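(* Let $A$ be a connected graded (not necessarily commutative) $k$-algebra. If $A$ is a classical complete intersection (cci), then $A$ is a complete intersection of growth type (gci); that is, if $A\cong C/(\Omega_1,\dots,\Omega_n)$ for some connected graded noetherian Artin–Schelter regular algebra $C$ and some regular sequence of normalizing homogeneous elements $\{\Omega_1,\dots,\Omega_n\}$ of positive degree in $C$, then the $\mathrm{Ext}$-algebra $E(A)=\bigoplus_{i\ge 0}\mathrm{Ext}^i_A(k,k)$ has finite Gelfand–Kirillov dimension.
   Context: $k$ is a field of characteristic zero; all algebras are over $k$. A graded algebra $A=\bigoplus_{i\ge0}A_i$ is connected graded if $A_0=k$; $k$ also denotes the trivial module $A/A_{\ge1}$. Elements of graded algebras are homogeneous. A sequence $\{\Omega_1,\dots,\Omega_n\}$ in $C$ is a regular sequence of normalizing elements if, for each $i$, the image $\overline{\Omega_i}$ of $\Omega_i$ in $\overline C=C/(\Omega_1,\dots,\Omega_{i-1})$ is a non-zero-divisor and is normal, i.e. $\overline{\Omega_i}\,\overline C=\overline C\,\overline{\Omega_i}$. A connected graded algebra $C$ is Artin–Schelter (AS) Gorenstein if (a) it has finite injective dimension $d$ on the left and on the right; (b) $\mathrm{Ext}^i_C({}_Ck,{}_CC)=\mathrm{Ext}^i_C(k_C,C_C)=0$ for $i\ne d$; (c) $\mathrm{Ext}^d_C({}_Ck,{}_CC)\cong\mathrm{Ext}^d_C(k_C,C_C)\cong k(l)$ for some integer $l$. It is AS regular if moreover it has finite global dimension and finite Gelfand–Kirillov dimension. $E(A)$ is graded by cohomological degree, $E_i=\mathrm{Ext}^i_A(k,k)$.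 The Gelfand–Kirillov dimension of an $\mathbb N$-graded algebra $E$ is $\limsup_{n}\log_n\big(\dim_k\bigoplus_{i=0}^nE_i\big)$. *)

theory Defs
  imports
    "HOL-Algebra.Module"
    "HOL-Algebra.QuotRing"
    "HOL-Library.FSet"
    "HOL-Library.Extended_Nat"
    "HOL-Library.Extended_Real"
    "HOL-Library.Liminf_Limsup"
begin

section \<open>Modules over noncommutative rings\<close>

text \<open>
  The library locale \<^locale>\<open>Module.module\<close> needs a commutative ring of scalars. The record
  type of modules is reused below; as in the library, its fields for multiplication and one are
  irrelevant when the record stands for a module. The locale \<^locale>\<open>submodule\<close> makes
  sense over every ring. Right \<open>R\<close>-modules are left modules over \<open>opposite R\<close>.
\<close>

locale left_module = R?: ring R + M?: abelian_group M
  for R :: "('a, 'e) ring_scheme" (structure) and M :: "('a, 'm, 'f) module_scheme" (structure) +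
  assumes smult_closed:
      "\<lbrakk>a \<in> carrier R; x \<in> carrier M\<rbrakk> \<Longrightarrow> a \<odot>\<^bsub>M\<^esub> x \<in> carrier M"
    and smult_l_distr:
      "\<lbrakk>a \<in> carrier R; b \<in> carrier R; x \<in> carrier M\<rbrakk> \<Longrightarrow>
        (a \<oplus>\<^bsub>R\<^esub> b) \<odot>\<^bsub>M\<^esub> x = a \<odot>\<^bsub>M\<^esub> x \<oplus>\<^bsub>M\<^esub> b \<odot>\<^bsub>M\<^esub> x"
    and smult_r_distr:
      "\<lbrakk>a \<in> carrier R; x \<in> carrier M; y \<in> carrier M\<rbrakk> \<Longrightarrow>
        a \<odot>\<^bsub>M\<^esub> (x \<oplus>\<^bsub>M\<^esub> y) = a \<odot>\<^bsub>M\<^esub> x \<oplus>\<^bsub>M\<^esub> a \<odot>\<^bsub>M\<^esub> y"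
    and smult_assoc:
      "\<lbrakk>a \<in> carrier R; b \<in> carrier R; x \<in> carrier M\<rbrakk> \<Longrightarrow>
        (a \<otimes>\<^bsub>R\<^esub> b) \<odot>\<^bsub>M\<^esub> x = a \<odot>\<^bsub>M\<^esub> (b \<odot>\<^bsub>M\<^esub> x)"
    and smult_one: "x \<in> carrier M \<Longrightarrow> \<one>\<^bsub>R\<^esub> \<odot>\<^bsub>M\<^esub> x = x"

definition opposite :: "('a, 'e) ring_scheme \<Rightarrow> ('a, 'e) ring_scheme" where
  "opposite R = R\<lparr>mult := (\<lambda>x y. y \<otimes>\<^bsub>R\<^esub> x)\<rparr>"

definition regular_module :: "('a, 'e) ring_scheme \<Rightarrow> ('a, 'a) module" where
  "regular_module R = ring.extend (ring.truncate R) (module.fields (\<lambda>a x. a \<otimes>\<^bsub>R\<^esub> x))"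

definition lin_maps ::
  "('r, 'e) ring_scheme \<Rightarrow> ('r, 'm) module \<Rightarrow> ('r, 'n) module \<Rightarrow> ('m \<Rightarrow> 'n) set" where
  "lin_maps R M N = {f \<in> carrier M \<rightarrow>\<^sub>E carrier N.
     (\<forall>x\<in>carrier M. \<forall>y\<in>carrier M. f (x \<oplus>\<^bsub>M\<^esub> y) = f x \<oplus>\<^bsub>N\<^esub> f y) \<and>
     (\<forall>r\<in>carrier R. \<forall>x\<in>carrier M. f (r \<odot>\<^bsub>M\<^esub> x) = r \<odot>\<^bsub>N\<^esub> f x)}"

definition zero_module :: "('r, 'm) module \<Rightarrow> bool" where
  "zero_module M \<longleftrightarrow> carrier M = {\<zero>\<^bsub>M\<^esub>}"

text \<open>
  The quotient by \<open>N\<close>. It serves for modules, for algebras (where \<open>N\<close> is a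
  two-sided ideal and the multiplication of cosets is the one of \<^const>\<open>FactRing\<close>)
  and for cohomology groups.
\<close>

definition quot_module :: "('r, 'm) module \<Rightarrow> 'm set \<Rightarrow> ('r, 'm set) module" where
  "quot_module M N = ring.extend (M Quot N)
     (module.fields (\<lambda>r S. \<Union>x\<in>S. N +>\<^bsub>M\<^esub> (r \<odot>\<^bsub>M\<^esub> x)))"

definition direct_sum :: "'i set \<Rightarrow> ('i \<Rightarrow> ('r, 'm) module) \<Rightarrow> ('r, 'i \<Rightarrow> 'm) module" where
  "direct_sum I V =
    \<lparr>carrier = {f \<in> (\<Pi>\<^sub>E i\<in>I. carrier (V i)). finite {i\<in>I. f i \<noteq> \<zero>\<^bsub>V i\<^esub>}},
     mult = undefined, one = undefined,
     zero = (\<lambda>i\<in>I. \<zero>\<^bsub>V i\<^esub>),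
     add = (\<lambda>f g. \<lambda>i\<in>I. f i \<oplus>\<^bsub>V i\<^esub> g i),
     smult = (\<lambda>r f. \<lambda>i\<in>I. r \<odot>\<^bsub>V i\<^esub> f i)\<rparr>"

definition free_module :: "('a, 'e) ring_scheme \<Rightarrow> 'x set \<Rightarrow> ('a, 'x \<Rightarrow> 'a) module" where
  "free_module R B = direct_sum B (\<lambda>_. regular_module R)"

text \<open>The linear map from the free module on \<open>B\<close> to \<open>M\<close> that sends the
  basis element \<open>x\<close> to \<open>v x\<close>:\<close>

definition free_lift ::
  "('a, 'e) ring_scheme \<Rightarrow> 'x set \<Rightarrow> ('a, 'm) module \<Rightarrow> ('x \<Rightarrow> 'm) \<Rightarrow> ('x \<Rightarrow> 'a) \<Rightarrow> 'm" where
  "free_lift R B M v =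
     (\<lambda>f\<in>carrier (free_module R B). \<Oplus>\<^bsub>M\<^esub>x\<in>{x\<in>B. f x \<noteq> \<zero>\<^bsub>R\<^esub>}. f x \<odot>\<^bsub>M\<^esub> v x)"

definition left_noetherian :: "('a, 'e) ring_scheme \<Rightarrow> bool" where
  "left_noetherian R \<longleftrightarrow>
     (\<forall>I. submodule I R (regular_module R) \<longrightarrow>
        (\<exists>S. finite S \<and> S \<subseteq> I \<and> I = \<Inter>{J. submodule J R (regular_module R) \<and> S \<subseteq> J}))"

definition noetherian :: "('a, 'e) ring_scheme \<Rightarrow> bool" where
  "noetherian R \<longleftrightarrow> left_noetherian R \<and> left_noetherian (opposite R)"


section \<open>Homological dimensions\<close>

text \<open>
  A definition in HOL cannot quantify over modules of all types. The modules over a ring on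
  \<open>'a\<close> that occur as test objects, or as terms of resolutions, are taken with
  carriers in \<open>'a set\<close>. If \<open>'a\<close> is infinite, as it is for nonzero
  algebras over a field of characteristic zero, this is no restriction: the type has room for
  a copy of every module of cardinality at most \<open>2 ^ |'a|\<close>. These include all cyclic
  modules (so all that Baer's criterion and Auslander's theorem on the global dimension need),
  and they are closed under free covers and under embeddings into injective modules.
\<close>

definition projective_module :: "('a, 'e) ring_scheme \<Rightarrow> ('a, 'a set) module \<Rightarrow> bool" where
  "projective_module R P \<longleftrightarrow> left_module R P \<and>
     (\<forall>(M :: ('a, 'a set) module) (N :: ('a, 'a set) module).
        left_module R M \<longrightarrow> left_module R N \<longrightarrow>
        (\<forall>f \<in> lin_maps R M N. f ` carrier M = carrier N \<longrightarrow>
          (\<forall>g \<in> lin_maps R P N. \<exists>h \<in> lin_maps R P M. \<forall>x\<in>carrier P. f (h x) = g x)))"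

definition injective_module :: "('a, 'e) ring_scheme \<Rightarrow> ('a, 'a set) module \<Rightarrow> bool" where
  "injective_module R I \<longleftrightarrow> left_module R I \<and>
     (\<forall>(M :: ('a, 'a set) module) (N :: ('a, 'a set) module).
        left_module R M \<longrightarrow> left_module R N \<longrightarrow>
        (\<forall>f \<in> lin_maps R M N. inj_on f (carrier M) \<longrightarrow>
          (\<forall>g \<in> lin_maps R M I. \<exists>h \<in> lin_maps R N I. \<forall>x\<in>carrier M. h (f x) = g x)))"

definition exact_at :: "('r, 'l) module \<Rightarrow> ('l \<Rightarrow> 'm) \<Rightarrow> ('r, 'm) module \<Rightarrow> ('m \<Rightarrow> 'n) \<Rightarrow>
    ('r, 'n) module \<Rightarrow> bool" where
  "exact_at L f M g N \<longleftrightarrow> f ` carrier L = {x \<in> carrier M. g x = \<zero>\<^bsub>N\<^esub>}"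

text \<open>\<open>\<dots> \<rightarrow> P 1 \<rightarrow> P 0 \<rightarrow> M \<rightarrow> 0\<close>,
  with \<open>d n\<close> from \<open>P (Suc n)\<close> to \<open>P n\<close>:\<close>

definition projective_resolution :: "('a, 'e) ring_scheme \<Rightarrow> ('a, 'm) module \<Rightarrow>
    (nat \<Rightarrow> ('a, 'a set) module) \<Rightarrow> (nat \<Rightarrow> 'a set \<Rightarrow> 'a set) \<Rightarrow> ('a set \<Rightarrow> 'm) \<Rightarrow> bool" where
  "projective_resolution R M P d \<epsilon> \<longleftrightarrow>
     (\<forall>n. projective_module R (P n)) \<and>
     \<epsilon> \<in> lin_maps R (P 0) M \<and> (\<forall>n. d n \<in> lin_maps R (P (Suc n)) (P n)) \<and>
     \<epsilon> ` carrier (P 0) = carrier M \<and>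
     exact_at (P 1) (d 0) (P 0) \<epsilon> M \<and>
     (\<forall>n. exact_at (P (Suc (Suc n))) (d (Suc n)) (P (Suc n)) (d n) (P n))"

text \<open>\<open>0 \<rightarrow> M \<rightarrow> I 0 \<rightarrow> I 1 \<rightarrow> \<dots>\<close>,
  with \<open>d n\<close> from \<open>I n\<close> to \<open>I (Suc n)\<close>:\<close>

definition injective_resolution :: "('a, 'e) ring_scheme \<Rightarrow> ('a, 'm) module \<Rightarrow>
    (nat \<Rightarrow> ('a, 'a set) module) \<Rightarrow> (nat \<Rightarrow> 'a set \<Rightarrow> 'a set) \<Rightarrow> ('m \<Rightarrow> 'a set) \<Rightarrow> bool" where
  "injective_resolution R M I d \<eta> \<longleftrightarrow>
     (\<forall>n. injective_module R (I n)) \<and>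
     \<eta> \<in> lin_maps R M (I 0) \<and> (\<forall>n. d n \<in> lin_maps R (I n) (I (Suc n))) \<and>
     inj_on \<eta> (carrier M) \<and>
     exact_at M \<eta> (I 0) (d 0) (I 1) \<and>
     (\<forall>n. exact_at (I n) (d n) (I (Suc n)) (d (Suc n)) (I (Suc (Suc n))))"

definition proj_dim :: "('a, 'e) ring_scheme \<Rightarrow> ('a, 'm) module \<Rightarrow> enat" where
  "proj_dim R M = Inf {enat l | l. \<exists>P d \<epsilon>. projective_resolution R M P d \<epsilon> \<and>
     (\<forall>n>l. zero_module (P n))}"

definition inj_dim :: "('a, 'e) ring_scheme \<Rightarrow> ('a, 'm) module \<Rightarrow> enat" where
  "inj_dim R M = Inf {enat l | l. \<exists>I d \<eta>. injective_resolution R M I d \<eta> \<and>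
     (\<forall>n>l. zero_module (I n))}"

definition gl_dim :: "('a, 'e) ring_scheme \<Rightarrow> enat" where
  "gl_dim R = (SUP M \<in> {M :: ('a, 'a set) module. left_module R M}. proj_dim R M)"


section \<open>Connected graded algebras\<close>

definition char_zero :: "('k, 'e) ring_scheme \<Rightarrow> bool" where
  "char_zero K \<longleftrightarrow> (\<forall>n::nat. 0 < n \<longrightarrow> [n] \<cdot>\<^bsub>K\<^esub> \<one>\<^bsub>K\<^esub> \<noteq> \<zero>\<^bsub>K\<^esub>)"

definition assoc_algebra :: "'k ring \<Rightarrow> ('k, 'a) module \<Rightarrow> bool" where
  "assoc_algebra K A \<longleftrightarrow> Ring.ring A \<and> Module.module K A \<and>
     (\<forall>c\<in>carrier K. \<forall>x\<in>carrier A. \<forall>y\<in>carrier A.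
        (c \<odot>\<^bsub>A\<^esub> x) \<otimes>\<^bsub>A\<^esub> y = c \<odot>\<^bsub>A\<^esub> (x \<otimes>\<^bsub>A\<^esub> y) \<and>
        x \<otimes>\<^bsub>A\<^esub> (c \<odot>\<^bsub>A\<^esub> y) = c \<odot>\<^bsub>A\<^esub> (x \<otimes>\<^bsub>A\<^esub> y))"

definition homogeneous_components :: "('a, 'e) ring_scheme \<Rightarrow> (nat \<Rightarrow> 'a set) \<Rightarrow> 'a \<Rightarrow> (nat \<Rightarrow> 'a) \<Rightarrow> bool"
  where
  "homogeneous_components A G x f \<longleftrightarrow>
     (\<forall>i. f i \<in> G i) \<and> finite {i. f i \<noteq> \<zero>\<^bsub>A\<^esub>} \<and>
     x = (\<Oplus>\<^bsub>A\<^esub>i\<in>{i. f i \<noteq> \<zero>\<^bsub>A\<^esub>}. f i)"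

definition graded_algebra :: "'k ring \<Rightarrow> ('k, 'a) module \<Rightarrow> (nat \<Rightarrow> 'a set) \<Rightarrow> bool" where
  "graded_algebra K A G \<longleftrightarrow> assoc_algebra K A \<and>
     (\<forall>i. submodule (G i) K A) \<and>
     (\<forall>x\<in>carrier A. \<exists>!f. homogeneous_components A G x f) \<and>
     (\<forall>i j. \<forall>x\<in>G i. \<forall>y\<in>G j. x \<otimes>\<^bsub>A\<^esub> y \<in> G (i + j)) \<and>
     \<one>\<^bsub>A\<^esub> \<in> G 0"

definition connected_graded :: "'k ring \<Rightarrow> ('k, 'a) module \<Rightarrow> (nat \<Rightarrow> 'a set) \<Rightarrow> bool" where
  "connected_graded K A G \<longleftrightarrow> graded_algebra K A G \<and>
     \<one>\<^bsub>A\<^esub> \<noteq> \<zero>\<^bsub>A\<^esub> \<and> G 0 = (\<lambda>c. c \<odot>\<^bsub>A\<^esub> \<one>\<^bsub>A\<^esub>) ` carrier K"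

text \<open>The sum of the components of positive degree:\<close>

definition aug_ideal :: "('a, 'e) ring_scheme \<Rightarrow> (nat \<Rightarrow> 'a set) \<Rightarrow> 'a set" where
  "aug_ideal A G = {x \<in> carrier A. \<exists>f. homogeneous_components A G x f \<and> f 0 = \<zero>\<^bsub>A\<^esub>}"

definition trivial_module :: "('a, 'e) ring_scheme \<Rightarrow> (nat \<Rightarrow> 'a set) \<Rightarrow> ('a, 'a set) module" where
  "trivial_module A G = quot_module (regular_module A) (aug_ideal A G)"

definition trivial_grading :: "('a, 'e) ring_scheme \<Rightarrow> (nat \<Rightarrow> 'a set) \<Rightarrow> int \<Rightarrow> 'a set set" where
  "trivial_grading A G i =
     (if i = 0 then carrier (trivial_module A G) else {\<zero>\<^bsub>trivial_module A G\<^esub>})"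

definition int_grading :: "('a, 'e) ring_scheme \<Rightarrow> (nat \<Rightarrow> 'a set) \<Rightarrow> int \<Rightarrow> 'a set" where
  "int_grading A G i = (if i < 0 then {\<zero>\<^bsub>A\<^esub>} else G (nat i))"

definition graded_algebra_iso :: "'k ring \<Rightarrow> ('k, 'b) module \<Rightarrow> (nat \<Rightarrow> 'b set) \<Rightarrow>
    ('k, 'a) module \<Rightarrow> (nat \<Rightarrow> 'a set) \<Rightarrow> ('b \<Rightarrow> 'a) \<Rightarrow> bool" where
  "graded_algebra_iso K B BG A AG \<phi> \<longleftrightarrow> \<phi> \<in> ring_iso B A \<and>
     (\<forall>c\<in>carrier K. \<forall>x\<in>carrier B. \<phi> (c \<odot>\<^bsub>B\<^esub> x) = c \<odot>\<^bsub>A\<^esub> \<phi> x) \<and>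
     (\<forall>i. \<phi> ` BG i = AG i)"

definition quot_grading :: "('r, 'c) module \<Rightarrow> (nat \<Rightarrow> 'c set) \<Rightarrow> 'c set \<Rightarrow> nat \<Rightarrow> 'c set set" where
  "quot_grading C G I i = (\<lambda>x. I +>\<^bsub>C\<^esub> x) ` G i"

definition regular_normalizing_sequence :: "('a, 'e) ring_scheme \<Rightarrow> 'a list \<Rightarrow> bool" where
  "regular_normalizing_sequence C \<Omega>s \<longleftrightarrow> set \<Omega>s \<subseteq> carrier C \<and>
     (\<forall>i<length \<Omega>s.
        let I = Idl\<^bsub>C\<^esub> (set (take i \<Omega>s)); D = C Quot I; w = I +>\<^bsub>C\<^esub> (\<Omega>s ! i) in
        (\<forall>x\<in>carrier D. w \<otimes>\<^bsub>D\<^esub> x = \<zero>\<^bsub>D\<^esub> \<or> x \<otimes>\<^bsub>D\<^esub> w = \<zero>\<^bsub>D\<^esub> \<longrightarrow> x = \<zero>\<^bsub>D\<^esub>) \<and>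
        w <#\<^bsub>D\<^esub> carrier D = carrier D #>\<^bsub>D\<^esub> w)"


section \<open>Ext\<close>

text \<open>
  \<open>Ext(M, N)\<close> is the cohomology of \<open>Hom(P, N)\<close>, where \<open>P\<close> is the
  canonical graded free resolution of the graded module \<open>M\<close>. Its term
  \<open>P\<^sub>0\<close> is free on the homogeneous elements of \<open>M\<close>, and
  \<open>P\<^sub>n\<^sub>+\<^sub>1\<close> is free on those formal linear combinations of the
  generators of \<open>P\<^sub>n\<close> that represent a homogeneous element of the kernel of
  \<open>P\<^sub>n \<rightarrow> P\<^sub>n\<^sub>-\<^sub>1\<close> (of \<open>P\<^sub>0 \<rightarrow> M\<close> if
  \<open>n = 0\<close>). Formal combinations are finite sets of pairs of a generator and a
  coefficient, so the generators of all terms fit into one datatype. The integer in a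
  generator is its degree.
\<close>

datatype ('a, 'm) gen = Elt int 'm | Comb int "(('a, 'm) gen \<times> 'a) fset"

fun gen_degree :: "('a, 'm) gen \<Rightarrow> int" where
  "gen_degree (Elt j m) = j"
| "gen_degree (Comb j S) = j"

fun gen_elt :: "('a, 'm) gen \<Rightarrow> 'm" where
  "gen_elt (Elt j m) = m"
| "gen_elt (Comb j S) = undefined"

text \<open>The element of the free module on \<open>B\<close> represented by a formal combination;
  coefficients of repeated generators add up.\<close>

definition comb_value :: "('a, 'e) ring_scheme \<Rightarrow> ('a, 'm) gen set \<Rightarrow>
    (('a, 'm) gen \<times> 'a) fset \<Rightarrow> ('a, 'm) gen \<Rightarrow> 'a" where
  "comb_value R B S = (\<lambda>x\<in>B. \<Oplus>\<^bsub>R\<^esub>a\<in>{a. (x, a) \<in> fset S}. a)"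

fun gen_boundary :: "('a, 'e) ring_scheme \<Rightarrow> ('a, 'm) gen set \<Rightarrow> ('a, 'm) gen \<Rightarrow>
    ('a, 'm) gen \<Rightarrow> 'a" where
  "gen_boundary R B (Elt j m) = undefined"
| "gen_boundary R B (Comb j S) = comb_value R B S"

definition free_degree_part :: "('a, 'e) ring_scheme \<Rightarrow> (nat \<Rightarrow> 'a set) \<Rightarrow> ('a, 'm) gen set \<Rightarrow>
    int \<Rightarrow> (('a, 'm) gen \<Rightarrow> 'a) set" where
  "free_degree_part R G B j =
     {f \<in> carrier (free_module R B). \<forall>x\<in>B. f x \<in> int_grading R G (j - gen_degree x)}"

text \<open>The \<open>n\<close>-th entry consists of the generators of \<open>P\<^sub>n\<close> and the
  kernel of the map that leaves \<open>P\<^sub>n\<close>.\<close>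

primrec std_resolution :: "('a, 'e) ring_scheme \<Rightarrow> (nat \<Rightarrow> 'a set) \<Rightarrow> ('a, 'm) module \<Rightarrow>
    (int \<Rightarrow> 'm set) \<Rightarrow> nat \<Rightarrow> ('a, 'm) gen set \<times> (('a, 'm) gen \<Rightarrow> 'a) set" where
  "std_resolution R G M MG 0 =
     (let B = {Elt j m | j m. m \<in> MG j}
      in (B, {f \<in> carrier (free_module R B). free_lift R B M gen_elt f = \<zero>\<^bsub>M\<^esub>}))"
| "std_resolution R G M MG (Suc n) =
     (let (B, Z) = std_resolution R G M MG n;
          B' = {Comb j S | j S. fset S \<subseteq> B \<times> carrier R \<and>
                 comb_value R B S \<in> Z \<inter> free_degree_part R G B j}
      in (B', {f \<in> carrier (free_module R B').
                free_lift R B' (free_module R B) (gen_boundary R B) f = \<zero>\<^bsub>free_module R B\<^esub>}))"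

definition std_gens :: "('a, 'e) ring_scheme \<Rightarrow> (nat \<Rightarrow> 'a set) \<Rightarrow> ('a, 'm) module \<Rightarrow>
    (int \<Rightarrow> 'm set) \<Rightarrow> nat \<Rightarrow> ('a, 'm) gen set" where
  "std_gens R G M MG n = fst (std_resolution R G M MG n)"

definition std_term :: "('a, 'e) ring_scheme \<Rightarrow> (nat \<Rightarrow> 'a set) \<Rightarrow> ('a, 'm) module \<Rightarrow>
    (int \<Rightarrow> 'm set) \<Rightarrow> nat \<Rightarrow> ('a, ('a, 'm) gen \<Rightarrow> 'a) module" where
  "std_term R G M MG n = free_module R (std_gens R G M MG n)"

definition std_diff :: "('a, 'e) ring_scheme \<Rightarrow> (nat \<Rightarrow> 'a set) \<Rightarrow> ('a, 'm) module \<Rightarrow>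
    (int \<Rightarrow> 'm set) \<Rightarrow> nat \<Rightarrow> (('a, 'm) gen \<Rightarrow> 'a) \<Rightarrow> ('a, 'm) gen \<Rightarrow> 'a" where
  "std_diff R G M MG n =
     free_lift R (std_gens R G M MG (Suc n)) (std_term R G M MG n)
       (gen_boundary R (std_gens R G M MG n))"

text \<open>A second ring may act on \<open>N\<close>, by a function \<open>act\<close> that commutes
  with the action of \<open>R\<close>; it then acts on the modules of linear maps and on Ext.\<close>

definition Hom_module :: "('r, 'e) ring_scheme \<Rightarrow> ('r, 'm) module \<Rightarrow> ('r, 'n) module \<Rightarrow>
    ('s \<Rightarrow> 'n \<Rightarrow> 'n) \<Rightarrow> ('s, 'm \<Rightarrow> 'n) module" where
  "Hom_module R M N act =
    \<lparr>carrier = lin_maps R M N, mult = undefined, one = undefined,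
     zero = (\<lambda>x\<in>carrier M. \<zero>\<^bsub>N\<^esub>),
     add = (\<lambda>f g. \<lambda>x\<in>carrier M. f x \<oplus>\<^bsub>N\<^esub> g x),
     smult = (\<lambda>s f. \<lambda>x\<in>carrier M. act s (f x))\<rparr>"

definition Ext_cocycles :: "('a, 'e) ring_scheme \<Rightarrow> (nat \<Rightarrow> 'a set) \<Rightarrow> ('a, 'm) module \<Rightarrow>
    (int \<Rightarrow> 'm set) \<Rightarrow> ('a, 'n) module \<Rightarrow> nat \<Rightarrow> ((('a, 'm) gen \<Rightarrow> 'a) \<Rightarrow> 'n) set" where
  "Ext_cocycles R G M MG N n =
     {f \<in> lin_maps R (std_term R G M MG n) N.
        \<forall>p\<in>carrier (std_term R G M MG (Suc n)). f (std_diff R G M MG n p) = \<zero>\<^bsub>N\<^esub>}"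

fun Ext_coboundaries :: "('a, 'e) ring_scheme \<Rightarrow> (nat \<Rightarrow> 'a set) \<Rightarrow> ('a, 'm) module \<Rightarrow>
    (int \<Rightarrow> 'm set) \<Rightarrow> ('a, 'n) module \<Rightarrow> nat \<Rightarrow> ((('a, 'm) gen \<Rightarrow> 'a) \<Rightarrow> 'n) set" where
  "Ext_coboundaries R G M MG N 0 = {\<lambda>p\<in>carrier (std_term R G M MG 0). \<zero>\<^bsub>N\<^esub>}"
| "Ext_coboundaries R G M MG N (Suc n) =
     (\<lambda>g. compose (carrier (std_term R G M MG (Suc n))) g (std_diff R G M MG n)) `
       lin_maps R (std_term R G M MG n) N"

definition Ext :: "('a, 'e) ring_scheme \<Rightarrow> (nat \<Rightarrow> 'a set) \<Rightarrow> ('a, 'm) module \<Rightarrow>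
    (int \<Rightarrow> 'm set) \<Rightarrow> ('a, 'n) module \<Rightarrow> ('s \<Rightarrow> 'n \<Rightarrow> 'n) \<Rightarrow> nat \<Rightarrow>
    ('s, ((('a, 'm) gen \<Rightarrow> 'a) \<Rightarrow> 'n) set) module" where
  "Ext R G M MG N act n =
     quot_module
       ((Hom_module R (std_term R G M MG n) N act)\<lparr>carrier := Ext_cocycles R G M MG N n\<rparr>)
       (Ext_coboundaries R G M MG N n)"

text \<open>The classes of those cocycles that are homogeneous of degree \<open>j\<close> with
  respect to the internal grading:\<close>

definition Ext_degree_part :: "('a, 'e) ring_scheme \<Rightarrow> (nat \<Rightarrow> 'a set) \<Rightarrow> ('a, 'm) module \<Rightarrow>
    (int \<Rightarrow> 'm set) \<Rightarrow> ('a, 'n) module \<Rightarrow> (int \<Rightarrow> 'n set) \<Rightarrow> ('s \<Rightarrow> 'n \<Rightarrow> 'n) \<Rightarrow> nat \<Rightarrow> int \<Rightarrow>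
    ((('a, 'm) gen \<Rightarrow> 'a) \<Rightarrow> 'n) set set" where
  "Ext_degree_part R G M MG N NG act n j =
     {Ext_coboundaries R G M MG N n +>\<^bsub>Hom_module R (std_term R G M MG n) N act\<^esub> f | f.
        f \<in> Ext_cocycles R G M MG N n \<and>
        (\<forall>i. \<forall>p \<in> free_degree_part R G (std_gens R G M MG n) i. f p \<in> NG (i + j))}"


section \<open>Artin--Schelter conditions\<close>

text \<open>\<open>Ext(k, C)\<close> for left modules, with the right action of \<open>C\<close> that
  comes from right multiplication on the second argument. Replacing \<open>C\<close> by
  \<open>opposite C\<close> exchanges left and right throughout.\<close>

definition Ext_k_C :: "('a, 'e) ring_scheme \<Rightarrow> (nat \<Rightarrow> 'a set) \<Rightarrow> nat \<Rightarrow>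
    ('a, ((('a, 'a set) gen \<Rightarrow> 'a) \<Rightarrow> 'a) set) module" where
  "Ext_k_C C G n =
     Ext C G (trivial_module C G) (trivial_grading C G) (regular_module C)
       (\<lambda>c x. x \<otimes>\<^bsub>C\<^esub> c) n"

definition Ext_k_C_degree_part :: "('a, 'e) ring_scheme \<Rightarrow> (nat \<Rightarrow> 'a set) \<Rightarrow> nat \<Rightarrow> int \<Rightarrow>
    ((('a, 'a set) gen \<Rightarrow> 'a) \<Rightarrow> 'a) set set" where
  "Ext_k_C_degree_part C G n j =
     Ext_degree_part C G (trivial_module C G) (trivial_grading C G) (regular_module C)
       (int_grading C G) (\<lambda>c x. x \<otimes>\<^bsub>C\<^esub> c) n j"

text \<open>An isomorphism of graded right \<open>C\<close>-modules from \<open>Ext^d(k, C)\<close> to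
  \<open>k(l)\<close>, where \<open>k(l)\<^sub>j = k\<^sub>l\<^sub>+\<^sub>j\<close>:\<close>

definition Ext_iso_shifted_k :: "('a, 'e) ring_scheme \<Rightarrow> (nat \<Rightarrow> 'a set) \<Rightarrow> nat \<Rightarrow> int \<Rightarrow> bool" where
  "Ext_iso_shifted_k C G d l \<longleftrightarrow>
     (\<exists>\<phi> \<in> lin_maps (opposite C) (Ext_k_C C G d) (trivial_module (opposite C) G).
        bij_betw \<phi> (carrier (Ext_k_C C G d)) (carrier (trivial_module (opposite C) G)) \<and>
        (\<forall>j. \<phi> ` Ext_k_C_degree_part C G d j = trivial_grading (opposite C) G (l + j)))"

definition AS_Gorenstein :: "('a, 'e) ring_scheme \<Rightarrow> (nat \<Rightarrow> 'a set) \<Rightarrow> bool" where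
  "AS_Gorenstein C G \<longleftrightarrow>
     (\<exists>(d::nat) (l::int).
        (inj_dim C (regular_module C) = enat d \<and>
         inj_dim (opposite C) (regular_module (opposite C)) = enat d) \<and>
        (\<forall>i. i \<noteq> d \<longrightarrow> zero_module (Ext_k_C C G i) \<and> zero_module (Ext_k_C (opposite C) G i)) \<and>
        Ext_iso_shifted_k C G d l \<and> Ext_iso_shifted_k (opposite C) G d l)"


section \<open>Gelfand--Kirillov dimension\<close>

definition finite_basis :: "'k ring \<Rightarrow> ('k, 'v) module \<Rightarrow> 'v set \<Rightarrow> bool" where
  "finite_basis K V B \<longleftrightarrow> finite B \<and> B \<subseteq> carrier V \<and>
     (\<forall>v\<in>carrier V. \<exists>!c. c \<in> B \<rightarrow>\<^sub>E carrier K \<and> v = (\<Oplus>\<^bsub>V\<^esub>b\<in>B. c b \<odot>\<^bsub>V\<^esub> b))"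

text \<open>\<open>\<infinity>\<close> if there is no finite basis; otherwise all bases have the same size.\<close>

definition vs_dim :: "'k ring \<Rightarrow> ('k, 'v) module \<Rightarrow> enat" where
  "vs_dim K V = Inf {enat (card B) | B. finite_basis K V B}"

definition log_enat :: "nat \<Rightarrow> enat \<Rightarrow> ereal" where
  "log_enat n m = (case m of enat r \<Rightarrow> if r = 0 then -\<infinity> else ereal (log (real n) (real r)) | \<infinity> \<Rightarrow> \<infinity>)"

text \<open>The Gelfand--Kirillov dimension of a graded algebra depends only on the family of its
  homogeneous components. The values at \<open>n \<le> 1\<close> do not affect the limit.\<close>

definition GK_dim :: "'k ring \<Rightarrow> (nat \<Rightarrow> ('k, 'v) module) \<Rightarrow> ereal" where
  "GK_dim K E = limsup (\<lambda>n. log_enat n (vs_dim K (direct_sum {0..n} E)))"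

definition AS_regular :: "'k ring \<Rightarrow> ('k, 'a) module \<Rightarrow> (nat \<Rightarrow> 'a set) \<Rightarrow> bool" where
  "AS_regular K C G \<longleftrightarrow> AS_Gorenstein C G \<and>
     gl_dim C < \<infinity> \<and> gl_dim (opposite C) < \<infinity> \<and>
     GK_dim K (\<lambda>i. C\<lparr>carrier := G i\<rparr>) < \<infinity>"

text \<open>The \<open>i\<close>-th component of the Ext-algebra of \<open>A\<close>, as a vector space over \<open>K\<close>:\<close>

definition Ext_algebra_component :: "('k, 'a) module \<Rightarrow> (nat \<Rightarrow> 'a set) \<Rightarrow> nat \<Rightarrow>
    ('k, ((('a, 'a set) gen \<Rightarrow> 'a) \<Rightarrow> 'a set) set) module" where
  "Ext_algebra_component A G i =
     Ext A G (trivial_module A G) (trivial_grading A G) (trivial_module A G)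
       (smult (quot_module A (aug_ideal A G))) i"

end

(* Only the ranks of free resolutions matter, and these resolutions need not be graded. Over the
   noetherian ring C of finite global dimension the trivial module k has a free resolution of
   bounded ranks. Let w be a regular normal element of B and m the augmentation ideal. Reducing a
   resolution of m modulo w resolves m/wm over B/w, and in the exact sequence
   0 -> wB/wm -> m/wm -> m/wB -> 0 the left term is isomorphic to B/m = k. The mapping cone
   therefore bounds the n-th rank for m/wB by the n-th rank for m plus the (n-2)-nd rank for m/wB
   itself, so that dividing by a regular normalizing sequence keeps the growth of the ranks
   polynomial. The ranks for the trivial module bound the dimensions of Ext^n(k, k). *)
theory Submission
  imports Defs
begin

section \<open>Linear maps and free modules\<close>

text \<open>The module reduced modulo w is m and not k, because w must act injectively: it does so
  on submodules of free modules, hence on m, but it kills k. The isomorphism of B/m with wB/wm is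
  right multiplication by w, which is left linear; that it matches m with wm requires the twist c ->
  c' given by wc = c'w to preserve m, and here the homogeneity of w and of the ideals divided out
  enters. The shift by two arises once from the cone and once from passing from k to its syzygy
  m/wB. The recursion therefore adds about n/2 old ranks, and each element divided out raises the
  exponent of the bound by one. The obstacle at both ends is that the given resolutions are too
  large. Finite global dimension supplies projective modules of arbitrary size, and
  \<open>Ext\<close> is computed from a standard resolution with infinitely many generators in each
  term. Instead of minimal resolutions, syzygies are compared as direct summands up to maps through
  a free or projective module. This relation is obtained by lifting alone and suffices to carry
  finiteness over.\<close>

lemma left_moduleI:
  assumes "ring R" "abelian_group M"
    and "\<And>a x. a \<in> carrier R \<Longrightarrow> x \<in> carrier M \<Longrightarrow> a \<odot>\<^bsub>M\<^esub> x \<in> carrier M"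
    and "\<And>a b x. a \<in> carrier R \<Longrightarrow> b \<in> carrier R \<Longrightarrow> x \<in> carrier M \<Longrightarrow>
        (a \<oplus>\<^bsub>R\<^esub> b) \<odot>\<^bsub>M\<^esub> x = a \<odot>\<^bsub>M\<^esub> x \<oplus>\<^bsub>M\<^esub> b \<odot>\<^bsub>M\<^esub> x"
    and "\<And>a x y. a \<in> carrier R \<Longrightarrow> x \<in> carrier M \<Longrightarrow> y \<in> carrier M \<Longrightarrow>
        a \<odot>\<^bsub>M\<^esub> (x \<oplus>\<^bsub>M\<^esub> y) = a \<odot>\<^bsub>M\<^esub> x \<oplus>\<^bsub>M\<^esub> a \<odot>\<^bsub>M\<^esub> y"
    and "\<And>a b x. a \<in> carrier R \<Longrightarrow> b \<in> carrier R \<Longrightarrow> x \<in> carrier M \<Longrightarrow>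
        (a \<otimes>\<^bsub>R\<^esub> b) \<odot>\<^bsub>M\<^esub> x = a \<odot>\<^bsub>M\<^esub> (b \<odot>\<^bsub>M\<^esub> x)"
    and "\<And>x. x \<in> carrier M \<Longrightarrow> \<one>\<^bsub>R\<^esub> \<odot>\<^bsub>M\<^esub> x = x"
  shows "left_module R M"
  using assms by (simp add: left_module_def left_module_axioms_def)

context left_module begin

lemma smult_l_null: "x \<in> carrier M \<Longrightarrow> \<zero> \<odot>\<^bsub>M\<^esub> x = \<zero>\<^bsub>M\<^esub>"
  using smult_l_distr[of \<zero> \<zero> x] smult_closed[of \<zero> x] by simp

lemma smult_r_null: "a \<in> carrier R \<Longrightarrow> a \<odot>\<^bsub>M\<^esub> \<zero>\<^bsub>M\<^esub> = \<zero>\<^bsub>M\<^esub>"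
  using smult_r_distr[of a "\<zero>\<^bsub>M\<^esub>" "\<zero>\<^bsub>M\<^esub>"] smult_closed[of a "\<zero>\<^bsub>M\<^esub>"] by simp

lemma smult_l_minus:
  "a \<in> carrier R \<Longrightarrow> x \<in> carrier M \<Longrightarrow> (\<ominus> a) \<odot>\<^bsub>M\<^esub> x = \<ominus>\<^bsub>M\<^esub> (a \<odot>\<^bsub>M\<^esub> x)"
  using smult_l_distr[of "\<ominus> a" a x] smult_closed[of a x] smult_closed[of "\<ominus> a" x]
  by (simp add: R.l_neg smult_l_null M.minus_equality)

lemma smult_r_minus:
  "a \<in> carrier R \<Longrightarrow> x \<in> carrier M \<Longrightarrow> a \<odot>\<^bsub>M\<^esub> (\<ominus>\<^bsub>M\<^esub> x) = \<ominus>\<^bsub>M\<^esub> (a \<odot>\<^bsub>M\<^esub> x)"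
  using smult_r_distr[of a "\<ominus>\<^bsub>M\<^esub> x" x] smult_closed[of a x] smult_closed[of a "\<ominus>\<^bsub>M\<^esub> x"]
  by (simp add: M.l_neg smult_r_null M.minus_equality)

lemma submodI:
  assumes "H \<subseteq> carrier M" "\<zero>\<^bsub>M\<^esub> \<in> H"
    and add: "\<And>x y. x \<in> H \<Longrightarrow> y \<in> H \<Longrightarrow> x \<oplus>\<^bsub>M\<^esub> y \<in> H"
    and smult: "\<And>a x. a \<in> carrier R \<Longrightarrow> x \<in> H \<Longrightarrow> a \<odot>\<^bsub>M\<^esub> x \<in> H"
  shows "submodule H R M"
proof -
  have "\<ominus>\<^bsub>M\<^esub> x \<in> H" if "x \<in> H" for x
    using smult[of "\<ominus> \<one>" x] that assms(1) smult_l_minus[of \<one> x] smult_one[of x] by auto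
  then have "subgroup H (add_monoid M)"
    using assms by (intro M.add.subgroupI) auto
  then show ?thesis
    using smult by (simp add: submodule_def submodule_axioms_def)
qed

lemma
  assumes "submodule H R M"
  shows submod_subset: "H \<subseteq> carrier M"
    and submod_carrier: "\<And>x. x \<in> H \<Longrightarrow> x \<in> carrier M"
    and submod_zero: "\<zero>\<^bsub>M\<^esub> \<in> H"
    and submod_add: "\<And>x y. x \<in> H \<Longrightarrow> y \<in> H \<Longrightarrow> x \<oplus>\<^bsub>M\<^esub> y \<in> H"
    and submod_neg: "\<And>x. x \<in> H \<Longrightarrow> \<ominus>\<^bsub>M\<^esub> x \<in> H"
    and submod_smult: "\<And>a x. a \<in> carrier R \<Longrightarrow> x \<in> H \<Longrightarrow> a \<odot>\<^bsub>M\<^esub> x \<in> H"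
proof -
  interpret subgroup H "add_monoid M"
    using assms by (simp add: submodule_def)
  show "H \<subseteq> carrier M" "\<And>x. x \<in> H \<Longrightarrow> x \<in> carrier M" "\<zero>\<^bsub>M\<^esub> \<in> H"
    "\<And>x y. x \<in> H \<Longrightarrow> y \<in> H \<Longrightarrow> x \<oplus>\<^bsub>M\<^esub> y \<in> H" "\<And>x. x \<in> H \<Longrightarrow> \<ominus>\<^bsub>M\<^esub> x \<in> H"
    using subset one_closed m_closed m_inv_closed by (auto simp: a_inv_def)
  show "\<And>a x. a \<in> carrier R \<Longrightarrow> x \<in> H \<Longrightarrow> a \<odot>\<^bsub>M\<^esub> x \<in> H"
    using assms by (simp add: submodule_def submodule_axioms_def)
qed

lemma submod_minus: "submodule H R M \<Longrightarrow> x \<in> H \<Longrightarrow> y \<in> H \<Longrightarrow> x \<ominus>\<^bsub>M\<^esub> y \<in> H"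
  by (simp add: a_minus_def submod_add submod_neg)

lemma submod_add_cancel:
  assumes "submodule H R M" "x \<in> H" "y \<in> carrier M"
  shows "x \<oplus>\<^bsub>M\<^esub> y \<in> H \<longleftrightarrow> y \<in> H" "y \<oplus>\<^bsub>M\<^esub> x \<in> H \<longleftrightarrow> y \<in> H"
proof -
  have x: "x \<in> carrier M" using assms by (simp add: submod_carrier)
  have "\<ominus>\<^bsub>M\<^esub> x \<oplus>\<^bsub>M\<^esub> (x \<oplus>\<^bsub>M\<^esub> y) = y" using x assms(3) by (simp add: M.r_neg1)
  then show 1: "x \<oplus>\<^bsub>M\<^esub> y \<in> H \<longleftrightarrow> y \<in> H"
    using assms by (metis submod_add submod_neg)
  then show "y \<oplus>\<^bsub>M\<^esub> x \<in> H \<longleftrightarrow> y \<in> H"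
    using x assms(3) by (simp add: M.a_comm)
qed

lemma submod_carrier_self: "submodule (carrier M) R M"
  by (rule submodI) (auto simp: smult_closed)

lemma submod_null: "submodule {\<zero>\<^bsub>M\<^esub>} R M"
  by (rule submodI) (auto simp: smult_r_null)

lemma submod_Int: "submodule H R M \<Longrightarrow> submodule H' R M \<Longrightarrow> submodule (H \<inter> H') R M"
  by (rule submodI) (auto simp: submod_zero submod_add submod_smult submod_carrier)

end

text \<open>\<open>lin_maps\<close> consists of extensional functions on whole carriers. Here domain
  and codomain are subsets and values elsewhere are arbitrary, so one function can be restricted,
  corestricted and composed without being changed.\<close>

definition lin_on :: "('r, 'e) ring_scheme \<Rightarrow> ('r, 'm, 'f) module_scheme \<Rightarrow> 'm set \<Rightarrow>
    ('r, 'n, 'g) module_scheme \<Rightarrow> 'n set \<Rightarrow> ('m \<Rightarrow> 'n) \<Rightarrow> bool" where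
  "lin_on R M X N Y f \<longleftrightarrow> (\<forall>x\<in>X. f x \<in> Y) \<and>
     (\<forall>x\<in>X. \<forall>y\<in>X. f (x \<oplus>\<^bsub>M\<^esub> y) = f x \<oplus>\<^bsub>N\<^esub> f y) \<and>
     (\<forall>a\<in>carrier R. \<forall>x\<in>X. f (a \<odot>\<^bsub>M\<^esub> x) = a \<odot>\<^bsub>N\<^esub> f x)"

lemma lin_onI:
  assumes "\<And>x. x \<in> X \<Longrightarrow> f x \<in> Y"
    and "\<And>x y. x \<in> X \<Longrightarrow> y \<in> X \<Longrightarrow> f (x \<oplus>\<^bsub>M\<^esub> y) = f x \<oplus>\<^bsub>N\<^esub> f y"
    and "\<And>a x. a \<in> carrier R \<Longrightarrow> x \<in> X \<Longrightarrow> f (a \<odot>\<^bsub>M\<^esub> x) = a \<odot>\<^bsub>N\<^esub> f x"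
  shows "lin_on R M X N Y f"
  using assms by (simp add: lin_on_def)

lemma
  assumes "lin_on R M X N Y f"
  shows lin_on_mem: "x \<in> X \<Longrightarrow> f x \<in> Y"
    and lin_on_add: "x \<in> X \<Longrightarrow> y \<in> X \<Longrightarrow> f (x \<oplus>\<^bsub>M\<^esub> y) = f x \<oplus>\<^bsub>N\<^esub> f y"
    and lin_on_smult: "a \<in> carrier R \<Longrightarrow> x \<in> X \<Longrightarrow> f (a \<odot>\<^bsub>M\<^esub> x) = a \<odot>\<^bsub>N\<^esub> f x"
  using assms by (simp_all add: lin_on_def)

lemma lin_on_subset:
  assumes "lin_on R M X N Y f" "X' \<subseteq> X" "\<And>x. x \<in> X' \<Longrightarrow> f x \<in> Y'"
  shows "lin_on R M X' N Y' f"
  using assms unfolding lin_on_def by (meson subsetD)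

lemma lin_on_id: "lin_on R M X M X (\<lambda>x. x)"
  by (simp add: lin_on_def)

lemma lin_on_comp:
  assumes "lin_on R M X N Y f" "lin_on R N Y P Z g"
  shows "lin_on R M X P Z (\<lambda>x. g (f x))"
  using assms by (simp add: lin_on_def)

lemma lin_on_zero:
  assumes "left_module R M" "left_module R N" "submodule X R M" "submodule Y R N" "lin_on R M X N Y f"
  shows "f \<zero>\<^bsub>M\<^esub> = \<zero>\<^bsub>N\<^esub>"
proof -
  interpret M: left_module R M by fact
  interpret N: left_module R N by fact
  have z: "\<zero>\<^bsub>M\<^esub> \<in> X" using assms(3) by (rule M.submod_zero)
  have "f \<zero>\<^bsub>M\<^esub> \<in> carrier N" using assms(4,5) z lin_on_mem N.submod_carrier by metis
  moreover have "f (\<zero>\<^bsub>R\<^esub> \<odot>\<^bsub>M\<^esub> \<zero>\<^bsub>M\<^esub>) = \<zero>\<^bsub>R\<^esub> \<odot>\<^bsub>N\<^esub> f \<zero>\<^bsub>M\<^esub>"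
    using lin_on_smult[OF assms(5)] z by simp
  ultimately show ?thesis by (simp add: M.smult_l_null N.smult_l_null)
qed

lemma lin_on_neg:
  assumes "left_module R M" "left_module R N" "submodule X R M" "submodule Y R N" "lin_on R M X N Y f" "x \<in> X"
  shows "f (\<ominus>\<^bsub>M\<^esub> x) = \<ominus>\<^bsub>N\<^esub> f x"
proof -
  interpret M: left_module R M by fact
  interpret N: left_module R N by fact
  have x: "x \<in> carrier M" "f x \<in> carrier N"
    using assms lin_on_mem M.submod_carrier N.submod_carrier by metis+
  have "f ((\<ominus>\<^bsub>R\<^esub> \<one>\<^bsub>R\<^esub>) \<odot>\<^bsub>M\<^esub> x) = (\<ominus>\<^bsub>R\<^esub> \<one>\<^bsub>R\<^esub>) \<odot>\<^bsub>N\<^esub> f x"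
    using lin_on_smult[OF assms(5)] assms(6) by simp
  then show ?thesis using x by (simp add: M.smult_l_minus N.smult_l_minus M.smult_one N.smult_one)
qed

lemma lin_on_minus:
  assumes "left_module R M" "left_module R N" "submodule X R M" "submodule Y R N" "lin_on R M X N Y f" "x \<in> X" "y \<in> X"
  shows "f (x \<ominus>\<^bsub>M\<^esub> y) = f x \<ominus>\<^bsub>N\<^esub> f y"
  using assms by (simp add: a_minus_def lin_on_add[OF assms(5)] left_module.submod_neg[OF assms(1,3)] lin_on_neg[OF assms(1-5)])

lemma lin_on_plus:
  assumes "left_module R M" "left_module R N" "submodule X R M" "submodule Y R N"
    "lin_on R M X N Y f" "lin_on R M X N Y g"
  shows "lin_on R M X N Y (\<lambda>x. f x \<oplus>\<^bsub>N\<^esub> g x)"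
proof -
  interpret M: left_module R M by fact
  interpret N: left_module R N by fact
  have c: "f x \<in> carrier N" "g x \<in> carrier N" if "x \<in> X" for x
    using that assms lin_on_mem N.submod_carrier by metis+
  show ?thesis
    by (rule lin_onI) (simp_all add: c N.submod_add[OF assms(4)] lin_on_mem[OF assms(5)] lin_on_mem[OF assms(6)]
      lin_on_add[OF assms(5)] lin_on_add[OF assms(6)] lin_on_smult[OF assms(5)] lin_on_smult[OF assms(6)]
      N.smult_r_distr N.a_ac)
qed

lemma lin_on_uminus:
  assumes "left_module R M" "left_module R N" "submodule X R M" "submodule Y R N" "lin_on R M X N Y f"
  shows "lin_on R M X N Y (\<lambda>x. \<ominus>\<^bsub>N\<^esub> f x)"
proof -
  interpret M: left_module R M by fact
  interpret N: left_module R N by fact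
  have c: "f x \<in> carrier N" if "x \<in> X" for x
    using that assms lin_on_mem N.submod_carrier by metis+
  show ?thesis
    by (rule lin_onI) (simp_all add: c N.submod_neg[OF assms(4)] lin_on_mem[OF assms(5)]
      lin_on_add[OF assms(5)] lin_on_smult[OF assms(5)] N.smult_r_minus N.minus_add)
qed

lemma lin_on_diff:
  assumes "left_module R M" "left_module R N" "submodule X R M" "submodule Y R N"
    "lin_on R M X N Y f" "lin_on R M X N Y g"
  shows "lin_on R M X N Y (\<lambda>x. f x \<ominus>\<^bsub>N\<^esub> g x)"
  unfolding a_minus_def using assms lin_on_plus lin_on_uminus by blast

lemma submod_vimage:
  assumes "left_module R M" "left_module R N" "submodule X R M" "submodule Y R N" "submodule Z R N"
    "lin_on R M X N Y f"
  shows "submodule {x \<in> X. f x \<in> Z} R M"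
proof -
  interpret M: left_module R M by fact
  interpret N: left_module R N by fact
  show ?thesis
    using lin_on_zero[OF assms(1-4,6)]
    by (intro M.submodI) (auto simp: M.submod_carrier[OF assms(3)] M.submod_zero[OF assms(3)] N.submod_zero[OF assms(5)]
       M.submod_add[OF assms(3)] lin_on_add[OF assms(6)] N.submod_add[OF assms(5)]
       M.submod_smult[OF assms(3)] N.submod_smult[OF assms(5)] lin_on_smult[OF assms(6)])
qed

lemma submod_image:
  assumes "left_module R M" "left_module R N" "submodule X R M" "submodule Y R N"
    "lin_on R M X N Y f"
  shows "submodule (f ` X) R N"
proof -
  interpret M: left_module R M by fact
  interpret N: left_module R N by fact
  show ?thesis
  proof (rule N.submodI)
    show "f ` X \<subseteq> carrier N" using lin_on_mem[OF assms(5)] N.submod_carrier[OF assms(4)] by blast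
    show "\<zero>\<^bsub>N\<^esub> \<in> f ` X" using imageI[OF M.submod_zero[OF assms(3)], of f] lin_on_zero[OF assms] by simp
    fix x y assume "x \<in> f ` X" "y \<in> f ` X"
    then show "x \<oplus>\<^bsub>N\<^esub> y \<in> f ` X"
      by (auto simp: lin_on_add[OF assms(5), symmetric] M.submod_add[OF assms(3)])
  next
    fix a x assume "a \<in> carrier R" "x \<in> f ` X"
    then show "a \<odot>\<^bsub>N\<^esub> x \<in> f ` X"
      by (auto simp: lin_on_smult[OF assms(5), symmetric] M.submod_smult[OF assms(3)])
  qed
qed

text \<open>
  The ambient module of all sequences makes the free modules of all finite ranks submodules of one
  module: \<open>R\<^sup>k\<close> is \<open>fr R k\<close>, and \<open>fI R I k\<close> is \<open>I\<^sup>k\<close>.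
\<close>

definition seqs :: "('a, 'e) ring_scheme \<Rightarrow> ('a, nat \<Rightarrow> 'a) module" where
  "seqs R = \<lparr>carrier = {v. \<forall>i. v i \<in> carrier R}, mult = undefined, one = undefined,
     zero = (\<lambda>_. \<zero>\<^bsub>R\<^esub>), add = (\<lambda>v w i. v i \<oplus>\<^bsub>R\<^esub> w i), smult = (\<lambda>a v i. a \<otimes>\<^bsub>R\<^esub> v i)\<rparr>"

lemma seqs_simps [simp]:
  "v \<in> carrier (seqs R) \<longleftrightarrow> (\<forall>i. v i \<in> carrier R)"
  "zero (seqs R) = (\<lambda>_. \<zero>\<^bsub>R\<^esub>)"
  "(v \<oplus>\<^bsub>seqs R\<^esub> w) i = v i \<oplus>\<^bsub>R\<^esub> w i"
  "(a \<odot>\<^bsub>seqs R\<^esub> v) i = a \<otimes>\<^bsub>R\<^esub> v i"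
  by (simp_all add: seqs_def)

definition fr :: "('a, 'e) ring_scheme \<Rightarrow> nat \<Rightarrow> (nat \<Rightarrow> 'a) set" where
  "fr R k = {v. (\<forall>i. v i \<in> carrier R) \<and> (\<forall>i\<ge>k. v i = \<zero>\<^bsub>R\<^esub>)}"

definition fI :: "('a, 'e) ring_scheme \<Rightarrow> 'a set \<Rightarrow> nat \<Rightarrow> (nat \<Rightarrow> 'a) set" where
  "fI R I k = {v \<in> fr R k. \<forall>i. v i \<in> I}"

context ring begin

lemma left_module_seqs: "left_module R (seqs R)"
proof (rule left_moduleI)
  show "abelian_group (seqs R)"
  proof (rule abelian_groupI)
    fix x assume "x \<in> carrier (seqs R)"
    then show "\<exists>y\<in>carrier (seqs R). y \<oplus>\<^bsub>seqs R\<^esub> x = \<zero>\<^bsub>seqs R\<^esub>"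
      by (intro bexI[of _ "\<lambda>i. \<ominus> x i"]) (auto simp: l_neg)
  qed (auto simp: a_ac fun_eq_iff)
qed (auto simp: l_distr r_distr m_assoc ring_axioms fun_eq_iff)

sublocale V: left_module R "seqs R" by (rule left_module_seqs)

lemma seqs_neg: "v \<in> carrier (seqs R) \<Longrightarrow> \<ominus>\<^bsub>seqs R\<^esub> v = (\<lambda>i. \<ominus> v i)"
  by (rule V.minus_equality) (auto simp: l_neg fun_eq_iff)

lemma seqs_minus: "v \<in> carrier (seqs R) \<Longrightarrow> w \<in> carrier (seqs R) \<Longrightarrow> v \<ominus>\<^bsub>seqs R\<^esub> w = (\<lambda>i. v i \<ominus> w i)"
  by (simp add: a_minus_def seqs_neg fun_eq_iff)

lemma submod_fr: "submodule (fr R k) R (seqs R)"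
  by (rule V.submodI) (auto simp: fr_def)

lemma fr_mono: "k \<le> l \<Longrightarrow> fr R k \<subseteq> fr R l"
  by (auto simp: fr_def)

lemma fr_0: "fr R 0 = {\<lambda>_. \<zero>}"
  by (auto simp: fr_def)

lemma fI_zero: "fI R {\<zero>} k = {\<lambda>_. \<zero>}"
  by (auto simp: fI_def fr_def)

lemma fI_mono: "I \<subseteq> J \<Longrightarrow> fI R I k \<subseteq> fI R J k"
  by (auto simp: fI_def)

lemma submod_fI:
  assumes "ideal I R"
  shows "submodule (fI R I k) R (seqs R)"
proof -
  interpret I: ideal I R by fact
  show ?thesis
    using V.submod_add[OF submod_fr, of _ k] V.submod_smult[OF submod_fr, of _ _ k] V.submod_zero[OF submod_fr, of k]
    by (intro V.submodI) (auto simp: fI_def I.I_l_closed fr_def)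
qed

text \<open>The splitting of R^(k+1) into R^k and the span of the last basis vector, on which the
  inductions over the rank run.\<close>

lemma fr_decomp:
  assumes "c \<in> fr R (Suc k)"
  shows "c(k := \<zero>) \<in> fr R k" "c k \<in> carrier R" "(\<lambda>i. if i = k then \<one> else \<zero>) \<in> fr R (Suc k)"
    "c = c(k := \<zero>) \<oplus>\<^bsub>seqs R\<^esub> c k \<odot>\<^bsub>seqs R\<^esub> (\<lambda>i. if i = k then \<one> else \<zero>)"
  using assms by (auto simp: fr_def fun_eq_iff)

text \<open>One step of the universal property of free modules: \<open>y\<close> becomes the image
  of the new basis vector.\<close>

lemma extend_lin:
  assumes "left_module R N" "submodule Y R N" "lin_on R (seqs R) (fr R k) N Y p" "y \<in> Y"
  shows "lin_on R (seqs R) (fr R (Suc k)) N Y (\<lambda>c. p (c(k := \<zero>)) \<oplus>\<^bsub>N\<^esub> c k \<odot>\<^bsub>N\<^esub> y)"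
proof -
  interpret N: left_module R N by fact
  have Y: "\<And>x. x \<in> Y \<Longrightarrow> x \<in> carrier N" using assms(2) by (rule N.submod_carrier)
  have p: "p (c(k := \<zero>)) \<in> Y" "c k \<in> carrier R" if "c \<in> fr R (Suc k)" for c
    using that fr_decomp lin_on_mem[OF assms(3)] by blast+
  have 1: "(x \<oplus>\<^bsub>seqs R\<^esub> x')(k := \<zero>) = x(k := \<zero>) \<oplus>\<^bsub>seqs R\<^esub> x'(k := \<zero>)" for x x'
    by (auto simp: fun_eq_iff)
  have 2: "a \<in> carrier R \<Longrightarrow> (a \<odot>\<^bsub>seqs R\<^esub> x)(k := \<zero>) = a \<odot>\<^bsub>seqs R\<^esub> x(k := \<zero>)" for x a
    by (auto simp: fun_eq_iff)
  note [simp] = N.smult_closed fr_decomp(1) p Y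
  show ?thesis
  proof (rule lin_onI, goal_cases)
    case (1 x) then show ?case using assms(2,4) by (simp add: N.submod_add N.submod_smult)
  next
    case (2 x x')
    then show ?case using assms(4) unfolding 1
      by (subst lin_on_add[OF assms(3)]) (simp_all add: N.smult_l_distr N.a_ac)
  next
    case (3 a x)
    then show ?case using assms(4) unfolding 2[OF 3(1)]
      by (subst lin_on_smult[OF assms(3)]) (simp_all add: N.smult_r_distr N.smult_assoc)
  qed
qed

text \<open>Working modulo \<open>N'\<close> covers surjections onto quotients.\<close>

lemma fr_lift_mod:
  assumes "left_module R M" "left_module R N" "submodule K R M" "submodule K' R N" "submodule N' R N"
    "lin_on R M K N K' \<phi>" "lin_on R (seqs R) (fr R k) N K' q"
    and ex: "\<And>c. c \<in> fr R k \<Longrightarrow> \<exists>v\<in>K. \<exists>l\<in>N'. q c = \<phi> v \<oplus>\<^bsub>N\<^esub> l"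
  shows "\<exists>p. lin_on R (seqs R) (fr R k) M K p \<and> (\<forall>c\<in>fr R k. \<exists>l\<in>N'. q c = \<phi> (p c) \<oplus>\<^bsub>N\<^esub> l)"
  using assms(7) ex
proof (induction k)
  case 0
  interpret M: left_module R M by fact
  interpret N: left_module R N by fact
  have "q (\<lambda>_. \<zero>) = \<zero>\<^bsub>N\<^esub>" "\<phi> \<zero>\<^bsub>M\<^esub> = \<zero>\<^bsub>N\<^esub>"
    using lin_on_zero[OF V.left_module_axioms assms(2) submod_fr assms(4) 0(1)] lin_on_zero[OF assms(1-4,6)] by auto
  then show ?case
    by (intro exI[of _ "\<lambda>_. \<zero>\<^bsub>M\<^esub>"]) (auto simp: fr_0 lin_on_def M.smult_r_null
       M.submod_zero[OF assms(3)] N.submod_zero[OF assms(5)] intro!: bexI[of _ "\<zero>\<^bsub>N\<^esub>"])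
next
  case (Suc k)
  interpret M: left_module R M by fact
  interpret N: left_module R N by fact
  have "lin_on R (seqs R) (fr R k) N K' q"
    using Suc(2) by (rule lin_on_subset) (use fr_mono[of k "Suc k"] lin_on_mem[OF Suc(2)] in auto)
  moreover have "\<exists>v\<in>K. \<exists>l\<in>N'. q c = \<phi> v \<oplus>\<^bsub>N\<^esub> l" if "c \<in> fr R k" for c
    using Suc(3) that fr_mono[of k "Suc k"] by auto
  ultimately obtain p where p: "lin_on R (seqs R) (fr R k) M K p"
      "\<And>c. c \<in> fr R k \<Longrightarrow> \<exists>l\<in>N'. q c = \<phi> (p c) \<oplus>\<^bsub>N\<^esub> l"
    using Suc(1) by blast
  let ?e = "\<lambda>i. if i = k then \<one> else \<zero>"
  have e: "?e \<in> fr R (Suc k)" by (auto simp: fr_def)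
  \<comment> \<open>A lift of the last basis vector, correct up to \<open>l\<close>. On
    \<open>c\<close> this contributes the error \<open>c k\<close> times \<open>l\<close>, which is
    added to the error from the induction hypothesis.\<close>
  then obtain v l where v: "v \<in> K" "l \<in> N'" "q ?e = \<phi> v \<oplus>\<^bsub>N\<^esub> l" using Suc(3) by blast
  have lin: "lin_on R (seqs R) (fr R (Suc k)) M K (\<lambda>c. p (c(k := \<zero>)) \<oplus>\<^bsub>M\<^esub> c k \<odot>\<^bsub>M\<^esub> v)"
    by (rule extend_lin[OF assms(1,3) p(1) v(1)])
  show ?case
  proof (intro exI conjI ballI, rule lin)
    fix c assume c: "c \<in> fr R (Suc k)"
    note d = fr_decomp[OF c]
    obtain l' where l': "l' \<in> N'" "q (c(k := \<zero>)) = \<phi> (p (c(k := \<zero>))) \<oplus>\<^bsub>N\<^esub> l'"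
      using p(2) d(1) by blast
    have pc: "p (c(k := \<zero>)) \<in> K" using p(1) d(1) lin_on_mem by metis
    have ck: "c k \<odot>\<^bsub>M\<^esub> v \<in> K" using assms(3) d(2) v(1) by (simp add: M.submod_smult)
    have N: "\<phi> (p (c(k := \<zero>))) \<in> carrier N" "\<phi> v \<in> carrier N" "l \<in> carrier N" "l' \<in> carrier N"
      using pc v l'(1) lin_on_mem[OF assms(6)] assms(4,5) N.submod_carrier by metis+
    have "q c = q (c(k := \<zero>)) \<oplus>\<^bsub>N\<^esub> c k \<odot>\<^bsub>N\<^esub> q ?e"
      by (subst d(4), subst lin_on_add[OF Suc(2)])
        (use d fr_mono[of k "Suc k"] in \<open>auto simp: lin_on_smult[OF Suc(2)] V.submod_smult[OF submod_fr]\<close>)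
    also have "\<dots> = \<phi> (p (c(k := \<zero>)) \<oplus>\<^bsub>M\<^esub> c k \<odot>\<^bsub>M\<^esub> v) \<oplus>\<^bsub>N\<^esub> (l' \<oplus>\<^bsub>N\<^esub> c k \<odot>\<^bsub>N\<^esub> l)"
      using pc ck v(1) d(2) N
      by (simp add: lin_on_add[OF assms(6)] lin_on_smult[OF assms(6)] v(3) l'(2) N.smult_r_distr N.smult_closed N.a_ac)
    finally show "\<exists>l\<in>N'. q c = \<phi> (p (c(k := \<zero>)) \<oplus>\<^bsub>M\<^esub> c k \<odot>\<^bsub>M\<^esub> v) \<oplus>\<^bsub>N\<^esub> l"
      using l'(1) v(2) d(2) assms(5) by (metis N.submod_add N.submod_smult)
  qed
qed

text \<open>\<open>p c\<close> is the combination of the images of the basis vectors with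
  coefficients \<open>c i\<close> in \<open>I\<close>, and \<open>I\<close> maps \<open>Y\<close>
  into \<open>L\<close>. Thus a map from R^k to \<open>Y\<close> induces one from (R/I)^k to
  Y/L.\<close>

lemma fI_maps:
  assumes "left_module R N" "submodule Y R N" "submodule L R N" "lin_on R (seqs R) (fr R k) N Y p"
    and IY: "\<And>a y. a \<in> I \<Longrightarrow> y \<in> Y \<Longrightarrow> a \<odot>\<^bsub>N\<^esub> y \<in> L" and "c \<in> fI R I k"
  shows "p c \<in> L"
proof -
  interpret N: left_module R N by fact
  have "c \<in> fr R k \<Longrightarrow> (\<And>i. i < k \<Longrightarrow> c i \<in> I) \<Longrightarrow> p c \<in> L"
    using assms(4)
  proof (induction k arbitrary: c)
    case 0
    then show ?case
      using lin_on_zero[OF V.left_module_axioms assms(1) submod_fr assms(2) 0(3)] N.submod_zero[OF assms(3)] by (simp add: fr_0)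
  next
    case (Suc k)
    note d = fr_decomp[OF Suc(2)]
    have "lin_on R (seqs R) (fr R k) N Y p"
      using Suc(4) by (rule lin_on_subset) (use fr_mono[of k "Suc k"] lin_on_mem[OF Suc(4)] in auto)
    then have 1: "p (c(k := \<zero>)) \<in> L"
      by (intro Suc(1)[OF d(1)]) (use Suc(3) in auto)
    let ?e = "\<lambda>i. if i = k then \<one> else \<zero>"
    have "p c = p (c(k := \<zero>)) \<oplus>\<^bsub>N\<^esub> c k \<odot>\<^bsub>N\<^esub> p ?e"
      by (subst d(4), subst lin_on_add[OF Suc(4)])
        (use d fr_mono[of k "Suc k"] in \<open>auto simp: lin_on_smult[OF Suc(4)] V.submod_smult[OF submod_fr]\<close>)
    then show ?case
      using 1 IY[OF Suc(3)[of k] lin_on_mem[OF Suc(4) d(3)]] N.submod_add[OF assms(3)] by simp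
  qed
  then show ?thesis using assms(6) by (simp add: fI_def)
qed

end

section \<open>Partial free resolutions\<close>

context left_module begin

lemma add_minus_cancel: "x \<in> carrier M \<Longrightarrow> y \<in> carrier M \<Longrightarrow> y \<oplus>\<^bsub>M\<^esub> (x \<ominus>\<^bsub>M\<^esub> y) = x"
  by (simp add: a_minus_def M.a_lcomm M.r_neg)

lemma minus_add_cancel: "l \<in> carrier M \<Longrightarrow> y \<in> carrier M \<Longrightarrow> (y \<oplus>\<^bsub>M\<^esub> l) \<ominus>\<^bsub>M\<^esub> y = l"
  by (simp add: a_minus_def M.a_comm[of y l] M.a_assoc M.r_neg)

end

text \<open>
  Modules over \<open>R/I\<close> are represented as \<open>K/L\<close> with \<open>I K \<subseteq> L \<subseteq> K\<close>, so that quotient rings and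
  quotient modules are never formed. In \<open>resolvable R I n r K L\<close> the module \<open>K/L\<close> has a partial free
  resolution over \<open>R/I\<close> with \<open>n\<close> terms, of ranks \<open>r 0, \<dots>, r (n - 1)\<close>; the syzygies of a cover
  \<open>p : (R/I)\<^sup>k \<rightarrow> K/L\<close> are represented by \<open>p\<^sup>-\<^sup>1 L / I\<^sup>k\<close>.
\<close>

definition covers :: "('a, 'e) ring_scheme \<Rightarrow> nat \<Rightarrow> ((nat \<Rightarrow> 'a) \<Rightarrow> nat \<Rightarrow> 'a) \<Rightarrow>
    (nat \<Rightarrow> 'a) set \<Rightarrow> (nat \<Rightarrow> 'a) set \<Rightarrow> bool" where
  "covers R k p K L \<longleftrightarrow> lin_on R (seqs R) (fr R k) (seqs R) K p \<and>
     (\<forall>v\<in>K. \<exists>c\<in>fr R k. \<exists>l\<in>L. v = p c \<oplus>\<^bsub>seqs R\<^esub> l)"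

primrec resolvable :: "('a, 'e) ring_scheme \<Rightarrow> 'a set \<Rightarrow> nat \<Rightarrow> (nat \<Rightarrow> nat) \<Rightarrow>
    (nat \<Rightarrow> 'a) set \<Rightarrow> (nat \<Rightarrow> 'a) set \<Rightarrow> bool" where
  "resolvable R I 0 r K L \<longleftrightarrow> True"
| "resolvable R I (Suc n) r K L \<longleftrightarrow> (\<exists>p. covers R (r 0) p K L \<and>
     resolvable R I n (\<lambda>i. r (Suc i)) {c \<in> fr R (r 0). p c \<in> L} (fI R I (r 0)))"

context ring begin

abbreviation "vadd \<equiv> add (seqs R)"
abbreviation "vsub v w \<equiv> a_minus (seqs R) v w"
abbreviation "subm K \<equiv> submodule K R (seqs R)"
abbreviation "lin K K' \<phi> \<equiv> lin_on R (seqs R) K (seqs R) K' \<phi>"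

lemmas lin_minus = lin_on_minus[OF left_module_seqs left_module_seqs]
lemmas lin_zero = lin_on_zero[OF left_module_seqs left_module_seqs]
lemmas subm_vimage = submod_vimage[OF left_module_seqs left_module_seqs]

text \<open>The hypotheses make \<open>\<phi>\<close> an isomorphism from K/L to K'/L'. Composing
  the first cover with \<open>\<phi>\<close> leaves the set of its syzygies unchanged, so the rest
  of the resolution is reused as it is.\<close>

lemma resolvable_iso:
  assumes "subm K" "subm L" "subm K'" "subm L'" "L \<subseteq> K" "lin K K' \<phi>"
    and onto: "\<And>v'. v' \<in> K' \<Longrightarrow> \<exists>v\<in>K. \<exists>l\<in>L'. v' = vadd (\<phi> v) l"
    and ker: "\<And>v. v \<in> K \<Longrightarrow> \<phi> v \<in> L' \<longleftrightarrow> v \<in> L"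
    and res: "resolvable R I n r K L"
  shows "resolvable R I n r K' L'"
proof (cases n)
  case (Suc m)
  then obtain p where p: "covers R (r 0) p K L"
      "resolvable R I m (\<lambda>i. r (Suc i)) {c \<in> fr R (r 0). p c \<in> L} (fI R I (r 0))"
    using res by auto
  then have lp: "lin (fr R (r 0)) K p" by (simp add: covers_def)
  have "covers R (r 0) (\<lambda>c. \<phi> (p c)) K' L'"
    unfolding covers_def
  proof (intro conjI ballI lin_on_comp[OF lp assms(6)])
    fix v' assume "v' \<in> K'"
    then obtain v l' where v: "v \<in> K" "l' \<in> L'" "v' = vadd (\<phi> v) l'" using onto by blast
    then obtain c l where c: "c \<in> fr R (r 0)" "l \<in> L" "v = vadd (p c) l"
      using p(1) by (auto simp: covers_def)
    have "l \<in> K" "p c \<in> K" "\<phi> l \<in> L'" using c assms(5) ker lin_on_mem[OF lp] by auto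
    then have "v' = vadd (\<phi> (p c)) (vadd (\<phi> l) l')" "vadd (\<phi> l) l' \<in> L'"
      using v(2,3) c lin_on_mem[OF assms(6)] V.submod_carrier[OF assms(3)] V.submod_carrier[OF assms(4)]
        V.submod_add[OF assms(4)]
      by (simp_all add: lin_on_add[OF assms(6)] V.M.a_assoc del: seqs_simps)
    then show "\<exists>c\<in>fr R (r 0). \<exists>l\<in>L'. v' = vadd (\<phi> (p c)) l" using c(1) by blast
  qed
  moreover have "{c \<in> fr R (r 0). \<phi> (p c) \<in> L'} = {c \<in> fr R (r 0). p c \<in> L}"
    using ker lin_on_mem[OF lp] by auto
  ultimately show ?thesis using p(2) Suc by auto
qed simp

text \<open>The inverse isomorphism need not come from a map of \<open>K'\<close> to
  \<open>K\<close>, so the cover \<open>q\<close> of K'/L' is lifted through \<open>\<phi>\<close>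
  to a cover \<open>p\<close> of K/L, which is possible from a free module. As \<open>q\<close> and
  \<open>\<phi>\<close> after \<open>p\<close> differ by elements of \<open>L'\<close>, both covers
  have the same syzygies.\<close>

lemma resolvable_iso_rev:
  assumes "subm K" "subm L" "subm K'" "subm L'" "L \<subseteq> K" "lin K K' \<phi>"
    and onto: "\<And>v'. v' \<in> K' \<Longrightarrow> \<exists>v\<in>K. \<exists>l\<in>L'. v' = vadd (\<phi> v) l"
    and ker: "\<And>v. v \<in> K \<Longrightarrow> \<phi> v \<in> L' \<longleftrightarrow> v \<in> L"
    and res: "resolvable R I n r K' L'"
  shows "resolvable R I n r K L"
proof (cases n)
  case (Suc m)
  then obtain q where q: "covers R (r 0) q K' L'"
      "resolvable R I m (\<lambda>i. r (Suc i)) {c \<in> fr R (r 0). q c \<in> L'} (fI R I (r 0))"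
    using res by auto
  then have lq: "lin (fr R (r 0)) K' q" by (simp add: covers_def)
  obtain p where lp: "lin (fr R (r 0)) K p"
    and p: "\<And>c. c \<in> fr R (r 0) \<Longrightarrow> \<exists>l\<in>L'. q c = vadd (\<phi> (p c)) l"
    using fr_lift_mod[OF left_module_seqs left_module_seqs assms(1,3,4,6) lq] onto lin_on_mem[OF lq] by blast
  have c': "\<And>v. v \<in> K' \<Longrightarrow> v \<in> carrier (seqs R)" "\<And>v. v \<in> L' \<Longrightarrow> v \<in> carrier (seqs R)"
    "\<And>v. v \<in> K \<Longrightarrow> v \<in> carrier (seqs R)"
    using assms(1,3,4) V.submod_carrier by blast+
  note mem = lin_on_mem[OF lp] lin_on_mem[OF lq] lin_on_mem[OF assms(6)]
  have eq: "q c \<in> L' \<longleftrightarrow> p c \<in> L" if c: "c \<in> fr R (r 0)" for c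
  proof -
    obtain l where "l \<in> L'" "q c = vadd (\<phi> (p c)) l" using p c by blast
    then show ?thesis
      using V.submod_add_cancel(2)[OF assms(4), of l "\<phi> (p c)"] ker mem c c' by simp
  qed
  have "covers R (r 0) p K L"
    unfolding covers_def
  proof (intro conjI ballI lp)
    fix v assume v: "v \<in> K"
    then obtain c l where c: "c \<in> fr R (r 0)" "l \<in> L'" "\<phi> v = vadd (q c) l"
      using q(1) mem(3)[OF v] unfolding covers_def by blast
    obtain l' where l': "l' \<in> L'" "q c = vadd (\<phi> (p c)) l'" using p c by blast
    have "\<phi> (vsub v (p c)) = vsub (\<phi> v) (\<phi> (p c))"
      using lin_minus[OF assms(1,3,6)] v c mem by blast
    also have "\<dots> = vadd l' l"
      using c l' c' mem V.minus_add_cancel[of "vadd l' l" "\<phi> (p c)"] by (simp add: V.M.a_assoc del: seqs_simps)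
    finally have "\<phi> (vsub v (p c)) \<in> L'" using l' c V.submod_add[OF assms(4)] by simp
    then have "vsub v (p c) \<in> L" using ker V.submod_minus[OF assms(1)] v c mem by blast
    moreover have "v = vadd (p c) (vsub v (p c))"
      using v c mem c' V.add_minus_cancel by metis
    ultimately show "\<exists>c\<in>fr R (r 0). \<exists>l\<in>L. v = vadd (p c) l" using c(1) by blast
  qed
  moreover have "{c \<in> fr R (r 0). q c \<in> L'} = {c \<in> fr R (r 0). p c \<in> L}"
    using eq by auto
  ultimately show ?thesis using q(2) Suc by auto
qed simp

section \<open>Concatenation of free modules; resolutions of extensions, quotients and
  retracts\<close>

definition head :: "nat \<Rightarrow> (nat \<Rightarrow> 'a) \<Rightarrow> nat \<Rightarrow> 'a" where
  "head k c = (\<lambda>i. if i < k then c i else \<zero>)"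

definition shift :: "nat \<Rightarrow> (nat \<Rightarrow> 'a) \<Rightarrow> nat \<Rightarrow> 'a" where
  "shift k c = (\<lambda>i. c (i + k))"

definition append :: "nat \<Rightarrow> (nat \<Rightarrow> 'a) \<Rightarrow> (nat \<Rightarrow> 'a) \<Rightarrow> nat \<Rightarrow> 'a" where
  "append k a b = (\<lambda>i. if i < k then a i else b (i - k))"

lemma lin_head: "lin (fr R (k + l)) (fr R k) (head k)"
  by (rule lin_onI) (auto simp: fr_def head_def fun_eq_iff)

lemma lin_shift: "lin (fr R (k + l)) (fr R l) (shift k)"
  by (rule lin_onI) (auto simp: fr_def shift_def fun_eq_iff)

lemma append_fr: "a \<in> fr R k \<Longrightarrow> b \<in> fr R l \<Longrightarrow> append k a b \<in> fr R (k + l)"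
  by (auto simp: fr_def append_def)

lemma head_append: "a \<in> fr R k \<Longrightarrow> head k (append k a b) = a"
  by (auto simp: head_def append_def fr_def fun_eq_iff)

lemma shift_append: "shift k (append k a b) = b"
  by (auto simp: shift_def append_def fun_eq_iff)

lemma lin_combine:
  assumes "subm K" "lin (fr R k) K p" "lin (fr R l) K q"
  shows "lin (fr R (k + l)) K (\<lambda>c. vadd (p (head k c)) (q (shift k c)))"
  using assms by (intro lin_on_plus[OF left_module_seqs left_module_seqs submod_fr]
      lin_on_comp[OF lin_head] lin_on_comp[OF lin_shift])

text \<open>What the cover \<open>q\<close> of J/K misses lies in \<open>K\<close>, and there
  \<open>p\<close> reaches it up to \<open>L\<close>.\<close>

lemma covers_combine:
  assumes "subm K" "subm J" "K \<subseteq> J" "subm L" "L \<subseteq> K" "covers R k p K L" "covers R l q J K"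
  shows "covers R (k + l) (\<lambda>c. vadd (p (head k c)) (q (shift k c))) J L"
  unfolding covers_def
proof (intro conjI ballI lin_combine assms(2))
  have lp: "lin (fr R k) K p" and lq: "lin (fr R l) J q" using assms(6,7) by (auto simp: covers_def)
  then show "lin (fr R k) J p" "lin (fr R l) J q"
    using assms(3) lin_on_mem[OF lp] by (auto intro: lin_on_subset)
  fix v assume "v \<in> J"
  then obtain b w where b: "b \<in> fr R l" "w \<in> K" "v = vadd (q b) w" using assms(7) by (auto simp: covers_def)
  obtain a u where a: "a \<in> fr R k" "u \<in> L" "w = vadd (p a) u" using assms(6) b by (auto simp: covers_def)
  have "p a \<in> carrier (seqs R)" "q b \<in> carrier (seqs R)" "u \<in> carrier (seqs R)"
    using a b assms(1,2,4) lin_on_mem[OF lp] lin_on_mem[OF lq] V.submod_carrier by blast+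
  then have "v = vadd (vadd (p (head k (append k a b))) (q (shift k (append k a b)))) u"
    using a b by (simp add: head_append shift_append V.M.a_ac del: seqs_simps)
  then show "\<exists>c\<in>fr R (k + l). \<exists>u\<in>L. v = vadd (vadd (p (head k c)) (q (shift k c))) u"
    using a b append_fr by blast
qed

text \<open>The horseshoe lemma for \<open>K/L \<rightarrow> J/L \<rightarrow> J/K\<close>.\<close>

lemma resolvable_extension:
  assumes "ideal I R"
  shows "subm J \<Longrightarrow> subm K \<Longrightarrow> subm L \<Longrightarrow> K \<subseteq> J \<Longrightarrow> L \<subseteq> K \<Longrightarrow>
    (\<And>a v. a \<in> I \<Longrightarrow> v \<in> J \<Longrightarrow> a \<odot>\<^bsub>seqs R\<^esub> v \<in> L) \<Longrightarrow>
    resolvable R I n r K L \<Longrightarrow> resolvable R I n s J K \<Longrightarrow> resolvable R I n (\<lambda>i. r i + s i) J L"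
proof (induction n arbitrary: r s J K L)
  case (Suc n)
  note J = Suc(2) and K = Suc(3) and L = Suc(4) and IJ = Suc(7)
  let ?k = "r 0" and ?l = "s 0"
  obtain p where p: "covers R ?k p K L"
      "resolvable R I n (\<lambda>i. r (Suc i)) {c \<in> fr R ?k. p c \<in> L} (fI R I ?k)" using Suc(8) by auto
  obtain q where q: "covers R ?l q J K"
      "resolvable R I n (\<lambda>i. s (Suc i)) {c \<in> fr R ?l. q c \<in> K} (fI R I ?l)" using Suc(9) by auto
  have lp: "lin (fr R ?k) K p" and lq: "lin (fr R ?l) J q" using p q by (auto simp: covers_def)
  have lpJ: "lin (fr R ?k) J p" using lp by (rule lin_on_subset) (use lin_on_mem[OF lp] Suc(5) in auto)
  define pq where "pq = (\<lambda>c. vadd (p (head ?k c)) (q (shift ?k c)))"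
  have pq: "covers R (?k + ?l) pq J L"
    unfolding pq_def using K J Suc(5) L Suc(6) p(1) q(1) by (rule covers_combine)
  then have lpq: "lin (fr R (?k + ?l)) J pq" by (simp add: covers_def)
  \<comment> \<open>\<open>W\<close> consists of the syzygies of the combined cover,
    \<open>T\<close> of those whose second component is zero modulo \<open>I\<close>. Modulo
    \<open>fI R I (?k + ?l)\<close>, \<open>T\<close> is isomorphic to the syzygies of K/L, and W/T
    to those of J/K, so the induction hypothesis applies to this chain of three modules.\<close>
  define W where "W = {c \<in> fr R (?k + ?l). pq c \<in> L}"
  define T where "T = {c \<in> W. shift ?k c \<in> fI R I ?l}"
  have W: "subm W" unfolding W_def by (rule subm_vimage[OF submod_fr J L lpq])
  have lW: "lin W (fr R ?l) (shift ?k)"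
    using lin_shift by (rule lin_on_subset) (use lin_on_mem[OF lin_shift] W_def in auto)
  have T: "subm T" unfolding T_def by (rule subm_vimage[OF W submod_fr submod_fI[OF assms] lW])
  have KP: "subm {c \<in> fr R ?k. p c \<in> L}" by (rule subm_vimage[OF submod_fr K L lp])
  have KQ: "subm {c \<in> fr R ?l. q c \<in> K}" by (rule subm_vimage[OF submod_fr J K lq])
  have qz: "q (\<lambda>_. \<zero>) = (\<lambda>_. \<zero>)" using lin_zero[OF submod_fr J lq] by simp
  have Jc: "\<And>v. v \<in> J \<Longrightarrow> v \<in> carrier (seqs R)" using J V.submod_carrier by blast
  have IK: "\<And>a v. a \<in> I \<Longrightarrow> v \<in> K \<Longrightarrow> a \<odot>\<^bsub>seqs R\<^esub> v \<in> L" using IJ Suc(5) by blast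
  have pqI: "fI R I (?k + ?l) \<subseteq> T"
  proof
    fix c assume c: "c \<in> fI R I (?k + ?l)"
    have "shift ?k c \<in> fI R I ?l" using c by (auto simp: shift_def fI_def fr_def)
    moreover have "pq c \<in> L" by (rule fI_maps[OF left_module_seqs J L lpq IJ c])
    ultimately show "c \<in> T" using c by (simp add: T_def W_def fI_def)
  qed
  have 1: "resolvable R I n (\<lambda>i. r (Suc i)) T (fI R I (?k + ?l))"
  proof (rule resolvable_iso[OF KP submod_fI[OF assms] T submod_fI[OF assms], where \<phi> = "\<lambda>c. c"])
    show "fI R I ?k \<subseteq> {c \<in> fr R ?k. p c \<in> L}"
      using fI_maps[OF left_module_seqs K L lp IK] by (auto simp: fI_def)
    show "resolvable R I n (\<lambda>i. r (Suc i)) {c \<in> fr R ?k. p c \<in> L} (fI R I ?k)" by fact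
    show "lin {c \<in> fr R ?k. p c \<in> L} T (\<lambda>c. c)"
    proof (rule lin_on_subset[OF lin_on_id subset_refl])
      fix c assume "c \<in> {c \<in> fr R ?k. p c \<in> L}"
      then have c: "c \<in> fr R ?k" "p c \<in> L" by auto
      have s: "shift ?k c = (\<lambda>_. \<zero>)" "head ?k c = c"
        using c(1) by (auto simp: shift_def head_def fr_def fun_eq_iff)
      have "pq c = p c"
        using V.M.r_zero[OF V.submod_carrier[OF L c(2)]] by (simp add: pq_def s qz)
      then have "pq c \<in> L" using c(2) by simp
      then show "c \<in> T"
        using c(1) fr_mono[of ?k "?k + ?l"] V.submod_zero[OF submod_fI[OF assms]] by (auto simp: T_def W_def s)
    qed
    fix c
    {
      assume "c \<in> T"
      then have c: "c \<in> fr R (?k + ?l)" "pq c \<in> L" "shift ?k c \<in> fI R I ?l" by (auto simp: T_def W_def)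
      have "q (shift ?k c) \<in> L" using fI_maps[OF left_module_seqs J L lq IJ c(3)] .
      moreover have h: "head ?k c \<in> fr R ?k" using c lin_on_mem[OF lin_head] by blast
      ultimately have "p (head ?k c) \<in> L"
        using c(2) V.submod_add_cancel(2)[OF L, of "q (shift ?k c)" "p (head ?k c)"] lin_on_mem[OF lpJ] Jc
        by (simp add: pq_def)
      \<comment> \<open>The tail of \<open>c\<close> has entries in \<open>I\<close>, so it counts
        as an error and is split off.\<close>
      moreover have "c = vadd (head ?k c) (\<lambda>i. if i < ?k then \<zero> else c i)"
        using c(1) by (auto simp: head_def fun_eq_iff fr_def)
      moreover have "(\<lambda>i. if i < ?k then \<zero> else c i) \<in> fI R I (?k + ?l)"
      proof -
        have "c i \<in> I" if "\<not> i < ?k" for i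
          using c(3) that by (auto simp: shift_def fI_def dest!: spec[of _ "i - ?k"])
        moreover have "\<zero> \<in> I" using assms additive_subgroup.zero_closed ideal.axioms(1) by blast
        ultimately show ?thesis using c(1) by (auto simp: fI_def fr_def)
      qed
      ultimately show "\<exists>v\<in>{c \<in> fr R ?k. p c \<in> L}. \<exists>l\<in>fI R I (?k + ?l). c = vadd v l"
        using h by blast
    }
    assume "c \<in> {c \<in> fr R ?k. p c \<in> L}"
    then show "c \<in> fI R I (?k + ?l) \<longleftrightarrow> c \<in> fI R I ?k" by (auto simp: fI_def fr_def)
  qed
  have 2: "resolvable R I n (\<lambda>i. s (Suc i)) W T"
  proof (rule resolvable_iso_rev[OF W T KQ submod_fI[OF assms], where \<phi> = "shift ?k"])
    show "T \<subseteq> W" by (auto simp: T_def)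
    show "resolvable R I n (\<lambda>i. s (Suc i)) {c \<in> fr R ?l. q c \<in> K} (fI R I ?l)" by fact
    show "lin W {c \<in> fr R ?l. q c \<in> K} (shift ?k)"
    proof (rule lin_on_subset[OF lW subset_refl])
      fix c assume "c \<in> W"
      then have c: "c \<in> fr R (?k + ?l)" "pq c \<in> L" by (auto simp: W_def)
      have "head ?k c \<in> fr R ?k" "shift ?k c \<in> fr R ?l" using c lin_on_mem[OF lin_head] lin_on_mem[OF lin_shift] by blast+
      then show "shift ?k c \<in> {c \<in> fr R ?l. q c \<in> K}"
        using c(2) Suc(6) V.submod_add_cancel(1)[OF K, of "p (head ?k c)" "q (shift ?k c)"]
          lin_on_mem[OF lp] lin_on_mem[OF lq] Jc by (auto simp: pq_def)
    qed
    fix v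
    { assume "v \<in> {c \<in> fr R ?l. q c \<in> K}"
      then have v: "v \<in> fr R ?l" "q v \<in> K" by auto
      then obtain a u where a: "a \<in> fr R ?k" "u \<in> L" "q v = vadd (p a) u" using p(1) by (auto simp: covers_def)
      \<comment> \<open>A tail \<open>v\<close> with \<open>q v\<close> in \<open>K\<close> becomes
        a syzygy when its head cancels \<open>q v\<close> up to \<open>u\<close>, hence the
        sign.\<close>
      let ?a = "\<ominus>\<^bsub>seqs R\<^esub> a"
      have na: "?a \<in> fr R ?k" using a(1) V.submod_neg[OF submod_fr] by blast
      let ?c = "append ?k ?a v"
      have c: "?c \<in> fr R (?k + ?l)" using na v append_fr by blast
      have pa: "p a \<in> carrier (seqs R)" "u \<in> carrier (seqs R)" using a lin_on_mem[OF lpJ] Jc Suc(5,6) by blast+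
      have "pq ?c = vadd (p ?a) (q v)" by (simp add: pq_def head_append[OF na] shift_append)
      also have "\<dots> = u" using lin_on_neg[OF left_module_seqs left_module_seqs submod_fr K lp a(1)] a(3) pa
        by (simp add: V.M.r_neg1 del: seqs_simps)
      finally have "?c \<in> W" using c a(2) by (simp add: W_def)
      moreover have "v = vadd (shift ?k ?c) (\<lambda>_. \<zero>)" using v by (auto simp: shift_append fr_def fun_eq_iff)
      ultimately show "\<exists>c\<in>W. \<exists>l\<in>fI R I ?l. v = vadd (shift ?k c) l"
        using V.submod_zero[OF submod_fI[OF assms], of ?l] by auto
    }
    assume "v \<in> W" then show "shift ?k v \<in> fI R I ?l \<longleftrightarrow> v \<in> T" by (simp add: T_def)
  qed
  have WI: "a \<odot>\<^bsub>seqs R\<^esub> v \<in> fI R I (?k + ?l)" if "a \<in> I" "v \<in> W" for a v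
  proof -
    interpret I: ideal I R by fact
    show ?thesis using that by (auto simp: W_def fI_def fr_def I.I_r_closed)
  qed
  have "T \<subseteq> W" by (auto simp: T_def)
  have "resolvable R I n (\<lambda>i. r (Suc i) + s (Suc i)) W (fI R I (?k + ?l))"
    by (rule Suc(1)[OF W T submod_fI[OF assms] \<open>T \<subseteq> W\<close> pqI WI 1 2])
  then show ?case using pq by (auto simp: W_def)
qed simp

text \<open>The mapping cone of \<open>K/L \<rightarrow> J/L\<close> resolves \<open>J/K\<close>.\<close>

lemma resolvable_quotient:
  assumes "ideal I R" "subm J" "subm K" "subm L" "K \<subseteq> J" "L \<subseteq> K"
    and IJ: "\<And>a v. a \<in> I \<Longrightarrow> v \<in> J \<Longrightarrow> a \<odot>\<^bsub>seqs R\<^esub> v \<in> L"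
    and "resolvable R I (Suc n) r J L" "resolvable R I n s K L"
  shows "resolvable R I (Suc n) (\<lambda>i. r i + (case i of 0 \<Rightarrow> 0 | Suc i \<Rightarrow> s i)) J K"
proof -
  let ?k = "r 0"
  obtain p where p: "covers R ?k p J L"
      "resolvable R I n (\<lambda>i. r (Suc i)) {c \<in> fr R ?k. p c \<in> L} (fI R I ?k)" using assms(8) by auto
  have lp: "lin (fr R ?k) J p" using p by (auto simp: covers_def)
  let ?W = "{c \<in> fr R ?k. p c \<in> K}" and ?T = "{c \<in> fr R ?k. p c \<in> L}"
  have W: "subm ?W" by (rule subm_vimage[OF submod_fr assms(2,3) lp])
  have T: "subm ?T" by (rule subm_vimage[OF submod_fr assms(2,4) lp])
  have TW: "?T \<subseteq> ?W" using assms(6) by auto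
  \<comment> \<open>\<open>p\<close> also covers J/K. Its syzygies \<open>?W\<close> there contain
    the old syzygies \<open>?T\<close>, and \<open>p\<close> identifies ?W/?T with K/L; this puts
    the ranks \<open>s\<close> one degree higher.\<close>
  have "resolvable R I n s ?W ?T"
  proof (rule resolvable_iso_rev[OF W T assms(3,4) TW, where \<phi> = p])
    show "lin ?W K p" using lp by (rule lin_on_subset) auto
    fix v assume v: "v \<in> K"
    then obtain c u where "c \<in> fr R ?k" "u \<in> L" "v = vadd (p c) u"
      using p(1) assms(5) unfolding covers_def by blast
    moreover from this v have "p c \<in> K"
      using V.submod_add_cancel(2)[OF assms(3), of u "p c"] assms(6) lin_on_mem[OF lp] V.submod_carrier[OF assms(2)] by auto
    ultimately show "\<exists>c\<in>?W. \<exists>l\<in>L. v = vadd (p c) l" by blast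
  qed (use assms(9) in auto)
  moreover have "fI R I ?k \<subseteq> ?T"
    using fI_maps[OF left_module_seqs assms(2,4) lp IJ] by (auto simp: fI_def)
  moreover have "a \<odot>\<^bsub>seqs R\<^esub> v \<in> fI R I ?k" if "a \<in> I" "v \<in> ?W" for a v
  proof -
    interpret I: ideal I R by fact
    show ?thesis using that by (auto simp: fI_def fr_def I.I_r_closed)
  qed
  ultimately have "resolvable R I n (\<lambda>i. r (Suc i) + s i) ?W (fI R I ?k)"
    using resolvable_extension[OF assms(1) W T submod_fI[OF assms(1)] TW _ _ p(2)] by blast
  moreover have "covers R ?k p J K"
    using p(1) assms(6) unfolding covers_def by blast
  ultimately show ?thesis by auto
qed

text \<open>\<open>\<theta>\<close> is an idempotent of R^k with image \<open>K\<close>. Its kernel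
  is the image of the complementary idempotent c - \<open>\<theta>\<close> c and so again a retract
  of R^k; hence every further syzygy is covered with the same rank.\<close>

lemma resolvable_retract:
  assumes "subm K" "K \<subseteq> fr R k" "lin (fr R k) K \<theta>" "\<And>v. v \<in> K \<Longrightarrow> \<theta> v = v"
  shows "resolvable R {\<zero>} n (\<lambda>_. k) K {\<lambda>_. \<zero>}"
  using assms
proof (induction n arbitrary: K \<theta>)
  case (Suc n)
  have z: "subm {\<lambda>_. \<zero>}" using V.submod_null by simp
  have Kc: "\<And>v. v \<in> K \<Longrightarrow> v \<in> carrier (seqs R)" using V.submod_carrier[OF Suc(2)] .
  have "covers R k \<theta> K {\<lambda>_. \<zero>}"
    unfolding covers_def
  proof (intro conjI ballI Suc(4))
    fix v assume v: "v \<in> K"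
    then have "v = vadd (\<theta> v) (\<lambda>_. \<zero>)"
      unfolding Suc(5)[OF v] using Kc[OF v] by (auto simp: fun_eq_iff)
    then show "\<exists>c\<in>fr R k. \<exists>l\<in>{\<lambda>_. \<zero>}. v = vadd (\<theta> c) l"
      using v Suc(3) by blast
  qed
  let ?W = "{c \<in> fr R k. \<theta> c \<in> {\<lambda>_. \<zero>}}"
  have W: "subm ?W" by (rule subm_vimage[OF submod_fr Suc(2) z Suc(4)])
  have l: "lin (fr R k) (fr R k) \<theta>" using Suc(4) by (rule lin_on_subset) (use Suc(3) lin_on_mem[OF Suc(4)] in auto)
  have l': "lin (fr R k) (fr R k) (\<lambda>c. vsub c (\<theta> c))"
    by (intro lin_on_diff left_module_seqs submod_fr lin_on_id l)
  have "resolvable R {\<zero>} n (\<lambda>_. k) ?W {\<lambda>_. \<zero>}"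
  proof (rule Suc(1)[OF W])
    show "lin (fr R k) ?W (\<lambda>c. vsub c (\<theta> c))"
    proof (rule lin_on_subset[OF l' subset_refl])
      fix c assume c: "c \<in> fr R k"
      have tc: "\<theta> c \<in> K" using c lin_on_mem[OF Suc(4)] by blast
      have "\<theta> (vsub c (\<theta> c)) = vsub (\<theta> c) (\<theta> (\<theta> c))"
        using lin_minus[OF submod_fr Suc(2,4)] c lin_on_mem[OF l] by blast
      also have "\<dots> = (\<lambda>_. \<zero>)" using tc Suc(5) Kc[OF tc] by (simp add: V.M.r_neg a_minus_def del: seqs_simps(1))
      finally show "vsub c (\<theta> c) \<in> ?W" using lin_on_mem[OF l' c] by simp
    qed
    fix v assume v: "v \<in> ?W"
    then have "\<theta> v = \<zero>\<^bsub>seqs R\<^esub>" "v \<in> carrier (seqs R)" by (auto simp: fr_def)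
    then show "vsub v (\<theta> v) = v" by (simp add: a_minus_def del: seqs_simps)
  qed auto
  then show ?case using \<open>covers R k \<theta> K _\<close> by (auto simp: fI_zero)
qed simp

end

section \<open>Change of rings\<close>

context ring begin

text \<open>Modulo I^k this is wN, so \<open>N\<close> divided by it represents the reduction of
  N/I^k modulo \<open>w\<close>. For \<open>w\<close> normal modulo \<open>I\<close> it is a left
  submodule.\<close>

definition scaled :: "'a set \<Rightarrow> nat \<Rightarrow> 'a \<Rightarrow> (nat \<Rightarrow> 'a) set \<Rightarrow> (nat \<Rightarrow> 'a) set" where
  "scaled I k w N = {vadd u (w \<odot>\<^bsub>seqs R\<^esub> v) | u v. u \<in> fI R I k \<and> v \<in> N}"

end

text \<open>
  If \<open>k\<close> has a resolution of ranks \<open>1, f 0, f 1, \<dots>\<close> before the regular normal element is factored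
  out, then it has one of ranks \<open>1, g 0, g 1, \<dots>\<close> afterwards, where \<open>g n\<close> is \<open>f n\<close> plus
  the rank in degree \<open>n - 1\<close> of the new resolution itself.
\<close>

fun quotient_rank :: "(nat \<Rightarrow> nat) \<Rightarrow> nat \<Rightarrow> nat" where
  "quotient_rank f 0 = f 0"
| "quotient_rank f (Suc 0) = f 1 + 1"
| "quotient_rank f (Suc (Suc n)) = f (Suc (Suc n)) + quotient_rank f n"

text \<open>The image of \<open>w\<close> is regular and normal in R/I, and J/I is the ideal that it
  generates. Since R/I is not formed, every equation of cosets carries an explicit error in
  \<open>I\<close>. The two conditions on \<open>m\<close> say that moving \<open>w\<close> past an
  element of \<open>m\<close> can be done within \<open>m\<close>; normality on
  \<open>carrier R\<close> alone does not give this.\<close>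

locale normal_regular = ring R for R (structure) +
  fixes I J m :: "'a set" and w
  assumes I: "ideal I R" and J: "ideal J R" and m: "ideal m R" and w: "w \<in> carrier R"
    and J_eq: "J = {u \<oplus> w \<otimes> c | u c. u \<in> I \<and> c \<in> carrier R}"
    and Jm: "J \<subseteq> m"
    and normal_left: "\<And>c. c \<in> carrier R \<Longrightarrow> \<exists>c'\<in>carrier R. \<exists>u\<in>I. w \<otimes> c = u \<oplus> c' \<otimes> w"
    and normal_right: "\<And>c. c \<in> carrier R \<Longrightarrow> \<exists>c'\<in>carrier R. \<exists>u\<in>I. c \<otimes> w = u \<oplus> w \<otimes> c'"
    and normal_left_m: "\<And>c. c \<in> m \<Longrightarrow> \<exists>c'\<in>m. \<exists>u\<in>I. w \<otimes> c = u \<oplus> c' \<otimes> w"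
    and normal_right_m: "\<And>c. c \<in> m \<Longrightarrow> \<exists>c'\<in>m. \<exists>u\<in>I. c \<otimes> w = u \<oplus> w \<otimes> c'"
    and regular_left: "\<And>c. c \<in> carrier R \<Longrightarrow> w \<otimes> c \<in> I \<Longrightarrow> c \<in> I"
    and regular_right: "\<And>c. c \<in> carrier R \<Longrightarrow> c \<otimes> w \<in> I \<Longrightarrow> c \<in> I"
begin

sublocale I: ideal I R by (rule I)
sublocale J: ideal J R by (rule J)
sublocale m: ideal m R by (rule m)

lemma Ic [simp]: "x \<in> I \<Longrightarrow> x \<in> carrier R" using I.a_subset by blast
lemma mc [simp]: "x \<in> m \<Longrightarrow> x \<in> carrier R" using m.a_subset by blast

lemma IJ: "I \<subseteq> J"
proof
  fix u assume "u \<in> I"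
  then have "u = u \<oplus> w \<otimes> \<zero>" using w by simp
  then show "u \<in> J" unfolding J_eq using \<open>u \<in> I\<close> by blast
qed

lemma wJ: "c \<in> carrier R \<Longrightarrow> w \<otimes> c \<in> J"
proof -
  assume c: "c \<in> carrier R"
  then have "w \<otimes> c = \<zero> \<oplus> w \<otimes> c" using w by simp
  then show "w \<otimes> c \<in> J" unfolding J_eq using I.zero_closed c by blast
qed

lemma subm_scaled:
  assumes "subm N" "N \<subseteq> fr R k"
  shows "subm (scaled I k w N)"
proof (rule V.submodI)
  have fIc: "v \<in> fI R I k \<Longrightarrow> v \<in> carrier (seqs R)" for v using V.submod_carrier[OF submod_fI[OF I]] .
  have Nc: "v \<in> N \<Longrightarrow> v \<in> carrier (seqs R)" for v using V.submod_carrier[OF assms(1)] .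
  show "scaled I k w N \<subseteq> carrier (seqs R)"
    using fIc Nc w by (auto simp: scaled_def)
  have "\<zero>\<^bsub>seqs R\<^esub> = vadd \<zero>\<^bsub>seqs R\<^esub> (w \<odot>\<^bsub>seqs R\<^esub> \<zero>\<^bsub>seqs R\<^esub>)" using w by (auto simp: fun_eq_iff)
  then show "\<zero>\<^bsub>seqs R\<^esub> \<in> scaled I k w N"
    unfolding scaled_def using V.submod_zero[OF submod_fI[OF I]] V.submod_zero[OF assms(1)] by blast
  fix x y assume "x \<in> scaled I k w N" "y \<in> scaled I k w N"
  then obtain u v u' v' where uv: "u \<in> fI R I k" "v \<in> N" "x = vadd u (w \<odot>\<^bsub>seqs R\<^esub> v)"
    "u' \<in> fI R I k" "v' \<in> N" "y = vadd u' (w \<odot>\<^bsub>seqs R\<^esub> v')" unfolding scaled_def by blast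
  have "vadd x y = vadd (vadd u u') (w \<odot>\<^bsub>seqs R\<^esub> vadd v v')"
    using uv fIc Nc w by (simp add: V.smult_r_distr V.M.a_ac V.smult_closed del: seqs_simps)
  then show "vadd x y \<in> scaled I k w N"
    unfolding scaled_def using uv V.submod_add[OF submod_fI[OF I]] V.submod_add[OF assms(1)] by blast
next
  fix a x assume a: "a \<in> carrier R" and "x \<in> scaled I k w N"
  then obtain u v where uv: "u \<in> fI R I k" "v \<in> N" "x = vadd u (w \<odot>\<^bsub>seqs R\<^esub> v)" unfolding scaled_def by blast
  \<comment> \<open>Normality moves \<open>a\<close> past \<open>w\<close>. The error,
    \<open>t\<close> times \<open>v\<close>, lies in I^k because \<open>N\<close> lies in
    R^k.\<close>
  obtain b t where b: "b \<in> carrier R" "t \<in> I" "a \<otimes> w = t \<oplus> w \<otimes> b" using normal_right[OF a] by blast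
  have c: "\<And>i. u i \<in> carrier R" "\<And>i. v i \<in> carrier R"
    using uv V.submod_carrier[OF submod_fI[OF I]] V.submod_carrier[OF assms(1)] by (meson seqs_simps(1))+
  have "a \<otimes> (w \<otimes> v i) = t \<otimes> v i \<oplus> w \<otimes> (b \<otimes> v i)" for i
    using b c a w I.Icarr by (simp add: m_assoc[symmetric] l_distr)
  then have "a \<odot>\<^bsub>seqs R\<^esub> x = vadd (vadd (a \<odot>\<^bsub>seqs R\<^esub> u) (t \<odot>\<^bsub>seqs R\<^esub> v)) (w \<odot>\<^bsub>seqs R\<^esub> (b \<odot>\<^bsub>seqs R\<^esub> v))"
    unfolding uv(3) using a b c w by (auto simp: fun_eq_iff r_distr a_assoc)
  moreover have "t \<odot>\<^bsub>seqs R\<^esub> v \<in> fI R I k"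
    using b uv assms(2) c by (auto simp: fI_def fr_def I.I_r_closed)
  ultimately show "a \<odot>\<^bsub>seqs R\<^esub> x \<in> scaled I k w N"
    unfolding scaled_def using uv b a V.submod_add[OF submod_fI[OF I]] V.submod_smult[OF submod_fI[OF I]]
      V.submod_smult[OF assms(1)] by blast
qed

lemma fI_scaled: "subm N \<Longrightarrow> fI R I k \<subseteq> scaled I k w N"
proof
  fix v assume N: "subm N" and v: "v \<in> fI R I k"
  have "v = vadd v (w \<odot>\<^bsub>seqs R\<^esub> \<zero>\<^bsub>seqs R\<^esub>)" using w v by (auto simp: fun_eq_iff fI_def fr_def)
  then show "v \<in> scaled I k w N" unfolding scaled_def using v V.submod_zero[OF N] by blast
qed

lemma fI_J_scaled: "fI R J k = scaled I k w (fr R k)"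
proof
  show "scaled I k w (fr R k) \<subseteq> fI R J k"
    using w subsetD[OF IJ] wJ by (auto simp: scaled_def fI_def fr_def intro!: J.a_closed)
  show "fI R J k \<subseteq> scaled I k w (fr R k)"
  proof
    fix v assume v: "v \<in> fI R J k"
    have "v i \<in> {u \<oplus> w \<otimes> c | u c. u \<in> I \<and> c \<in> carrier R}" for i
      using v unfolding J_eq[symmetric] by (simp add: fI_def)
    then have "\<forall>i. \<exists>u c. u \<in> I \<and> c \<in> carrier R \<and> v i = u \<oplus> w \<otimes> c" by blast
    then obtain u c where uc: "\<And>i. u i \<in> I" "\<And>i. c i \<in> carrier R" "\<And>i. v i = u i \<oplus> w \<otimes> c i" by metis
    \<comment> \<open>Beyond \<open>k\<close> only the combination of the chosen \<open>u\<close>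
      and \<open>c\<close> has to vanish, not each of them; \<open>head\<close> cuts them
      off.\<close>
    have "v = vadd (head k u) (w \<odot>\<^bsub>seqs R\<^esub> head k c)"
    proof
      fix i
      have "i \<ge> k \<Longrightarrow> v i = \<zero>" using v by (simp add: fI_def fr_def)
      then show "v i = vadd (head k u) (w \<odot>\<^bsub>seqs R\<^esub> head k c) i"
        using uc(3)[of i] w by (cases "i < k") (simp_all add: head_def)
    qed
    moreover have "head k u \<in> fI R I k" "head k c \<in> fr R k" using uc by (auto simp: head_def fI_def fr_def)
    ultimately show "v \<in> scaled I k w (fr R k)" unfolding scaled_def by blast
  qed
qed

text \<open>As \<open>w\<close> is regular, a resolution stays exact when it is reduced modulo \<open>w\<close>.\<close>

lemma resolvable_reduce:
  "subm N \<Longrightarrow> N \<subseteq> fr R k \<Longrightarrow> fI R I k \<subseteq> N \<Longrightarrow> resolvable R I n f N (fI R I k) \<Longrightarrow>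
    resolvable R J n f N (scaled I k w N)"
proof (induction n arbitrary: N k f)
  case (Suc n)
  note N = Suc(2)
  let ?k = "f 0"
  obtain p where p: "covers R ?k p N (fI R I k)"
    "resolvable R I n (\<lambda>i. f (Suc i)) {c \<in> fr R ?k. p c \<in> fI R I k} (fI R I ?k)" using Suc(5) by auto
  have lp: "lin (fr R ?k) N p" using p(1) by (simp add: covers_def)
  let ?W = "{c \<in> fr R ?k. p c \<in> fI R I k}" and ?W' = "{c \<in> fr R ?k. p c \<in> scaled I k w N}"
  have W: "subm ?W" by (rule subm_vimage[OF submod_fr N submod_fI[OF I] lp])
  have W': "subm ?W'" by (rule subm_vimage[OF submod_fr N subm_scaled[OF N Suc(3)] lp])
  have IN: "a \<odot>\<^bsub>seqs R\<^esub> v \<in> fI R I k" if "a \<in> I" "v \<in> N" for a v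
    using that Suc(3) by (auto simp: fI_def fr_def I.I_r_closed)
  have WI: "fI R I ?k \<subseteq> ?W"
    using fI_maps[OF left_module_seqs N submod_fI[OF I] lp IN] by (auto simp: fI_def)
  have Nc: "v \<in> N \<Longrightarrow> v \<in> carrier (seqs R)" for v using V.submod_carrier[OF N] .
  have Ivc: "v \<in> fI R I k \<Longrightarrow> v \<in> carrier (seqs R)" for v using V.submod_carrier[OF submod_fI[OF I]] .
  have fc: "v \<in> fr R k' \<Longrightarrow> v \<in> carrier (seqs R)" for v k' using V.submod_carrier[OF submod_fr] .
  \<comment> \<open>Regularity of \<open>w\<close> on R/I passes to free modules, and so to N/I^k
    inside one of them.\<close>
  have wreg: "v \<in> fI R I k" if "w \<odot>\<^bsub>seqs R\<^esub> v \<in> fI R I k" "v \<in> fr R k" for v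
  proof -
    have "w \<otimes> v i \<in> I" "v i \<in> carrier R" for i using that by (simp_all add: fI_def fr_def)
    then have "v i \<in> I" for i using regular_left by blast
    then show ?thesis using that(2) by (simp add: fI_def)
  qed
  have wI: "w \<odot>\<^bsub>seqs R\<^esub> v \<in> fI R I k" if "v \<in> fI R I k" for v
    using that V.submod_smult[OF submod_fI[OF I] w] by blast
  have 1: "resolvable R J n (\<lambda>i. f (Suc i)) ?W (scaled I ?k w ?W)"
    using Suc(1)[OF W _ WI p(2)] by blast
  \<comment> \<open>This is exactness after reduction: the new syzygies \<open>?W'\<close> are the
    sum of \<open>?W\<close> and \<open>fI R J ?k\<close>, and \<open>?W\<close> meets
    \<open>fI R J ?k\<close> exactly in \<open>scaled I ?k w ?W\<close>.\<close>
  have "resolvable R J n (\<lambda>i. f (Suc i)) ?W' (fI R J ?k)"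
  proof (rule resolvable_iso[OF W subm_scaled[OF W] W' submod_fI[OF J], where \<phi> = "\<lambda>c. c"])
    show "?W \<subseteq> fr R ?k" by auto
    show "scaled I ?k w ?W \<subseteq> ?W"
    proof
      fix v assume "v \<in> scaled I ?k w ?W"
      then show "v \<in> ?W" unfolding scaled_def
        using WI V.submod_add[OF W] V.submod_smult[OF W w] by blast
    qed
    show "lin ?W ?W' (\<lambda>c. c)"
      by (rule lin_on_subset[OF lin_on_id subset_refl]) (use fI_scaled[OF N] in blast)
    show "resolvable R J n (\<lambda>i. f (Suc i)) ?W (scaled I ?k w ?W)" by fact
    fix v
    {
      assume "v \<in> ?W'"
      then obtain u x where v: "v \<in> fr R ?k" "u \<in> fI R I k" "x \<in> N" "p v = vadd u (w \<odot>\<^bsub>seqs R\<^esub> x)"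
        unfolding scaled_def by blast
      obtain a u' where a: "a \<in> fr R ?k" "u' \<in> fI R I k" "x = vadd (p a) u'"
        using p(1) v(3) unfolding covers_def by blast
      \<comment> \<open>Subtracting \<open>w\<close> times a lift \<open>a\<close> of
        \<open>x\<close> removes the multiple of \<open>w\<close> from \<open>p v\<close>.\<close>
      have wa: "w \<odot>\<^bsub>seqs R\<^esub> a \<in> fr R ?k" using V.submod_smult[OF submod_fr w] a by blast
      have "p v = vadd (p (w \<odot>\<^bsub>seqs R\<^esub> a)) (vadd u (w \<odot>\<^bsub>seqs R\<^esub> u'))"
        using v a w Ivc Nc lin_on_mem[OF lp] lin_on_smult[OF lp w]
        by (simp add: V.smult_r_distr V.M.a_ac V.smult_closed del: seqs_simps)
      moreover have uu: "vadd u (w \<odot>\<^bsub>seqs R\<^esub> u') \<in> fI R I k"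
        using v a wI V.submod_add[OF submod_fI[OF I]] by blast
      moreover have "p (vsub v (w \<odot>\<^bsub>seqs R\<^esub> a)) = vsub (p v) (p (w \<odot>\<^bsub>seqs R\<^esub> a))"
        using lin_minus[OF submod_fr N lp v(1) wa] .
      ultimately have "p (vsub v (w \<odot>\<^bsub>seqs R\<^esub> a)) = vadd u (w \<odot>\<^bsub>seqs R\<^esub> u')"
        using V.minus_add_cancel Ivc Nc lin_on_mem[OF lp] wa by metis
      then have "vsub v (w \<odot>\<^bsub>seqs R\<^esub> a) \<in> ?W" using uu V.submod_minus[OF submod_fr v(1) wa] by simp
      moreover have "w \<odot>\<^bsub>seqs R\<^esub> a \<in> fI R J ?k"
        using a wJ w by (auto simp: fI_def fr_def)
      moreover have "v = vadd (vsub v (w \<odot>\<^bsub>seqs R\<^esub> a)) (w \<odot>\<^bsub>seqs R\<^esub> a)"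
        using V.add_minus_cancel[OF fc[OF v(1)] fc[OF wa]] V.M.a_comm[OF fc[OF wa], of "vsub v (w \<odot>\<^bsub>seqs R\<^esub> a)"]
          fc[OF V.submod_minus[OF submod_fr v(1) wa]] by metis
      ultimately show "\<exists>c\<in>?W. \<exists>l\<in>fI R J ?k. v = vadd c l" by blast
    }
    assume vW: "v \<in> ?W"
    show "v \<in> fI R J ?k \<longleftrightarrow> v \<in> scaled I ?k w ?W"
    proof
      assume "v \<in> scaled I ?k w ?W"
      then show "v \<in> fI R J ?k" unfolding fI_J_scaled by (auto simp: scaled_def)
    next
      assume "v \<in> fI R J ?k"
      then obtain u a where v: "u \<in> fI R I ?k" "a \<in> fr R ?k" "v = vadd u (w \<odot>\<^bsub>seqs R\<^esub> a)"
        unfolding fI_J_scaled scaled_def by blast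
      have wa: "w \<odot>\<^bsub>seqs R\<^esub> a \<in> fr R ?k" using V.submod_smult[OF submod_fr w] v by blast
      have pu: "p u \<in> fI R I k" using fI_maps[OF left_module_seqs N submod_fI[OF I] lp IN v(1)] .
      have pa: "p a \<in> fr R k" using lin_on_mem[OF lp] v(2) Suc(3) by blast
      have "p v = vadd (p u) (w \<odot>\<^bsub>seqs R\<^esub> p a)"
        using v wa lin_on_add[OF lp _ wa] lin_on_smult[OF lp w] by (simp add: fI_def)
      moreover have "w \<odot>\<^bsub>seqs R\<^esub> p a \<in> carrier (seqs R)" using V.smult_closed[OF w fc[OF pa]] .
      \<comment> \<open>Regularity enters here: \<open>p v\<close> and \<open>p u\<close> lie in
        I^k, hence so does \<open>w\<close> times \<open>p a\<close>, and \<open>w\<close> can be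
        cancelled. This is the vanishing of the first Tor group of N/I^k against R/J.\<close>
      ultimately have "w \<odot>\<^bsub>seqs R\<^esub> p a \<in> fI R I k"
        using vW V.submod_add_cancel(1)[OF submod_fI[OF I] pu] by simp
      then have "p a \<in> fI R I k" using wreg pa by blast
      then show "v \<in> scaled I ?k w ?W" unfolding scaled_def using v by blast
    qed
  qed
  moreover have "covers R ?k p N (scaled I k w N)"
    using p(1) fI_scaled[OF N] unfolding covers_def by blast
  ultimately show ?case by auto
qed simp

text \<open>Right multiplication by \<open>w\<close> is linear for left modules and induces an
  isomorphism from R/m to J/(I + wm). It is onto because wc equals some c'w modulo \<open>I\<close>.
  If vw lies in I + wm, moving \<open>w\<close> to the right gives (v - y')w in \<open>I\<close>
  with y' in \<open>m\<close>, so regularity puts v into \<open>m\<close>.\<close>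

lemma resolvable_J_mod_scaled:
  assumes "resolvable R J n s (fr R 1) (fI R m 1)"
  shows "resolvable R J n s (fI R J 1) (scaled I 1 w (fI R m 1))"
proof (rule resolvable_iso[OF submod_fr submod_fI[OF m] submod_fI[OF J] subm_scaled[OF submod_fI[OF m]],
    where \<phi> = "\<lambda>v i. v i \<otimes> w"])
  show "fI R m 1 \<subseteq> fr R 1" "fI R m 1 \<subseteq> fr R 1" by (auto simp: fI_def)
  have wmem: "w \<in> J" using wJ[of \<one>] w by simp
  show "lin (fr R 1) (fI R J 1) (\<lambda>v i. v i \<otimes> w)"
    using w wmem by (intro lin_onI) (auto simp: fr_def fI_def fun_eq_iff l_distr m_assoc J.I_l_closed)
  fix v
  {
    assume "v \<in> fI R J 1"
    then obtain u c where v: "u \<in> fI R I 1" "c \<in> fr R 1" "v = vadd u (w \<odot>\<^bsub>seqs R\<^esub> c)"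
      unfolding fI_J_scaled scaled_def by blast
    obtain c' t where c': "c' \<in> carrier R" "t \<in> I" "w \<otimes> c 0 = t \<oplus> c' \<otimes> w"
      using normal_left[of "c 0"] v(2) by (auto simp: fr_def)
    let ?u = "vadd u (\<lambda>i. if i = 0 then t else \<zero>)"
    have "?u \<in> fI R I 1" using v(1) c' by (auto simp: fI_def fr_def)
    then have "?u \<in> scaled I 1 w (fI R m 1)" using fI_scaled[OF submod_fI[OF m]] by blast
    moreover have "v = vadd (\<lambda>i. (if i = 0 then c' else \<zero>) \<otimes> w) ?u"
      using v c' w by (auto simp: fun_eq_iff fr_def fI_def a_ac)
    moreover have "(\<lambda>i. if i = 0 then c' else \<zero>) \<in> fr R 1" using c' by (auto simp: fr_def)
    ultimately show "\<exists>x\<in>fr R 1. \<exists>l\<in>scaled I 1 w (fI R m 1). v = vadd (\<lambda>i. x i \<otimes> w) l"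
      by (intro bexI[of _ "\<lambda>i. if i = 0 then c' else \<zero>"] bexI[of _ ?u])
  }
  assume v: "v \<in> fr R 1"
  show "(\<lambda>i. v i \<otimes> w) \<in> scaled I 1 w (fI R m 1) \<longleftrightarrow> v \<in> fI R m 1"
  proof
    assume "(\<lambda>i. v i \<otimes> w) \<in> scaled I 1 w (fI R m 1)"
    then obtain u y where uy: "u \<in> fI R I 1" "y \<in> fI R m 1" "(\<lambda>i. v i \<otimes> w) = vadd u (w \<odot>\<^bsub>seqs R\<^esub> y)"
      unfolding scaled_def by blast
    then have e: "v 0 \<otimes> w = u 0 \<oplus> w \<otimes> y 0" by (metis seqs_simps(3,4))
    obtain y' t where y': "y' \<in> m" "t \<in> I" "w \<otimes> y 0 = t \<oplus> y' \<otimes> w"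
      using normal_left_m[of "y 0"] uy by (auto simp: fI_def)
    have c: "v 0 \<in> carrier R" "u 0 \<in> I" "y' \<in> carrier R" "t \<in> carrier R" using v uy y' by (auto simp: fr_def fI_def)
    have "(v 0 \<ominus> y') \<otimes> w = u 0 \<oplus> t"
      using c e y' w by (simp add: a_minus_def l_distr l_minus) (simp add: a_assoc r_neg Ic)
    then have "v 0 \<ominus> y' \<in> I" using regular_right[of "v 0 \<ominus> y'"] c y' by simp
    then have "v 0 \<ominus> y' \<in> m" using IJ Jm by blast
    then have "(v 0 \<ominus> y') \<oplus> y' \<in> m" using y' by simp
    moreover have "(v 0 \<ominus> y') \<oplus> y' = v 0" using c by (simp add: a_minus_def a_assoc l_neg)
    ultimately have "v 0 \<in> m" by simp
    then show "v \<in> fI R m 1" using v by (auto simp: fI_def fr_def) (metis One_nat_def Suc_leI m.zero_closed not_gr0)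
  next
    assume "v \<in> fI R m 1"
    then have "v 0 \<in> m" by (auto simp: fI_def)
    then obtain y' t where y': "y' \<in> m" "t \<in> I" "v 0 \<otimes> w = t \<oplus> w \<otimes> y'"
      using normal_right_m by blast
    have "(\<lambda>i. v i \<otimes> w) = vadd (\<lambda>i. if i = 0 then t else \<zero>) (w \<odot>\<^bsub>seqs R\<^esub> (\<lambda>i. if i = 0 then y' else \<zero>))"
      using v y' w by (auto simp: fun_eq_iff fr_def)
    moreover have "(\<lambda>i. if i = 0 then t else \<zero>) \<in> fI R I 1" "(\<lambda>i. if i = 0 then y' else \<zero>) \<in> fI R m 1"
      using y' by (auto simp: fI_def fr_def)
    ultimately show "(\<lambda>i. v i \<otimes> w) \<in> scaled I 1 w (fI R m 1)" unfolding scaled_def by blast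
  qed
qed (rule assms)

text \<open>The cover of R/m by R/J has rank 1 and syzygies m/J.\<close>

lemma resolvable_trivial:
  assumes "resolvable R J n g (fI R m 1) (fI R J 1)"
  shows "resolvable R J (Suc n) (case_nat 1 g) (fr R 1) (fI R m 1)"
proof -
  have "covers R 1 (\<lambda>c. c) (fr R 1) (fI R m 1)"
    unfolding covers_def
  proof (intro conjI ballI lin_on_id)
    fix v assume v: "v \<in> fr R 1"
    then have "v = vadd v \<zero>\<^bsub>seqs R\<^esub>" by (auto simp: fun_eq_iff fr_def)
    then show "\<exists>c\<in>fr R 1. \<exists>l\<in>fI R m 1. v = vadd c l"
      using v V.submod_zero[OF submod_fI[OF m]] by blast
  qed
  moreover have "{c \<in> fr R 1. c \<in> fI R m 1} = fI R m 1" by (auto simp: fI_def)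
  ultimately show ?thesis using assms by (auto intro!: exI[of _ "\<lambda>c. c"])
qed

text \<open>Length n for m/J uses length n - 1 for J/(I + wm), that is for R/m, and this uses length
  n - 2 for m/J. Hence the strong induction and the shift by two in
  \<open>quotient_rank\<close>.\<close>

lemma resolvable_change_of_rings:
  assumes "\<And>n. resolvable R I n f (fI R m 1) (fI R I 1)"
  shows "resolvable R J n (quotient_rank f) (fI R m 1) (fI R J 1)"
proof (induction n rule: less_induct)
  case (less n)
  show ?case
  proof (cases n)
    case (Suc n')
    let ?L = "scaled I 1 w (fI R m 1)"
    have sub: "fI R m 1 \<subseteq> fr R 1" by (auto simp: fI_def)
    have L: "subm ?L" by (rule subm_scaled[OF submod_fI[OF m] sub])
    have LJ: "?L \<subseteq> fI R J 1" unfolding fI_J_scaled using sub by (auto simp: scaled_def)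
    have 1: "resolvable R J (Suc n') f (fI R m 1) ?L"
      using resolvable_reduce[OF submod_fI[OF m] sub _ assms] fI_mono IJ Jm by (meson order_trans)
    have 2: "resolvable R J n' (case_nat 1 (quotient_rank f)) (fr R 1) (fI R m 1)"
    proof (cases n')
      case (Suc n'')
      then show ?thesis using resolvable_trivial less.IH[of n''] \<open>n = Suc n'\<close> by simp
    qed simp
    \<comment> \<open>As J = I + wR, these products lie in I + wm, so m/?L is a module over
      R/J.\<close>
    have JL: "a \<odot>\<^bsub>seqs R\<^esub> v \<in> ?L" if "a \<in> J" "v \<in> fI R m 1" for a v
    proof -
      obtain u c where a: "u \<in> I" "c \<in> carrier R" "a = u \<oplus> w \<otimes> c" using \<open>a \<in> J\<close> J_eq by blast
      have v: "\<And>i. v i \<in> carrier R" "\<And>i. i \<ge> 1 \<Longrightarrow> v i = \<zero>" using that(2) by (auto simp: fI_def fr_def)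
      have "a \<odot>\<^bsub>seqs R\<^esub> v = vadd (u \<odot>\<^bsub>seqs R\<^esub> v) (w \<odot>\<^bsub>seqs R\<^esub> (c \<odot>\<^bsub>seqs R\<^esub> v))"
        using a v w by (auto simp: fun_eq_iff l_distr m_assoc Ic)
      moreover have "u \<odot>\<^bsub>seqs R\<^esub> v \<in> fI R I 1" using a v by (auto simp: fI_def fr_def I.I_r_closed)
      moreover have "c \<odot>\<^bsub>seqs R\<^esub> v \<in> fI R m 1" using V.submod_smult[OF submod_fI[OF m] a(2) that(2)] .
      ultimately show ?thesis unfolding scaled_def by blast
    qed
    have eq: "f i + (case i of 0 \<Rightarrow> 0 | Suc i \<Rightarrow> case i of 0 \<Rightarrow> 1 | Suc i \<Rightarrow> quotient_rank f i) = quotient_rank f i" for i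
      by (induction f i rule: quotient_rank.induct) auto
    have "resolvable R J (Suc n') (\<lambda>i. f i + (case i of 0 \<Rightarrow> 0 | Suc i \<Rightarrow> case_nat 1 (quotient_rank f) i)) (fI R m 1) (fI R J 1)"
      using resolvable_quotient[OF J submod_fI[OF m] submod_fI[OF J] L fI_mono[OF Jm] LJ JL 1]
        resolvable_J_mod_scaled[OF 2] by blast
    then show ?thesis unfolding eq Suc .
  qed simp
qed

end

text \<open>Here the representation by pairs is left. With S = R/J through \<open>\<rho>\<close>,
  the image of \<open>K\<close> is K/J^k. This shape is stable under syzygies, which are again taken
  modulo some power of \<open>J\<close>.\<close>

lemma resolvable_transfer:
  assumes "ring R" "ring S" "\<rho> \<in> ring_hom R S" "\<rho> ` carrier R = carrier S"
    and Jid: "ideal J R" and J: "\<And>x. x \<in> carrier R \<Longrightarrow> \<rho> x = \<zero>\<^bsub>S\<^esub> \<longleftrightarrow> x \<in> J"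
  shows "submodule K R (seqs R) \<Longrightarrow> K \<subseteq> fr R k \<Longrightarrow> fI R J k \<subseteq> K \<Longrightarrow> resolvable R J n r K (fI R J k) \<Longrightarrow>
    resolvable S {\<zero>\<^bsub>S\<^esub>} n r ((\<lambda>v i. \<rho> (v i)) ` K) {\<lambda>_. \<zero>\<^bsub>S\<^esub>}"
proof (induction n arbitrary: K k r)
  case (Suc n)
  interpret R: ring R by fact
  interpret S: ring S by fact
  interpret h: ring_hom_ring R S \<rho> by (rule ring_hom_ringI2[OF assms(1-3)])
  define P where "P = (\<lambda>v :: nat \<Rightarrow> 'a. \<lambda>i. \<rho> (v i))"
  have Padd: "P (v \<oplus>\<^bsub>seqs R\<^esub> v') = P v \<oplus>\<^bsub>seqs S\<^esub> P v'" if "v \<in> carrier (seqs R)" "v' \<in> carrier (seqs R)" for v v'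
    using that by (auto simp: P_def fun_eq_iff)
  have Psm: "P (a \<odot>\<^bsub>seqs R\<^esub> v) = \<rho> a \<odot>\<^bsub>seqs S\<^esub> P v" if "v \<in> carrier (seqs R)" "a \<in> carrier R" for v a
    using that by (auto simp: P_def fun_eq_iff)
  have Pz: "P v = (\<lambda>_. \<zero>\<^bsub>S\<^esub>) \<longleftrightarrow> v \<in> fI R J k" if "v \<in> fr R k" for v k
    using that J by (auto simp: P_def fI_def fr_def fun_eq_iff)
  have Pfr: "P ` fr R k = fr S k" for k
  proof
    show "P ` fr R k \<subseteq> fr S k" by (auto simp: P_def fr_def)
    show "fr S k \<subseteq> P ` fr R k"
    proof
      fix v assume v: "v \<in> fr S k"
      then have "\<forall>i. \<exists>c. c \<in> carrier R \<and> v i = \<rho> c" using assms(4) by (auto simp: fr_def)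
      then obtain c where c: "\<And>i. c i \<in> carrier R" "\<And>i. v i = \<rho> (c i)" by metis
      have "v = P (R.head k c)" using c v by (auto simp: P_def R.head_def fr_def fun_eq_iff)
      moreover have "R.head k c \<in> fr R k" using c by (auto simp: R.head_def fr_def)
      ultimately show "v \<in> P ` fr R k" by blast
    qed
  qed
  have fc: "v \<in> fr R k' \<Longrightarrow> v \<in> carrier (seqs R)" for v k' by (simp add: fr_def)
  let ?k = "r 0"
  obtain p where p: "covers R ?k p K (fI R J k)"
    "resolvable R J n (\<lambda>i. r (Suc i)) {c \<in> fr R ?k. p c \<in> fI R J k} (fI R J ?k)" using Suc(5) by auto
  have lp: "R.lin (fr R ?k) K p" using p(1) by (simp add: covers_def)
  have JK: "a \<odot>\<^bsub>seqs R\<^esub> v \<in> fI R J k" if "a \<in> J" "v \<in> K" for a v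
  proof -
    interpret J: ideal J R by (rule Jid)
    show ?thesis using that Suc(3) by (auto simp: fI_def fr_def J.I_r_closed)
  qed
  have pJ: "p c \<in> fI R J k" if "c \<in> fI R J ?k" for c
    using R.fI_maps[OF R.left_module_seqs Suc(2) R.submod_fI[OF Jid] lp JK that] .
  \<comment> \<open>\<open>P (p c)\<close> depends only on \<open>P c\<close>, because
    \<open>p\<close> maps \<open>fI R J ?k\<close> into \<open>fI R J k\<close>; so \<open>p\<close>
    descends to a map \<open>q\<close> on the free module over \<open>S\<close>.\<close>
  have Pp: "P (p c) = P (p c')" if "c \<in> fr R ?k" "c' \<in> fr R ?k" "P c = P c'" for c c'
  proof -
    have "\<rho> (c i \<ominus>\<^bsub>R\<^esub> c' i) = \<zero>\<^bsub>S\<^esub>" for i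
      using that by (auto simp: P_def fun_eq_iff fr_def a_minus_def S.r_neg)
    then have d: "R.vsub c c' \<in> fI R J ?k"
      using that R.V.submod_minus[OF R.submod_fr that(1,2)] J by (auto simp: fI_def R.seqs_minus fr_def)
    have pc: "p c \<in> fr R k" "p c' \<in> fr R k" using that lin_on_mem[OF lp] Suc(3) by blast+
    have "p (R.vsub c c') = R.vsub (p c) (p c')" using R.lin_minus[OF R.submod_fr Suc(2) lp that(1,2)] .
    then have "R.vsub (p c) (p c') \<in> fI R J k" using pJ[OF d] by simp
    then have "\<rho> (p c i \<ominus>\<^bsub>R\<^esub> p c' i) = \<zero>\<^bsub>S\<^esub>" for i
      using pc J by (auto simp: fI_def R.seqs_minus fr_def)
    moreover have "p c i \<in> carrier R" "p c' i \<in> carrier R" for i using pc by (simp_all add: fr_def)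
    ultimately have "\<rho> (p c i) \<ominus>\<^bsub>S\<^esub> \<rho> (p c' i) = \<zero>\<^bsub>S\<^esub>" for i by (simp add: a_minus_def)
    then have "\<rho> (p c' i) = \<rho> (p c i)" for i
      using pc S.minus_equality[of "\<rho> (p c i)" "\<ominus>\<^bsub>S\<^esub> \<rho> (p c' i)"] S.minus_minus
      by (simp add: fr_def a_minus_def)
    then show ?thesis by (simp add: P_def)
  qed
  define s where "s = (\<lambda>a. SOME c. c \<in> fr R ?k \<and> P c = a)"
  have s: "s a \<in> fr R ?k" "P (s a) = a" if "a \<in> fr S ?k" for a
  proof -
    have "\<exists>c. c \<in> fr R ?k \<and> P c = a" using that unfolding Pfr[of ?k, symmetric] by blast
    from someI_ex[OF this] show "s a \<in> fr R ?k" "P (s a) = a" unfolding s_def by blast+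
  qed
  define q where "q = (\<lambda>a. P (p (s a)))"
  have q: "q (P c) = P (p c)" if "c \<in> fr R ?k" for c
  proof -
    have "P c \<in> fr S ?k" using Pfr[of ?k] that by blast
    then show ?thesis unfolding q_def using Pp[OF s(1) that s(2)] by blast
  qed
  have lq: "S.lin (fr S ?k) (P ` K) q"
    unfolding Pfr[symmetric]
  proof (rule lin_onI, goal_cases)
    case (1 x) then show ?case using q lin_on_mem[OF lp] by auto
  next
    case (2 x y)
    then obtain c c' where c: "c \<in> fr R ?k" "x = P c" "c' \<in> fr R ?k" "y = P c'" by blast
    have "q (x \<oplus>\<^bsub>seqs S\<^esub> y) = q (P (R.vadd c c'))" using c fc Padd by simp
    also have "\<dots> = P (p (R.vadd c c'))" using q R.V.submod_add[OF R.submod_fr] c by blast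
    also have "\<dots> = q x \<oplus>\<^bsub>seqs S\<^esub> q y"
      unfolding c(2,4) q[OF c(1)] q[OF c(3)] lin_on_add[OF lp c(1,3)]
      using Padd fc subsetD[OF Suc(3) lin_on_mem[OF lp c(1)]] subsetD[OF Suc(3) lin_on_mem[OF lp c(3)]] by blast
    finally show ?case .
  next
    case (3 a x)
    then obtain c b where c: "c \<in> fr R ?k" "x = P c" "b \<in> carrier R" "a = \<rho> b" using assms(4) by blast
    have "q (a \<odot>\<^bsub>seqs S\<^esub> x) = q (P (b \<odot>\<^bsub>seqs R\<^esub> c))" using c fc Psm by simp
    also have "\<dots> = P (p (b \<odot>\<^bsub>seqs R\<^esub> c))" using q R.V.submod_smult[OF R.submod_fr] c by blast
    also have "\<dots> = a \<odot>\<^bsub>seqs S\<^esub> q x"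
      unfolding c(2,4) q[OF c(1)] lin_on_smult[OF lp c(3,1)]
      using Psm fc subsetD[OF Suc(3) lin_on_mem[OF lp c(1)]] c(3) by blast
    finally show ?case .
  qed
  have "covers S ?k q (P ` K) {\<lambda>_. \<zero>\<^bsub>S\<^esub>}"
    unfolding covers_def
  proof (intro conjI ballI lq)
    fix v assume "v \<in> P ` K"
    then obtain x where x: "x \<in> K" "v = P x" by blast
    then obtain c l where c: "c \<in> fr R ?k" "l \<in> fI R J k" "x = R.vadd (p c) l"
      using p(1) unfolding covers_def by blast
    have l: "l \<in> fr R k" using c by (simp add: fI_def)
    have "v = P (p c) \<oplus>\<^bsub>seqs S\<^esub> P l"
      unfolding x(2) c(3) using Padd fc[OF l] fc[OF subsetD[OF Suc(3) lin_on_mem[OF lp c(1)]]] by blast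
    then have "v = q (P c) \<oplus>\<^bsub>seqs S\<^esub> (\<lambda>_. \<zero>\<^bsub>S\<^esub>)" using q[OF c(1)] Pz[OF l] c(2) by simp
    moreover have "P c \<in> fr S ?k" using c(1) Pfr[of ?k] by blast
    ultimately show "\<exists>c\<in>fr S ?k. \<exists>l\<in>{\<lambda>_. \<zero>\<^bsub>S\<^esub>}. v = q c \<oplus>\<^bsub>seqs S\<^esub> l" by blast
  qed
  moreover
  let ?W = "{c \<in> fr R ?k. p c \<in> fI R J k}"
  have "{c \<in> fr S ?k. q c \<in> {\<lambda>_. \<zero>\<^bsub>S\<^esub>}} = P ` ?W"
  proof -
    have "q (P c) = (\<lambda>_. \<zero>\<^bsub>S\<^esub>) \<longleftrightarrow> p c \<in> fI R J k" if "c \<in> fr R ?k" for c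
      using q[OF that] Pz lin_on_mem[OF lp that] Suc(3) by auto
    then show ?thesis unfolding Pfr[symmetric] by auto
  qed
  moreover have "resolvable S {\<zero>\<^bsub>S\<^esub>} n (\<lambda>i. r (Suc i)) (P ` ?W) {\<lambda>_. \<zero>\<^bsub>S\<^esub>}"
    unfolding P_def
  proof (rule Suc(1)[OF _ _ _ p(2)])
    show "submodule ?W R (seqs R)" by (rule R.subm_vimage[OF R.submod_fr Suc(2) R.submod_fI[OF Jid] lp])
    show "fI R J ?k \<subseteq> ?W" using pJ by (auto simp: fI_def)
  qed auto
  ultimately show ?case by (auto simp: S.fI_zero P_def)
qed simp

section \<open>Noetherian rings of finite global dimension\<close>

text \<open>
  \<open>Z\<close> is a direct summand of \<open>Z'\<close> up to a map that factors through \<open>P\<close>. Passing to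
  syzygies preserves this relation, which replaces the comparison of resolutions by chain maps
  and homotopies.
\<close>

definition stable_retract where
  "stable_retract R M P Z N P' Z' \<longleftrightarrow> (\<exists>\<alpha> \<beta> \<theta>. lin_on R M P N P' \<alpha> \<and> lin_on R N P' M P \<beta> \<and> lin_on R M P M Z \<theta> \<and>
     (\<forall>z\<in>Z. \<alpha> z \<in> Z') \<and> (\<forall>z\<in>Z'. \<beta> z \<in> Z) \<and> (\<forall>z\<in>Z. z = \<beta> (\<alpha> z) \<oplus>\<^bsub>M\<^esub> \<theta> z))"

text \<open>The lifting property against the single map \<open>d\<close>, used in place of
  projectivity, so that free modules of any type and projective modules on \<open>'a set\<close> are
  treated alike.\<close>

definition lifts where
  "lifts R M X N Y Q W d \<longleftrightarrow>
     (\<forall>q. lin_on R M X Q W q \<longrightarrow> (\<exists>p. lin_on R M X N Y p \<and> (\<forall>x\<in>X. d (p x) = q x)))"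

text \<open>\<open>\<alpha>\<close> and \<open>\<beta>\<close> lift to maps \<open>\<alpha>1\<close>
  and \<open>\<beta>1\<close> of the covers, and \<open>\<theta>\<close>, being defined on all of
  \<open>P\<close>, lifts to \<open>\<tau>\<close>. On \<open>Z\<close> the identity is
  \<open>\<beta>\<close> \<open>\<alpha>\<close> + \<open>\<theta>\<close>, so \<open>d\<close>
  kills the values of 1 - \<open>\<beta>1\<close> \<open>\<alpha>1\<close> - \<open>\<tau>\<close>
  \<open>d\<close>. This map is the new correction into the kernel, and on the kernel its last term
  vanishes.\<close>

lemma stable_retract_syzygy:
  assumes mod: "left_module R M" "left_module R N" "left_module R M1" "left_module R N1"
    and sub: "submodule P R M" "submodule Z R M" "submodule P' R N" "submodule Z' R N"
      "submodule P1 R M1" "submodule P1' R N1" and "Z \<subseteq> P" "Z' \<subseteq> P'"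
    and d: "lin_on R M1 P1 M Z d" and d': "lin_on R N1 P1' N Z' d'"
    and lifts: "lifts R M1 P1 N1 P1' N Z' d'" "lifts R N1 P1' M1 P1 M Z d" "lifts R M P M1 P1 M Z d"
    and sr: "stable_retract R M P Z N P' Z'"
  shows "stable_retract R M1 P1 {x \<in> P1. d x = \<zero>\<^bsub>M\<^esub>} N1 P1' {x \<in> P1'. d' x = \<zero>\<^bsub>N\<^esub>}"
proof -
  interpret M: left_module R M by fact
  interpret N: left_module R N by fact
  interpret M1: left_module R M1 by fact
  interpret N1: left_module R N1 by fact
  obtain \<alpha> \<beta> \<theta> where a: "lin_on R M P N P' \<alpha>" "\<And>z. z \<in> Z \<Longrightarrow> \<alpha> z \<in> Z'"
    and b: "lin_on R N P' M P \<beta>" "\<And>z. z \<in> Z' \<Longrightarrow> \<beta> z \<in> Z"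
    and t: "lin_on R M P M Z \<theta>" "\<And>z. z \<in> Z \<Longrightarrow> z = \<beta> (\<alpha> z) \<oplus>\<^bsub>M\<^esub> \<theta> z"
    using sr unfolding stable_retract_def by blast
  have aZ: "lin_on R M Z N Z' \<alpha>" by (rule lin_on_subset[OF a(1) \<open>Z \<subseteq> P\<close> a(2)])
  have bZ: "lin_on R N Z' M Z \<beta>" by (rule lin_on_subset[OF b(1) \<open>Z' \<subseteq> P'\<close> b(2)])
  obtain \<alpha>1 where a1: "lin_on R M1 P1 N1 P1' \<alpha>1" "\<And>x. x \<in> P1 \<Longrightarrow> d' (\<alpha>1 x) = \<alpha> (d x)"
    using lifts(1) lin_on_comp[OF d aZ] unfolding lifts_def by blast
  obtain \<beta>1 where b1: "lin_on R N1 P1' M1 P1 \<beta>1" "\<And>x. x \<in> P1' \<Longrightarrow> d (\<beta>1 x) = \<beta> (d' x)"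
    using lifts(2) lin_on_comp[OF d' bZ] unfolding lifts_def by blast
  obtain \<tau> where tau: "lin_on R M P M1 P1 \<tau>" "\<And>x. x \<in> P \<Longrightarrow> d (\<tau> x) = \<theta> x"
    using lifts(3) t(1) unfolding lifts_def by blast
  let ?K = "{x \<in> P1. d x = \<zero>\<^bsub>M\<^esub>}" and ?K' = "{x \<in> P1'. d' x = \<zero>\<^bsub>N\<^esub>}"
  define \<theta>1 where "\<theta>1 = (\<lambda>x. x \<ominus>\<^bsub>M1\<^esub> (\<beta>1 (\<alpha>1 x) \<oplus>\<^bsub>M1\<^esub> \<tau> (d x)))"
  have dP: "lin_on R M1 P1 M P d" by (rule lin_on_subset[OF d subset_refl]) (use lin_on_mem[OF d] \<open>Z \<subseteq> P\<close> in blast)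
  have l1: "lin_on R M1 P1 M1 P1 (\<lambda>x. \<beta>1 (\<alpha>1 x))" by (rule lin_on_comp[OF a1(1) b1(1)])
  have l2: "lin_on R M1 P1 M1 P1 (\<lambda>x. \<tau> (d x))" by (rule lin_on_comp[OF dP tau(1)])
  have l3: "lin_on R M1 P1 M1 P1 (\<lambda>x. \<beta>1 (\<alpha>1 x) \<oplus>\<^bsub>M1\<^esub> \<tau> (d x))"
    by (rule lin_on_plus[OF mod(3,3) sub(5,5) l1 l2])
  have t1: "lin_on R M1 P1 M1 P1 \<theta>1"
    unfolding \<theta>1_def by (rule lin_on_diff[OF mod(3,3) sub(5,5) lin_on_id l3])
  have P1c: "x \<in> P1 \<Longrightarrow> x \<in> carrier M1" for x using M1.submod_carrier[OF sub(5)] .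
  have Zc: "x \<in> Z \<Longrightarrow> x \<in> carrier M" for x using M.submod_carrier[OF sub(2)] .
  have "d (\<theta>1 x) = \<zero>\<^bsub>M\<^esub>" if x: "x \<in> P1" for x
  proof -
    have "d (\<theta>1 x) = d x \<ominus>\<^bsub>M\<^esub> d (\<beta>1 (\<alpha>1 x) \<oplus>\<^bsub>M1\<^esub> \<tau> (d x))"
      unfolding \<theta>1_def by (rule lin_on_minus[OF mod(3,1) sub(5,2) d x lin_on_mem[OF l3 x]])
    also have "d (\<beta>1 (\<alpha>1 x) \<oplus>\<^bsub>M1\<^esub> \<tau> (d x)) = \<beta> (\<alpha> (d x)) \<oplus>\<^bsub>M\<^esub> \<theta> (d x)"
      using lin_on_add[OF d lin_on_mem[OF l1 x] lin_on_mem[OF l2 x]] b1(2)[OF lin_on_mem[OF a1(1) x]] a1(2)[OF x]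
        tau(2)[OF lin_on_mem[OF dP x]] by simp
    also have "\<dots> = d x" using t(2)[OF lin_on_mem[OF d x]] by simp
    also have "d x \<ominus>\<^bsub>M\<^esub> d x = \<zero>\<^bsub>M\<^esub>" using Zc[OF lin_on_mem[OF d x]] by (simp add: a_minus_def M.M.r_neg)
    finally show ?thesis .
  qed
  then have "lin_on R M1 P1 M1 ?K \<theta>1"
    using lin_on_mem[OF t1] by (intro lin_on_subset[OF t1 subset_refl]) blast
  moreover have "\<alpha>1 z \<in> ?K'" if "z \<in> ?K" for z
    using that a1(2) lin_on_mem[OF a1(1)] lin_on_zero[OF mod(1,2) sub(1,3) a(1)] by simp
  moreover have "\<beta>1 z \<in> ?K" if "z \<in> ?K'" for z
    using that b1(2) lin_on_mem[OF b1(1)] lin_on_zero[OF mod(2,1) sub(3,1) b(1)] by simp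
  moreover have "z = \<beta>1 (\<alpha>1 z) \<oplus>\<^bsub>M1\<^esub> \<theta>1 z" if z: "z \<in> ?K" for z
  proof -
    have "\<tau> (d z) = \<zero>\<^bsub>M1\<^esub>" using z lin_on_zero[OF mod(1,3) sub(1,5) tau(1)] by simp
    then have "\<theta>1 z = z \<ominus>\<^bsub>M1\<^esub> \<beta>1 (\<alpha>1 z)"
      using z P1c lin_on_mem[OF l1] by (simp add: \<theta>1_def)
    then show ?thesis using M1.add_minus_cancel[of z "\<beta>1 (\<alpha>1 z)"] z P1c lin_on_mem[OF l1] by simp
  qed
  ultimately show ?thesis unfolding stable_retract_def using a1(1) b1(1) by blast
qed

text \<open>The start of the comparison, in the manner of Schanuel's lemma. Lifting each of
  \<open>d\<close> and \<open>d'\<close> through the other gives \<open>\<alpha>\<close> and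
  \<open>\<beta>\<close>; then \<open>d\<close> kills the values of 1 - \<open>\<beta>\<close>
  \<open>\<alpha>\<close> on all of \<open>P\<close>, and this map serves as the correction.\<close>

lemma stable_retract_kernels:
  assumes mod: "left_module R M" "left_module R N" "left_module R Q"
    and sub: "submodule P R M" "submodule P' R N" "submodule X R Q"
    and d: "lin_on R M P Q X d" and d': "lin_on R N P' Q X d'"
    and lifts: "lifts R M P N P' Q X d'" "lifts R N P' M P Q X d"
  shows "stable_retract R M P {x \<in> P. d x = \<zero>\<^bsub>Q\<^esub>} N P' {x \<in> P'. d' x = \<zero>\<^bsub>Q\<^esub>}"
proof -
  interpret M: left_module R M by fact
  interpret N: left_module R N by fact
  interpret Q: left_module R Q by fact
  obtain \<alpha> where a: "lin_on R M P N P' \<alpha>" "\<And>x. x \<in> P \<Longrightarrow> d' (\<alpha> x) = d x"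
    using lifts(1) d unfolding lifts_def by blast
  obtain \<beta> where b: "lin_on R N P' M P \<beta>" "\<And>x. x \<in> P' \<Longrightarrow> d (\<beta> x) = d' x"
    using lifts(2) d' unfolding lifts_def by blast
  let ?K = "{x \<in> P. d x = \<zero>\<^bsub>Q\<^esub>}" and ?K' = "{x \<in> P'. d' x = \<zero>\<^bsub>Q\<^esub>}"
  have ab: "lin_on R M P M P (\<lambda>x. \<beta> (\<alpha> x))" by (rule lin_on_comp[OF a(1) b(1)])
  have t: "lin_on R M P M P (\<lambda>x. x \<ominus>\<^bsub>M\<^esub> \<beta> (\<alpha> x))"
    by (rule lin_on_diff[OF mod(1,1) sub(1,1) lin_on_id ab])
  have Pc: "x \<in> P \<Longrightarrow> x \<in> carrier M" for x using M.submod_carrier[OF sub(1)] .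
  have "d (x \<ominus>\<^bsub>M\<^esub> \<beta> (\<alpha> x)) = \<zero>\<^bsub>Q\<^esub>" if x: "x \<in> P" for x
    using lin_on_minus[OF mod(1,3) sub(1,3) d x lin_on_mem[OF ab x]] a(2)[OF x] b(2)[OF lin_on_mem[OF a(1) x]]
      Q.submod_carrier[OF sub(3) lin_on_mem[OF d x]] by (simp add: a_minus_def Q.M.r_neg)
  then have "lin_on R M P M ?K (\<lambda>x. x \<ominus>\<^bsub>M\<^esub> \<beta> (\<alpha> x))"
    using lin_on_mem[OF t] by (intro lin_on_subset[OF t subset_refl]) blast
  moreover have "\<forall>z\<in>?K. \<alpha> z \<in> ?K'" "\<forall>z\<in>?K'. \<beta> z \<in> ?K"
    using a(2) lin_on_mem[OF a(1)] b(2) lin_on_mem[OF b(1)] by auto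
  moreover have "\<forall>z\<in>?K. z = \<beta> (\<alpha> z) \<oplus>\<^bsub>M\<^esub> (z \<ominus>\<^bsub>M\<^esub> \<beta> (\<alpha> z))"
    using M.add_minus_cancel Pc lin_on_mem[OF ab] by simp
  ultimately show ?thesis unfolding stable_retract_def using a(1) b(1) by blast
qed

section \<open>Lifting from free modules of finite rank and from projective modules\<close>

lemma (in ring) lifts_fr:
  assumes "left_module R N" "left_module R Q" "submodule Y R N" "submodule W R Q"
    "lin_on R N Y Q W d" "\<And>w. w \<in> W \<Longrightarrow> \<exists>y\<in>Y. d y = w"
  shows "lifts R (seqs R) (fr R k) N Y Q W d"
  unfolding lifts_def
proof (intro allI impI)
  interpret N: left_module R N by fact
  interpret Q: left_module R Q by fact
  fix q assume q: "lin_on R (seqs R) (fr R k) Q W q"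
  have Wc: "w \<in> W \<Longrightarrow> w \<in> carrier Q" for w using Q.submod_carrier[OF assms(4)] .
  have "\<exists>v\<in>Y. \<exists>l\<in>{\<zero>\<^bsub>Q\<^esub>}. q c = d v \<oplus>\<^bsub>Q\<^esub> l" if c: "c \<in> fr R k" for c
  proof -
    have "q c \<in> W" using lin_on_mem[OF q c] .
    then obtain y where "y \<in> Y" "d y = q c" using assms(6) by blast
    then show ?thesis using Wc[OF \<open>q c \<in> W\<close>] by (intro bexI[of _ y] bexI[of _ "\<zero>\<^bsub>Q\<^esub>"]) simp_all
  qed
  then obtain p where p: "lin_on R (seqs R) (fr R k) N Y p"
      "\<And>c. c \<in> fr R k \<Longrightarrow> \<exists>l\<in>{\<zero>\<^bsub>Q\<^esub>}. q c = d (p c) \<oplus>\<^bsub>Q\<^esub> l"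
    using fr_lift_mod[OF assms(1-4) Q.submod_null assms(5) q] by blast
  have "d (p c) = q c" if c: "c \<in> fr R k" for c
    using p(2)[OF c] Wc[OF lin_on_mem[OF assms(5) lin_on_mem[OF p(1) c]]] by simp
  then show "\<exists>p. lin_on R (seqs R) (fr R k) N Y p \<and> (\<forall>x\<in>fr R k. d (p x) = q x)"
    using p(1) by blast
qed

text \<open>Transport of structure along a map \<open>f\<close> that is injective on
  \<open>X\<close>. It moves submodules of any type onto carriers of type \<open>'a set\<close>,
  over which \<open>projective_module\<close> quantifies.\<close>

definition copy_module :: "('m \<Rightarrow> 'n) \<Rightarrow> ('r, 'm) module \<Rightarrow> 'm set \<Rightarrow> ('r, 'n) module" where
  "copy_module f M X = \<lparr>carrier = f ` X, mult = undefined, one = undefined, zero = f \<zero>\<^bsub>M\<^esub>,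
     add = (\<lambda>x y. f (inv_into X f x \<oplus>\<^bsub>M\<^esub> inv_into X f y)),
     smult = (\<lambda>a x. f (a \<odot>\<^bsub>M\<^esub> inv_into X f x))\<rparr>"

lemma left_module_copy:
  assumes "left_module R M" "submodule X R M" "inj_on f X"
  shows "left_module R (copy_module f M X)"
proof -
  interpret M: left_module R M by fact
  have c: "x \<in> X \<Longrightarrow> x \<in> carrier M" for x using M.submod_carrier[OF assms(2)] .
  note [simp] = c M.submod_zero[OF assms(2)] M.submod_add[OF assms(2)] M.submod_smult[OF assms(2)]
    inv_into_f_f[OF assms(3)]
  show ?thesis
  proof (rule left_moduleI)
    show "ring R" by (rule M.R.ring_axioms)
    show "abelian_group (copy_module f M X)"
    proof (rule abelian_groupI)
      fix x assume "x \<in> carrier (copy_module f M X)"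
      then obtain y where "y \<in> X" "x = f y" by (auto simp: copy_module_def)
      then show "\<exists>y\<in>carrier (copy_module f M X). y \<oplus>\<^bsub>copy_module f M X\<^esub> x = \<zero>\<^bsub>copy_module f M X\<^esub>"
        by (intro bexI[of _ "f (\<ominus>\<^bsub>M\<^esub> y)"]) (simp_all add: copy_module_def M.submod_neg[OF assms(2)] M.M.l_neg)
    qed (auto simp: copy_module_def M.M.a_ac)
  qed (auto simp: copy_module_def M.smult_l_distr M.smult_r_distr M.smult_assoc M.smult_one)
qed

lemma lin_maps_lin_on: "f \<in> lin_maps R M N \<Longrightarrow> lin_on R M (carrier M) N (carrier N) f"
  by (auto simp: lin_maps_def lin_on_def)

lemma restrict_lin_maps:
  assumes "left_module R M" "lin_on R M (carrier M) N (carrier N) f"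
  shows "restrict f (carrier M) \<in> lin_maps R M N"
proof -
  interpret left_module R M by fact
  show ?thesis using assms(2) by (auto simp: lin_maps_def lin_on_def smult_closed)
qed

text \<open>Modules of any type can serve as test modules in \<^const>\<open>projective_module\<close>
  if their carriers embed into the type of sets.\<close>

lemma lifts_projective:
  fixes N :: "('a, 'n) module" and Q :: "('a, 'q) module" and P :: "('a, 'a set) module"
    and f :: "'n \<Rightarrow> 'a set" and g :: "'q \<Rightarrow> 'a set"
  assumes "projective_module R P" "left_module R N" "left_module R Q" "submodule Y R N" "submodule W R Q"
    "lin_on R N Y Q W d" "\<And>w. w \<in> W \<Longrightarrow> \<exists>y\<in>Y. d y = w" and f: "inj_on f Y" and g: "inj_on g W"
  shows "lifts R P (carrier P) N Y Q W d"
  unfolding lifts_def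
proof (intro allI impI)
  interpret N: left_module R N by fact
  interpret Q: left_module R Q by fact
  have P: "left_module R P" using assms(1) by (simp add: projective_module_def)
  fix q assume q: "lin_on R P (carrier P) Q W q"
  let ?N = "copy_module f N Y" and ?Q = "copy_module g Q W"
  note f_inv = inv_into_f_f[OF f] and g_inv = inv_into_f_f[OF g]
  have N: "left_module R ?N" and Q: "left_module R ?Q"
    using left_module_copy assms by blast+
  note [simp] = f_inv g_inv N.submod_add[OF assms(4)] N.submod_smult[OF assms(4)]
    Q.submod_add[OF assms(5)] Q.submod_smult[OF assms(5)] lin_on_mem[OF assms(6)] lin_on_mem[OF q]
  let ?d = "\<lambda>x. g (d (inv_into Y f x))"
  have d1: "lin_on R ?N (carrier ?N) ?Q (carrier ?Q) ?d"
    by (rule lin_onI) (auto simp: copy_module_def lin_on_add[OF assms(6)] lin_on_smult[OF assms(6)])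
  have q1: "lin_on R P (carrier P) ?Q (carrier ?Q) (\<lambda>x. g (q x))"
    by (rule lin_onI) (auto simp: copy_module_def lin_on_add[OF q] lin_on_smult[OF q])
  have "restrict ?d (carrier ?N) ` carrier ?N = carrier ?Q"
  proof -
    have "d ` Y = W" using assms(7) lin_on_mem[OF assms(6)] by blast
    then have "g ` d ` Y = g ` W" by simp
    then show ?thesis by (simp add: copy_module_def image_image)
  qed
  then obtain h where h: "h \<in> lin_maps R P ?N"
    "\<And>x. x \<in> carrier P \<Longrightarrow> restrict ?d (carrier ?N) (h x) = restrict (\<lambda>x. g (q x)) (carrier P) x"
    using assms(1) N Q restrict_lin_maps[OF N d1] restrict_lin_maps[OF P q1]
    unfolding projective_module_def by meson
  have lh: "lin_on R P (carrier P) ?N (carrier ?N) h" using h(1) by (rule lin_maps_lin_on)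
  have hx: "\<exists>y\<in>Y. h x = f y" if "x \<in> carrier P" for x
    using lin_on_mem[OF lh that] by (auto simp: copy_module_def)
  have "lin_on R P (carrier P) N Y (\<lambda>x. inv_into Y f (h x))"
  proof (rule lin_onI)
    fix x assume x: "x \<in> carrier P"
    show "inv_into Y f (h x) \<in> Y" using hx[OF x] by auto
    { fix y assume y: "y \<in> carrier P"
      show "inv_into Y f (h (x \<oplus>\<^bsub>P\<^esub> y)) = inv_into Y f (h x) \<oplus>\<^bsub>N\<^esub> inv_into Y f (h y)"
        using hx[OF x] hx[OF y] lin_on_add[OF lh x y] by (auto simp: copy_module_def) }
    fix a assume "a \<in> carrier R"
    then show "inv_into Y f (h (a \<odot>\<^bsub>P\<^esub> x)) = a \<odot>\<^bsub>N\<^esub> inv_into Y f (h x)"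
      using hx[OF x] lin_on_smult[OF lh _ x] by (auto simp: copy_module_def)
  qed
  moreover have "d (inv_into Y f (h x)) = q x" if x: "x \<in> carrier P" for x
  proof -
    obtain y where y: "y \<in> Y" "h x = f y" using hx[OF x] by blast
    then have "g (d y) = g (q x)" using h(2)[OF x] x by (simp add: copy_module_def)
    then show ?thesis using y x g by (simp add: inj_on_eq_iff)
  qed
  ultimately show "\<exists>p. lin_on R P (carrier P) N Y p \<and> (\<forall>x\<in>carrier P. d (p x) = q x)" by blast
qed

text \<open>A sequence is coded by its graph: \<open>e\<close> codes the index, and \<open>g\<close>
  codes pairs, which is possible since the square of an infinite set is no larger than the set. So
  \<open>seqs R\<close> and its submodules have copies among the test modules.\<close>

lemma ex_inj_sequences:
  assumes "infinite (UNIV :: 'a set)"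
  shows "\<exists>f :: (nat \<Rightarrow> 'a) \<Rightarrow> 'a set. inj f"
proof -
  obtain e :: "nat \<Rightarrow> 'a" where e: "inj e" using assms infinite_countable_subset by blast
  obtain g :: "'a \<times> 'a \<Rightarrow> 'a" where g: "inj g"
  proof -
    have "(card_of (UNIV \<times> UNIV :: ('a \<times> 'a) set), card_of (UNIV :: 'a set)) \<in> ordLeq"
      using card_of_Times_same_infinite[OF assms] ordIso_iff_ordLeq by blast
    then show thesis using that by (metis UNIV_Times_UNIV card_of_ordLeq)
  qed
  have "inj (\<lambda>v :: nat \<Rightarrow> 'a. range (\<lambda>i. g (e i, v i)))"
  proof (rule injI, rule ext)
    fix v v' :: "nat \<Rightarrow> 'a" and i
    assume "range (\<lambda>i. g (e i, v i)) = range (\<lambda>i. g (e i, v' i))"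
    then obtain j where "g (e i, v i) = g (e j, v' j)" by (metis (no_types, lifting) UNIV_I imageE image_eqI)
    then show "v i = v' i" using injD[OF g] injD[OF e] by blast
  qed
  then show ?thesis by blast
qed

section \<open>Finite covers over a noetherian ring\<close>

lemma regular_module_simps [simp]:
  "carrier (regular_module R) = carrier R" "add (regular_module R) = add R"
  "zero (regular_module R) = zero R" "smult (regular_module R) = mult R"
  "mult (regular_module R) = mult R" "one (regular_module R) = one R"
  by (simp_all add: regular_module_def ring.defs module.defs)

lemma (in ring) left_module_regular: "left_module R (regular_module R)"
proof (rule left_moduleI)
  show "abelian_group (regular_module R)"
    by (rule abelian_groupI) (auto simp: a_ac intro: l_neg bexI[of _ "\<ominus> _"])
qed (auto simp: l_distr r_distr m_assoc ring_axioms)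

lemma (in ring) lin_on_generators:
  assumes "left_module R N" "submodule X R N" "finite S" "S \<subseteq> X"
  shows "\<exists>k p. lin_on R (seqs R) (fr R k) N X p \<and> S \<subseteq> p ` fr R k"
  using assms(3,4)
proof (induction S)
  case empty
  interpret N: left_module R N by fact
  show ?case
    by (intro exI[of _ 0] exI[of _ "\<lambda>_. \<zero>\<^bsub>N\<^esub>"]) (auto simp: lin_on_def N.submod_zero[OF assms(2)] N.smult_r_null)
next
  case (insert x S)
  interpret N: left_module R N by fact
  obtain k p where p: "lin_on R (seqs R) (fr R k) N X p" "S \<subseteq> p ` fr R k" using insert by auto
  have x: "x \<in> X" using insert by simp
  let ?p = "\<lambda>c. p (c(k := \<zero>)) \<oplus>\<^bsub>N\<^esub> c k \<odot>\<^bsub>N\<^esub> x"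
  have Xc: "y \<in> X \<Longrightarrow> y \<in> carrier N" for y using N.submod_carrier[OF assms(2)] .
  have p0: "p (\<lambda>_. \<zero>) = \<zero>\<^bsub>N\<^esub>" using lin_on_zero[OF left_module_seqs assms(1) submod_fr assms(2) p(1)] by simp
  have "?p c = p c" if c: "c \<in> fr R k" for c
  proof -
    have "c(k := \<zero>) = c" "c k = \<zero>" using c by (auto simp: fr_def fun_eq_iff)
    then show ?thesis using Xc[OF lin_on_mem[OF p(1) c]] Xc[OF x] by (simp add: N.smult_l_null)
  qed
  then have "p ` fr R k \<subseteq> ?p ` fr R (Suc k)"
    using fr_mono[of k "Suc k"] by force
  moreover have "x = ?p (\<lambda>i. if i = k then \<one> else \<zero>)"
  proof -
    have "(\<lambda>i. if i = k then \<one> else \<zero>)(k := \<zero>) = (\<lambda>_. \<zero>)" by auto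
    then show ?thesis using Xc[OF x] p0 by (simp add: N.smult_one)
  qed
  moreover have "(\<lambda>i. if i = k then \<one> else \<zero>) \<in> fr R (Suc k)" by (auto simp: fr_def)
  ultimately have "insert x S \<subseteq> ?p ` fr R (Suc k)" using p(2) by blast
  then show ?case using extend_lin[OF assms(1,2) p(1) x] by blast
qed

text \<open>Induction on \<open>k\<close>. The last coordinates of \<open>K\<close> form a left
  ideal, which is finitely generated. Subtracting a suitable combination of lifts of its generators
  makes the last coordinate zero, and the induction hypothesis covers what remains.\<close>

lemma (in ring) noetherian_covers:
  assumes "left_noetherian R"
  shows "subm K \<Longrightarrow> K \<subseteq> fr R k \<Longrightarrow> \<exists>r p. covers R r p K {\<lambda>_. \<zero>}"
proof (induction k arbitrary: K)
  case 0
  then have "K = {\<lambda>_. \<zero>}" using V.submod_zero[OF 0(1)] by (auto simp: fr_0)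
  then show ?case
    by (intro exI[of _ 0] exI[of _ "\<lambda>_. \<lambda>_. \<zero>"]) (auto simp: covers_def lin_on_def fr_0 fun_eq_iff)
next
  case (Suc k)
  note reg = left_module_regular
  interpret N: left_module R "regular_module R" by (rule reg)
  let ?\<phi> = "\<lambda>v :: nat \<Rightarrow> 'a. v k"
  have Kc: "v \<in> K \<Longrightarrow> v \<in> carrier (seqs R)" for v using V.submod_carrier[OF Suc(2)] .
  have l0: "lin_on R (seqs R) K (regular_module R) (carrier (regular_module R)) ?\<phi>"
    using Kc by (intro lin_onI) auto
  have X: "submodule (?\<phi> ` K) R (regular_module R)"
    by (rule submod_image[OF left_module_seqs reg Suc(2) N.submod_carrier_self l0])
  have l: "lin_on R (seqs R) K (regular_module R) (?\<phi> ` K) ?\<phi>"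
    by (rule lin_on_subset[OF l0]) auto
  obtain S where S: "finite S" "S \<subseteq> ?\<phi> ` K"
    "?\<phi> ` K = \<Inter>{J. submodule J R (regular_module R) \<and> S \<subseteq> J}"
    using assms[unfolded left_noetherian_def, rule_format, OF X] by blast
  obtain r q where q: "lin_on R (seqs R) (fr R r) (regular_module R) (?\<phi> ` K) q" "S \<subseteq> q ` fr R r"
    using lin_on_generators[OF reg X S(1,2)] by blast
  have "submodule (q ` fr R r) R (regular_module R)"
    by (rule submod_image[OF left_module_seqs reg submod_fr X q(1)])
  then have qX: "?\<phi> ` K \<subseteq> q ` fr R r" using S(3) q(2) by blast
  have "lifts R (seqs R) (fr R r) (seqs R) K (regular_module R) (?\<phi> ` K) ?\<phi>"
    by (rule lifts_fr[OF left_module_seqs reg Suc(2) X l]) auto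
  then obtain p where p: "lin (fr R r) K p" "\<And>c. c \<in> fr R r \<Longrightarrow> p c k = q c"
    using q(1) unfolding lifts_def by blast
  have K0: "subm (K \<inter> fr R k)" by (rule V.submod_Int[OF Suc(2) submod_fr])
  have "covers R r p K (K \<inter> fr R k)"
    unfolding covers_def
  proof (intro conjI ballI p(1))
    fix v assume v: "v \<in> K"
    then have "v k \<in> q ` fr R r" using qX by blast
    then obtain c where c: "c \<in> fr R r" "v k = p c k" using p(2) by force
    have pc: "p c \<in> K" using lin_on_mem[OF p(1) c(1)] .
    have s: "vsub v (p c) \<in> K" using V.submod_minus[OF Suc(2) v pc] .
    have "vsub v (p c) k = \<zero>" unfolding seqs_minus[OF Kc[OF v] Kc[OF pc]] using Kc[OF pc] by (simp add: c(2) a_minus_def r_neg)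
    then have "vsub v (p c) \<in> fr R k" 
      using subsetD[OF Suc(3) s] by (auto simp: fr_def) (metis le_antisym not_less_eq_eq)
    then show "\<exists>c\<in>fr R r. \<exists>l\<in>K \<inter> fr R k. v = vadd (p c) l"
      using s c V.add_minus_cancel[OF Kc[OF v] Kc[OF pc]] by (metis IntI)
  qed
  moreover obtain r0 p0 where "covers R r0 p0 (K \<inter> fr R k) {\<lambda>_. \<zero>}" using Suc(1)[OF K0] by blast
  moreover have "subm {\<lambda>_. \<zero>}" using V.submod_null by simp
  moreover have "{\<lambda>_. \<zero>} \<subseteq> K \<inter> fr R k" using V.submod_zero[OF K0] by simp
  ultimately show ?case
    using covers_combine[OF K0 Suc(2)] by blast
qed

text \<open>
  A module of finite projective dimension has a finite resolution by finitely generated projectives.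
  The last syzygy \<open>K\<close> is a retract of some \<open>R\<^sup>s\<close>, hence has a free resolution of constant rank
  \<open>s\<close> given by an idempotent; so the ranks are bounded, although the resolution is infinite.
\<close>

lemma (in ring) noetherian_resolvable:
  fixes P :: "nat \<Rightarrow> ('a, 'a set) module" and X :: "('a, 'a set) module"
  assumes noeth: "left_noetherian R" and inf: "infinite (UNIV :: 'a set)"
    and X: "left_module R X" and res: "projective_resolution R X P d \<epsilon>" and "\<And>n. n > l \<Longrightarrow> zero_module (P n)"
    and \<pi>: "lin_on R (seqs R) (fr R k) X (carrier X) \<pi>" "\<And>x. x \<in> carrier X \<Longrightarrow> \<exists>c\<in>fr R k. \<pi> c = x"
  shows "\<exists>f b. (\<forall>i. f i \<le> b) \<and> (\<forall>n. resolvable R {\<zero>} n f {c \<in> fr R k. \<pi> c = \<zero>\<^bsub>X\<^esub>} {\<lambda>_. \<zero>})"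
proof -
  interpret X: left_module R X by fact
  obtain \<iota> :: "(nat \<Rightarrow> 'a) \<Rightarrow> 'a set" where \<iota>: "inj \<iota>" using ex_inj_sequences[OF inf] by blast
  have proj: "projective_module R (P n)" for n using res by (simp add: projective_resolution_def)
  then have Pm: "left_module R (P n)" for n by (simp add: projective_module_def)
  have Pc: "submodule (carrier (P n)) R (P n)" for n by (rule left_module.submod_carrier_self[OF Pm])
  have Xc: "submodule (carrier X) R X" by (rule X.submod_carrier_self)
  have \<epsilon>: "lin_on R (P 0) (carrier (P 0)) X (carrier X) \<epsilon>" "\<epsilon> ` carrier (P 0) = carrier X"
    using res lin_maps_lin_on by (auto simp: projective_resolution_def)
  have d: "lin_on R (P (Suc n)) (carrier (P (Suc n))) (P n) (carrier (P n)) (d n)" for n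
    using res by (intro lin_maps_lin_on) (simp add: projective_resolution_def)
  define Z where "Z n = (case n of 0 \<Rightarrow> {x \<in> carrier (P 0). \<epsilon> x = \<zero>\<^bsub>X\<^esub>}
      | Suc n \<Rightarrow> {x \<in> carrier (P (Suc n)). d n x = \<zero>\<^bsub>P n\<^esub>})" for n
  have im: "d n ` carrier (P (Suc n)) = Z n" for n
    using res by (cases n) (auto simp: projective_resolution_def exact_at_def Z_def)
  have d_onto: "\<exists>y\<in>carrier (P (Suc n)). d n y = w" if "w \<in> Z n" for n w
  proof -
    have "w \<in> d n ` carrier (P (Suc n))" using that by (simp only: im)
    then show ?thesis by (elim imageE) blast
  qed
  have \<epsilon>_onto: "\<exists>y\<in>carrier (P 0). \<epsilon> y = w" if "w \<in> carrier X" for w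
  proof -
    have "w \<in> \<epsilon> ` carrier (P 0)" using that by (simp only: \<epsilon>(2))
    then show ?thesis by (elim imageE) blast
  qed
  have dZ: "lin_on R (P (Suc n)) (carrier (P (Suc n))) (P n) (Z n) (d n)" for n
    using im by (intro lin_on_subset[OF d]) auto
  have Zsub: "Z n \<subseteq> carrier (P n)" for n by (cases n) (auto simp: Z_def)
  have Zm: "submodule (Z n) R (P n)" for n
    unfolding im[symmetric] by (rule submod_image[OF Pm Pm Pc Pc d])
  \<comment> \<open>\<open>t\<close> counts the syzygies still to be taken before index
    \<open>Suc l\<close>, where \<open>P\<close> vanishes. \<open>K\<close> stays a stable retract
    of \<open>Z j\<close>, and each step covers it by a free module of finite rank.\<close>
  have step: "\<exists>f b. (\<forall>i. f i \<le> b) \<and> (\<forall>n. resolvable R {\<zero>} n f K {\<lambda>_. \<zero>})"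
    if "j + t = Suc l" "subm K" "K \<subseteq> fr R s" "stable_retract R (seqs R) (fr R s) K (P j) (carrier (P j)) (Z j)"
    for j t s K using that
  proof (induction t arbitrary: j s K)
    case 0
    obtain \<alpha> \<beta> \<theta> where a: "lin_on R (seqs R) (fr R s) (P j) (carrier (P j)) \<alpha>"
      and b: "lin_on R (P j) (carrier (P j)) (seqs R) (fr R s) \<beta>"
      and t: "lin (fr R s) K \<theta>" "\<And>z. z \<in> K \<Longrightarrow> z = vadd (\<beta> (\<alpha> z)) (\<theta> z)"
      using 0(4) unfolding stable_retract_def by blast
    \<comment> \<open>\<open>\<beta>\<close> after \<open>\<alpha>\<close> factors through
      \<open>P j\<close>, which is zero. So \<open>\<theta>\<close> is the identity on
      \<open>K\<close>, and \<open>K\<close> is a retract of R^s.\<close>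
    have "carrier (P j) = {\<zero>\<^bsub>P j\<^esub>}" using assms(5)[of j] 0(1) by (simp add: zero_module_def)
    then have a0: "\<alpha> z = \<zero>\<^bsub>P j\<^esub>" if "z \<in> K" for z
      using lin_on_mem[OF a subsetD[OF 0(3) that]] by simp
    have b0: "\<beta> \<zero>\<^bsub>P j\<^esub> = \<zero>\<^bsub>seqs R\<^esub>" by (rule lin_on_zero[OF Pm left_module_seqs Pc submod_fr b])
    have "\<theta> z = z" if z: "z \<in> K" for z
    proof -
      have "z = vadd \<zero>\<^bsub>seqs R\<^esub> (\<theta> z)" using t(2)[OF z] unfolding a0[OF z] b0 .
      also have "\<dots> = \<theta> z" by (rule V.M.l_zero[OF V.submod_carrier[OF 0(2) lin_on_mem[OF t(1) subsetD[OF 0(3) z]]]])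
      finally show ?thesis by (rule sym)
    qed
    then have "\<forall>n. resolvable R {\<zero>} n (\<lambda>_. s) K {\<lambda>_. \<zero>}"
      using resolvable_retract[OF 0(2,3) t(1)] by blast
    then show ?case by (intro exI[of _ "\<lambda>_. s"] exI[of _ s]) simp
  next
    case (Suc t)
    obtain r p where p: "covers R r p K {\<lambda>_. \<zero>}" using noetherian_covers[OF noeth Suc(3,4)] by blast
    have lp: "lin (fr R r) K p" using p by (simp add: covers_def)
    have onto: "\<exists>y\<in>fr R r. p y = w" if w: "w \<in> K" for w
    proof -
      obtain c l where c: "c \<in> fr R r" "l \<in> {\<lambda>_. \<zero>}" "w = vadd (p c) l"
        using p w unfolding covers_def by blast
      then have "w = vadd (p c) \<zero>\<^bsub>seqs R\<^esub>" by simp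
      with c(1) show ?thesis using V.M.r_zero[OF V.submod_carrier[OF Suc(3) lin_on_mem[OF lp c(1)]]] by auto
    qed
    let ?K = "{x \<in> fr R r. p x = \<zero>\<^bsub>seqs R\<^esub>}"
    have "stable_retract R (seqs R) (fr R r) ?K (P (Suc j)) (carrier (P (Suc j)))
        {x \<in> carrier (P (Suc j)). d j x = \<zero>\<^bsub>P j\<^esub>}"
    proof (rule stable_retract_syzygy[OF left_module_seqs Pm left_module_seqs Pm submod_fr Suc(3) Pc Zm submod_fr Pc
          Suc(4) Zsub lp dZ _ _ _ Suc(5)])
      show "lifts R (seqs R) (fr R r) (P (Suc j)) (carrier (P (Suc j))) (P j) (Z j) (d j)"
        by (rule lifts_fr[OF Pm Pm Pc Zm dZ d_onto])
      show "lifts R (P (Suc j)) (carrier (P (Suc j))) (seqs R) (fr R r) (seqs R) K p"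
        by (rule lifts_projective[OF proj left_module_seqs left_module_seqs submod_fr Suc(3) lp onto
            inj_on_subset[OF \<iota>] inj_on_subset[OF \<iota>]]) auto
      show "lifts R (seqs R) (fr R s) (seqs R) (fr R r) (seqs R) K p"
        by (rule lifts_fr[OF left_module_seqs left_module_seqs submod_fr Suc(3) lp onto])
    qed
    then have "stable_retract R (seqs R) (fr R r) ?K (P (Suc j)) (carrier (P (Suc j))) (Z (Suc j))"
      by (simp add: Z_def)
    moreover have "subm ?K" using subm_vimage[OF submod_fr Suc(3) V.submod_null lp] by simp
    ultimately obtain f b where f: "\<And>i. f i \<le> b" "\<And>n. resolvable R {\<zero>} n f ?K {\<lambda>_. \<zero>}"
      using Suc(1)[of "Suc j" ?K r] Suc(2) by auto
    have "resolvable R {\<zero>} n (case_nat r f) K {\<lambda>_. \<zero>}" for n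
      using p f(2) by (cases n) (auto simp: fI_zero)
    moreover have "case_nat r f i \<le> max r b" for i using f(1) by (cases i) (auto intro: max.coboundedI2)
    ultimately show ?case by blast
  qed
  \<comment> \<open>The comparison starts with the two covers \<open>\<pi>\<close> and
    \<open>\<epsilon>\<close> of \<open>X\<close>. As \<open>X\<close> is already a module on
    \<open>'a set\<close>, its embedding \<open>g\<close> is the identity.\<close>
  have "stable_retract R (seqs R) (fr R k) {c \<in> fr R k. \<pi> c = \<zero>\<^bsub>X\<^esub>} (P 0) (carrier (P 0)) {x \<in> carrier (P 0). \<epsilon> x = \<zero>\<^bsub>X\<^esub>}"
  proof (rule stable_retract_kernels[OF left_module_seqs Pm X submod_fr Pc Xc \<pi>(1) \<epsilon>(1)])
    show "lifts R (seqs R) (fr R k) (P 0) (carrier (P 0)) X (carrier X) \<epsilon>"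
      by (rule lifts_fr[OF Pm X Pc Xc \<epsilon>(1) \<epsilon>_onto])
    show "lifts R (P 0) (carrier (P 0)) (seqs R) (fr R k) X (carrier X) \<pi>"
      by (rule lifts_projective[OF proj left_module_seqs X submod_fr Xc \<pi> inj_on_subset[OF \<iota>], where g = "\<lambda>x. x"]) auto
  qed
  moreover have "subm {c \<in> fr R k. \<pi> c = \<zero>\<^bsub>X\<^esub>}"
    using submod_vimage[OF left_module_seqs X submod_fr Xc X.submod_null \<pi>(1)] by simp
  ultimately show ?thesis
    using step[of 0 "Suc l" "{c \<in> fr R k. \<pi> c = \<zero>\<^bsub>X\<^esub>}" k] by (auto simp: Z_def)
qed

lemma gl_dim_resolution:
  fixes X :: "('a, 'a set) module"
  assumes "gl_dim R < \<infinity>" "left_module R X"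
  shows "\<exists>P d \<epsilon> l. projective_resolution R X P d \<epsilon> \<and> (\<forall>n>l. zero_module (P n))"
proof -
  have "proj_dim R X \<le> gl_dim R" unfolding gl_dim_def using assms(2) by (intro SUP_upper) auto
  then have "proj_dim R X < \<infinity>" using assms(1) by (rule le_less_trans)
  \<comment> \<open>The infimum of the empty set in \<open>enat\<close> is \<infinity>, so
    finiteness provides an actual resolution.\<close>
  then have "{enat l | l. \<exists>P d \<epsilon>. projective_resolution R X P d \<epsilon> \<and> (\<forall>n>l. zero_module (P n))} \<noteq> {}"
    unfolding proj_dim_def by (metis (no_types, lifting) Inf_enat_def less_irrefl)
  then show ?thesis by blast
qed

section \<open>Graded algebras\<close>

context left_module begin

lemma submod_additive: "submodule N R M \<Longrightarrow> additive_subgroup N M"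
  by (simp add: submodule_def additive_subgroup_def)

lemma coset_eq_iff:
  assumes "submodule N R M" "x \<in> carrier M" "y \<in> carrier M"
  shows "N +>\<^bsub>M\<^esub> x = N +>\<^bsub>M\<^esub> y \<longleftrightarrow> x \<ominus>\<^bsub>M\<^esub> y \<in> N"
proof
  assume "N +>\<^bsub>M\<^esub> x = N +>\<^bsub>M\<^esub> y"
  moreover have "x \<in> N +>\<^bsub>M\<^esub> x"
    using submod_zero[OF assms(1)] assms(2) by (force simp: a_r_coset_def')
  ultimately obtain n where "n \<in> N" "x = n \<oplus>\<^bsub>M\<^esub> y" by (auto simp: a_r_coset_def')
  then show "x \<ominus>\<^bsub>M\<^esub> y \<in> N"
    using assms submod_carrier[OF assms(1)] minus_add_cancel[of n y] by (simp add: M.a_comm)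
next
  assume d: "x \<ominus>\<^bsub>M\<^esub> y \<in> N"
  have *: "N +>\<^bsub>M\<^esub> u \<subseteq> N +>\<^bsub>M\<^esub> v" if "u \<ominus>\<^bsub>M\<^esub> v \<in> N" "u \<in> carrier M" "v \<in> carrier M" for u v
  proof
    fix z assume "z \<in> N +>\<^bsub>M\<^esub> u"
    then obtain n where n: "n \<in> N" "z = n \<oplus>\<^bsub>M\<^esub> u" by (auto simp: a_r_coset_def')
    have "z = (n \<oplus>\<^bsub>M\<^esub> (u \<ominus>\<^bsub>M\<^esub> v)) \<oplus>\<^bsub>M\<^esub> v"
      using n that submod_carrier[OF assms(1)] by (simp add: a_minus_def M.a_assoc M.l_neg)
    then show "z \<in> N +>\<^bsub>M\<^esub> v" using submod_add[OF assms(1) n(1) that(1)] by (auto simp: a_r_coset_def')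
  qed
  have "y \<ominus>\<^bsub>M\<^esub> x = \<ominus>\<^bsub>M\<^esub> (x \<ominus>\<^bsub>M\<^esub> y)" using assms by (simp add: a_minus_def M.minus_add M.a_comm)
  then have "y \<ominus>\<^bsub>M\<^esub> x \<in> N" using d submod_neg[OF assms(1)] by simp
  then show "N +>\<^bsub>M\<^esub> x = N +>\<^bsub>M\<^esub> y" using * d assms by blast
qed

lemma coset_eq_zero_iff:
  assumes "submodule N R M" "x \<in> carrier M"
  shows "N +>\<^bsub>M\<^esub> x = N \<longleftrightarrow> x \<in> N"
proof -
  have "N +>\<^bsub>M\<^esub> \<zero>\<^bsub>M\<^esub> = N" using submod_subset[OF assms(1)] by (rule M.a_coset_add_zero)
  then show ?thesis using coset_eq_iff[OF assms, of "\<zero>\<^bsub>M\<^esub>"] assms(2)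
      minus_add_cancel[of x "\<zero>\<^bsub>M\<^esub>"] by simp
qed

end

lemma quot_module_simps [simp]:
  "carrier (quot_module M N) = (\<lambda>x. N +>\<^bsub>M\<^esub> x) ` carrier M"
  "zero (quot_module M N) = N"
  by (auto simp: quot_module_def ring.defs module.defs FactRing_def A_RCOSETS_def')

lemma
  fixes M :: "('r, 'm) module"
  assumes "left_module R M" and N: "submodule N R M" and x: "x \<in> carrier M"
  shows quot_add: "y \<in> carrier M \<Longrightarrow> (N +>\<^bsub>M\<^esub> x) \<oplus>\<^bsub>quot_module M N\<^esub> (N +>\<^bsub>M\<^esub> y) = N +>\<^bsub>M\<^esub> (x \<oplus>\<^bsub>M\<^esub> y)"
    and quot_smult: "a \<in> carrier R \<Longrightarrow> a \<odot>\<^bsub>quot_module M N\<^esub> (N +>\<^bsub>M\<^esub> x) = N +>\<^bsub>M\<^esub> (a \<odot>\<^bsub>M\<^esub> x)"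
proof -
  interpret left_module R M by fact
  interpret abelian_subgroup N M
    using submod_additive[OF N] M.abelian_group_axioms by (rule abelian_subgroupI3)
  show "y \<in> carrier M \<Longrightarrow> (N +>\<^bsub>M\<^esub> x) \<oplus>\<^bsub>quot_module M N\<^esub> (N +>\<^bsub>M\<^esub> y) = N +>\<^bsub>M\<^esub> (x \<oplus>\<^bsub>M\<^esub> y)"
    using a_rcos_sum x by (simp add: quot_module_def ring.defs module.defs FactRing_def)
  assume a: "a \<in> carrier R"
  \<comment> \<open>\<open>quot_module\<close> scales a coset by a union over all its elements; each
    of them gives the same coset.\<close>
  have "N +>\<^bsub>M\<^esub> (a \<odot>\<^bsub>M\<^esub> z) = N +>\<^bsub>M\<^esub> (a \<odot>\<^bsub>M\<^esub> x)" if z: "z \<in> N +>\<^bsub>M\<^esub> x" for z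
  proof -
    obtain n where n: "n \<in> N" "z = n \<oplus>\<^bsub>M\<^esub> x"
      using z unfolding a_r_coset_def' by blast
    have nc: "n \<in> carrier M" using n submod_carrier[OF N] by blast
    have "a \<odot>\<^bsub>M\<^esub> z \<ominus>\<^bsub>M\<^esub> a \<odot>\<^bsub>M\<^esub> x = a \<odot>\<^bsub>M\<^esub> n"
      using nc x a minus_add_cancel[of "a \<odot>\<^bsub>M\<^esub> n" "a \<odot>\<^bsub>M\<^esub> x"]
      by (simp add: n(2) smult_r_distr smult_closed M.a_comm)
    then show ?thesis
      using coset_eq_iff[OF N, of "a \<odot>\<^bsub>M\<^esub> z" "a \<odot>\<^bsub>M\<^esub> x"] nc x a n submod_smult[OF N a n(1)]
      by (simp add: smult_closed)
  qed
  moreover have "x \<in> N +>\<^bsub>M\<^esub> x"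
    using submod_zero[OF N] x by (force simp: a_r_coset_def')
  ultimately have "(\<Union>x\<in>N +>\<^bsub>M\<^esub> x. N +>\<^bsub>M\<^esub> (a \<odot>\<^bsub>M\<^esub> x)) = N +>\<^bsub>M\<^esub> (a \<odot>\<^bsub>M\<^esub> x)" by blast
  then show "a \<odot>\<^bsub>quot_module M N\<^esub> (N +>\<^bsub>M\<^esub> x) = N +>\<^bsub>M\<^esub> (a \<odot>\<^bsub>M\<^esub> x)"
    by (simp add: quot_module_def ring.defs module.defs)
qed

lemma left_module_quot:
  fixes M :: "('r, 'm) module"
  assumes "left_module R M" "submodule N R M"
  shows "left_module R (quot_module M N)"
proof -
  interpret left_module R M by fact
  note [simp] = quot_add[OF assms] quot_smult[OF assms] smult_closed
  have z: "N = N +>\<^bsub>M\<^esub> \<zero>\<^bsub>M\<^esub>" using M.a_coset_add_zero[OF submod_subset[OF assms(2)]] by simp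
  show ?thesis
  proof (rule left_moduleI)
    show "abelian_group (quot_module M N)"
    proof (rule abelian_groupI)
      show "\<zero>\<^bsub>quot_module M N\<^esub> \<in> carrier (quot_module M N)" using z by auto
      fix x assume "x \<in> carrier (quot_module M N)"
      then obtain u where u: "u \<in> carrier M" "x = N +>\<^bsub>M\<^esub> u" by auto
      then have "N \<oplus>\<^bsub>quot_module M N\<^esub> x = x" using quot_add[OF assms M.zero_closed u(1)] z by simp
      then show "\<zero>\<^bsub>quot_module M N\<^esub> \<oplus>\<^bsub>quot_module M N\<^esub> x = x" by simp
      have "(N +>\<^bsub>M\<^esub> (\<ominus>\<^bsub>M\<^esub> u)) \<oplus>\<^bsub>quot_module M N\<^esub> x = N" using u z by (simp add: M.l_neg)
      then show "\<exists>y\<in>carrier (quot_module M N). y \<oplus>\<^bsub>quot_module M N\<^esub> x = \<zero>\<^bsub>quot_module M N\<^esub>"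
        using u by auto
    qed (auto simp: M.a_ac)
  qed (auto simp: smult_l_distr smult_r_distr smult_assoc smult_one R.ring_axioms)
qed

lemma ring_ideal_submodule:
  assumes "ring R" "ideal I R"
  shows "submodule I R (regular_module R)"
proof -
  interpret ideal I R by fact
  interpret N: left_module R "regular_module R" by (rule left_module_regular)
  show ?thesis by (rule N.submodI) (auto simp: I_l_closed)
qed

section \<open>Homogeneous components\<close>

locale graded =
  fixes K :: "'k ring" and A :: "('k, 'a) module" (structure) and G :: "nat \<Rightarrow> 'a set"
  assumes graded: "graded_algebra K A G"
begin

sublocale ring A using graded by (simp add: graded_algebra_def assoc_algebra_def)
sublocale KA: Module.module K A using graded by (simp add: graded_algebra_def assoc_algebra_def)

lemma KA_left_module: "left_module K A"
  by (rule left_moduleI) (auto simp: KA.smult_l_distr KA.smult_r_distr KA.smult_assoc1 KA.R.ring_axioms is_abelian_group)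

sublocale KL: left_module K A by (rule KA_left_module)

lemma G_submod: "submodule (G i) K A" using graded by (simp add: graded_algebra_def)
lemma G_carrier: "x \<in> G i \<Longrightarrow> x \<in> carrier A" using KL.submod_carrier[OF G_submod] .
lemma G_zero [simp]: "\<zero> \<in> G i" using KL.submod_zero[OF G_submod] .
lemma G_add: "x \<in> G i \<Longrightarrow> y \<in> G i \<Longrightarrow> x \<oplus> y \<in> G i" using KL.submod_add[OF G_submod] .
lemma G_mult: "x \<in> G i \<Longrightarrow> y \<in> G j \<Longrightarrow> x \<otimes> y \<in> G (i + j)"
  using graded by (simp add: graded_algebra_def)
definition hc :: "'a \<Rightarrow> nat \<Rightarrow> 'a" where
  "hc x = (THE f. homogeneous_components A G x f)"

lemma hc_eq: "x \<in> carrier A \<Longrightarrow> homogeneous_components A G x f \<Longrightarrow> hc x = f"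
  unfolding hc_def using graded by (intro the1_equality) (simp_all add: graded_algebra_def)

lemma hc_components: "x \<in> carrier A \<Longrightarrow> homogeneous_components A G x (hc x)"
proof -
  assume "x \<in> carrier A"
  then have "\<exists>!f. homogeneous_components A G x f" using graded by (simp add: graded_algebra_def)
  then show ?thesis unfolding hc_def by (rule theI')
qed

text \<open>\<open>homogeneous_components\<close> sums over the exact support, which is not known
  for sums and products; here any finite set containing the support will do.\<close>

lemma hc_eqI:
  assumes "\<And>i. f i \<in> G i" "finite S" "\<And>i. i \<notin> S \<Longrightarrow> f i = \<zero>" "x = (\<Oplus>i\<in>S. f i)"
  shows "hc x = f"
proof (rule hc_eq)
  show "x \<in> carrier A" unfolding assms(4) using G_carrier[OF assms(1)] by (intro finsum_closed) blast
  have "{i. f i \<noteq> \<zero>} \<subseteq> S" using assms(3) by auto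
  moreover from this have "(\<Oplus>i\<in>{i. f i \<noteq> \<zero>}. f i) = (\<Oplus>i\<in>S. f i)"
    using G_carrier[OF assms(1)] assms(2) by (intro add.finprod_mono_neutral_cong_left) auto
  ultimately show "homogeneous_components A G x f"
    using assms finite_subset by (auto simp: homogeneous_components_def)
qed

lemma hc_G [simp]: "x \<in> carrier A \<Longrightarrow> hc x i \<in> G i"
  using hc_components by (simp add: homogeneous_components_def)

lemma hc_carrier [simp]: "x \<in> carrier A \<Longrightarrow> hc x i \<in> carrier A"
  using G_carrier[OF hc_G] .

lemma hc_sum:
  assumes "x \<in> carrier A"
  obtains S where "finite S" "\<And>i. i \<notin> S \<Longrightarrow> hc x i = \<zero>" "x = (\<Oplus>i\<in>S. hc x i)"
  using hc_components[OF assms] unfolding homogeneous_components_def by fastforce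

lemma finsum_superset:
  assumes "finite T" "S \<subseteq> T" "\<And>i. i \<notin> S \<Longrightarrow> f i = \<zero>" "\<And>i. f i \<in> carrier A"
  shows "(\<Oplus>i\<in>S. f i) = (\<Oplus>i\<in>T. f i)"
  using assms by (intro add.finprod_mono_neutral_cong_left) auto

lemma hc_add:
  assumes "x \<in> carrier A" "y \<in> carrier A"
  shows "hc (x \<oplus> y) i = hc x i \<oplus> hc y i"
proof -
  obtain S where S: "finite S" "\<And>i. i \<notin> S \<Longrightarrow> hc x i = \<zero>" "x = (\<Oplus>i\<in>S. hc x i)" using hc_sum[OF assms(1)] by blast
  obtain T where T: "finite T" "\<And>i. i \<notin> T \<Longrightarrow> hc y i = \<zero>" "y = (\<Oplus>i\<in>T. hc y i)" using hc_sum[OF assms(2)] by blast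
  note c = hc_carrier[OF assms(1)] hc_carrier[OF assms(2)]
  have x: "x = (\<Oplus>i\<in>S \<union> T. hc x i)" using S(3) finsum_superset[of "S \<union> T" S "hc x"] S T c by simp
  have y: "y = (\<Oplus>i\<in>S \<union> T. hc y i)" using T(3) finsum_superset[of "S \<union> T" T "hc y"] S T c by simp
  have "hc (x \<oplus> y) = (\<lambda>i. hc x i \<oplus> hc y i)"
  proof (rule hc_eqI[of _ "S \<union> T"])
    have "(\<Oplus>i\<in>S \<union> T. hc x i \<oplus> hc y i) = (\<Oplus>i\<in>S \<union> T. hc x i) \<oplus> (\<Oplus>i\<in>S \<union> T. hc y i)"
      using c by (intro finsum_addf) auto
    then show "x \<oplus> y = (\<Oplus>i\<in>S \<union> T. hc x i \<oplus> hc y i)" using x y by simp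
  qed (use S T assms G_add in auto)
  then show ?thesis by simp
qed

lemma hc_homogeneous: "x \<in> G j \<Longrightarrow> hc x = (\<lambda>i. if i = j then x else \<zero>)"
  by (rule hc_eqI[of _ "{j}"]) (auto simp: G_carrier)

lemma hc_zero [simp]: "hc \<zero> i = \<zero>"
  by (simp add: hc_homogeneous[of _ 0])

lemma hc_neg: "x \<in> carrier A \<Longrightarrow> hc (\<ominus> x) i = \<ominus> hc x i"
  using hc_add[of "\<ominus> x" x i] G_carrier[OF hc_G] by (intro minus_equality[symmetric]) (simp_all add: l_neg)

lemma hc_finsum:
  assumes "finite S" "\<And>s. s \<in> S \<Longrightarrow> f s \<in> carrier A"
  shows "hc (\<Oplus>s\<in>S. f s) i = (\<Oplus>s\<in>S. hc (f s) i)"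
  using assms
proof (induction S)
  case (insert s S)
  have "hc (\<Oplus>s\<in>insert s S. f s) i = hc (f s \<oplus> (\<Oplus>s\<in>S. f s)) i"
    using insert by (subst finsum_insert) auto
  also have "\<dots> = hc (f s) i \<oplus> hc (\<Oplus>s\<in>S. f s) i"
    using insert by (intro hc_add) (auto intro: finsum_closed)
  also have "\<dots> = (\<Oplus>s\<in>insert s S. hc (f s) i)"
    using insert by (subst finsum_insert) auto
  finally show ?case .
qed simp

lemma hc_mult_right:
  assumes x: "x \<in> carrier A" and b: "b \<in> G j"
  shows "hc (x \<otimes> b) i = (if j \<le> i then hc x (i - j) \<otimes> b else \<zero>)"
proof -
  obtain S where S: "finite S" "\<And>i. i \<notin> S \<Longrightarrow> hc x i = \<zero>" "x = (\<Oplus>i\<in>S. hc x i)" using hc_sum[OF x] by blast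
  note [simp] = hc_carrier[OF x] G_carrier[OF b]
  have "x \<otimes> b = (\<Oplus>k\<in>S. hc x k \<otimes> b)" by (subst S(3), subst finsum_ldistr) (auto simp: S(1))
  then have "hc (x \<otimes> b) i = (\<Oplus>k\<in>S. hc (hc x k \<otimes> b) i)"
    using S(1) hc_finsum[of S "\<lambda>k. hc x k \<otimes> b" i] by simp
  also have "\<dots> = (\<Oplus>k\<in>S. if i = k + j then hc x k \<otimes> b else \<zero>)"
    using hc_homogeneous[OF G_mult[OF hc_G[OF x] b]] by simp
  also have "\<dots> = (if j \<le> i then hc x (i - j) \<otimes> b else \<zero>)"
  proof (cases "j \<le> i \<and> i - j \<in> S")
    case True
    then have "(\<Oplus>k\<in>S. if i = k + j then hc x k \<otimes> b else \<zero>) =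
        (\<Oplus>k\<in>S. if i - j = k then hc x k \<otimes> b else \<zero>)"
      by (intro finsum_cong') auto
    then show ?thesis using True S(1) finsum_singleton[of "i - j" S "\<lambda>k. hc x k \<otimes> b"] by auto
  next
    case False
    have "(\<Oplus>k\<in>S. if i = k + j then hc x k \<otimes> b else \<zero>) = (\<Oplus>k\<in>S. \<zero>)"
      using False by (intro finsum_cong') auto
    then show ?thesis using False S(2)[of "i - j"] by auto
  qed
  finally show ?thesis .
qed

lemma hc_mult_left:
  assumes x: "x \<in> carrier A" and b: "b \<in> G j"
  shows "hc (b \<otimes> x) i = (if j \<le> i then b \<otimes> hc x (i - j) else \<zero>)"
proof -
  obtain S where S: "finite S" "\<And>i. i \<notin> S \<Longrightarrow> hc x i = \<zero>" "x = (\<Oplus>i\<in>S. hc x i)" using hc_sum[OF x] by blast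
  note [simp] = hc_carrier[OF x] G_carrier[OF b]
  have "b \<otimes> x = (\<Oplus>k\<in>S. b \<otimes> hc x k)" by (subst S(3), subst finsum_rdistr) (auto simp: S(1))
  then have "hc (b \<otimes> x) i = (\<Oplus>k\<in>S. hc (b \<otimes> hc x k) i)"
    using S(1) hc_finsum[of S "\<lambda>k. b \<otimes> hc x k" i] by simp
  also have "\<dots> = (\<Oplus>k\<in>S. if i = j + k then b \<otimes> hc x k else \<zero>)"
    using hc_homogeneous[OF G_mult[OF b hc_G[OF x]]] by simp
  also have "\<dots> = (if j \<le> i then b \<otimes> hc x (i - j) else \<zero>)"
  proof (cases "j \<le> i \<and> i - j \<in> S")
    case True
    then have "(\<Oplus>k\<in>S. if i = j + k then b \<otimes> hc x k else \<zero>) =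
        (\<Oplus>k\<in>S. if i - j = k then b \<otimes> hc x k else \<zero>)"
      by (intro finsum_cong') auto
    then show ?thesis using True S(1) finsum_singleton[of "i - j" S "\<lambda>k. b \<otimes> hc x k"] by auto
  next
    case False
    have "(\<Oplus>k\<in>S. if i = j + k then b \<otimes> hc x k else \<zero>) = (\<Oplus>k\<in>S. \<zero>)"
      using False by (intro finsum_cong') auto
    then show ?thesis using False S(2)[of "i - j"] by auto
  qed
  finally show ?thesis .
qed

lemma aug_ideal_iff: "x \<in> aug_ideal A G \<longleftrightarrow> x \<in> carrier A \<and> hc x 0 = \<zero>"
  using hc_eq hc_components by (auto simp: aug_ideal_def)

text \<open>Degrees are nonnegative, so only the components of degree 0 of the two factors meet in
  degree 0. This makes the augmentation ideal two-sided.\<close>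

lemma hc_0_mult:
  assumes "x \<in> carrier A" "y \<in> carrier A"
  shows "hc (x \<otimes> y) 0 = hc x 0 \<otimes> hc y 0"
proof -
  obtain S where S: "finite S" "\<And>i. i \<notin> S \<Longrightarrow> hc y i = \<zero>" "y = (\<Oplus>i\<in>S. hc y i)" using hc_sum[OF assms(2)] by blast
  note [simp] = hc_carrier[OF assms(1)] hc_carrier[OF assms(2)] assms
  have "x \<otimes> y = (\<Oplus>k\<in>S. x \<otimes> hc y k)" by (subst S(3), subst finsum_rdistr) (auto simp: S(1))
  then have "hc (x \<otimes> y) 0 = (\<Oplus>k\<in>S. hc (x \<otimes> hc y k) 0)"
    using S(1) hc_finsum[of S "\<lambda>k. x \<otimes> hc y k" 0] by simp
  also have "\<dots> = (\<Oplus>k\<in>S. if 0 = k then hc x 0 \<otimes> hc y k else \<zero>)"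
    using hc_mult_right[OF assms(1) hc_G[OF assms(2)], of _ 0] by (intro finsum_cong') auto
  also have "\<dots> = hc x 0 \<otimes> hc y 0"
  proof (cases "0 \<in> S")
    case True
    then show ?thesis using S(1) finsum_singleton[of 0 S "\<lambda>k. hc x 0 \<otimes> hc y k"] by auto
  next
    case False
    have "(\<Oplus>k\<in>S. if 0 = k then hc x 0 \<otimes> hc y k else \<zero>) = (\<Oplus>k\<in>S. \<zero>)"
      using False by (intro finsum_cong') auto
    then show ?thesis using False S(2)[of 0] by auto
  qed
  finally show ?thesis .
qed

lemma ideal_aug: "ideal (aug_ideal A G) A"
proof (rule idealI)
  show "ring A" by (rule ring_axioms)
  show "subgroup (aug_ideal A G) (add_monoid A)"
  proof (rule add.subgroupI)
    show "aug_ideal A G \<noteq> {}" using aug_ideal_iff[of "\<zero>"] by auto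
  qed (auto simp: aug_ideal_iff hc_neg hc_add)
qed (auto simp: aug_ideal_iff hc_0_mult)

definition homogeneous_ideal :: "'a set \<Rightarrow> bool" where
  "homogeneous_ideal I \<longleftrightarrow> (\<forall>x\<in>I. \<forall>i. hc x i \<in> I)"

text \<open>The elements of the ideal all of whose components lie in it form an ideal
  \<open>H\<close>: multiplication by a homogeneous element shifts components, and any factor is a
  sum of homogeneous ones. \<open>H\<close> contains \<open>S\<close>, hence everything that
  \<open>S\<close> generates.\<close>

lemma homogeneous_genideal:
  assumes "\<And>x. x \<in> S \<Longrightarrow> \<exists>i. x \<in> G i"
  shows "homogeneous_ideal (Idl S)"
proof -
  have S: "S \<subseteq> carrier A" using assms G_carrier by blast
  let ?I = "Idl S"
  interpret I: ideal ?I A using S by (rule genideal_ideal)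
  define H where "H = {x \<in> ?I. \<forall>i. hc x i \<in> ?I}"
  have Ic: "x \<in> ?I \<Longrightarrow> x \<in> carrier A" for x using I.a_subset by blast
  have sums: "(\<Oplus>k\<in>T. f k) \<in> ?I" if "finite T" "\<And>k. f k \<in> ?I" for T and f :: "nat \<Rightarrow> 'a"
    using that(1)
  proof (induction T)
    case (insert k T)
    then show ?case using that(2) Ic by (subst finsum_insert) auto
  qed simp
  have "ideal H A"
  proof (rule idealI)
    show "ring A" by (rule ring_axioms)
    have "\<zero> \<in> H" by (simp add: H_def)
    show "subgroup H (add_monoid A)"
    proof (rule add.subgroupI)
      show "H \<noteq> {}" using \<open>\<zero> \<in> H\<close> by blast
    qed (auto simp: H_def hc_neg hc_add Ic)
    fix x a assume x: "x \<in> H" and a: "a \<in> carrier A"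
    then have xI: "x \<in> ?I" "x \<in> carrier A" "\<And>i. hc x i \<in> ?I" using Ic by (auto simp: H_def)
    obtain T where T: "finite T" "\<And>i. i \<notin> T \<Longrightarrow> hc a i = \<zero>" "a = (\<Oplus>i\<in>T. hc a i)" using hc_sum[OF a] by blast
    note [simp] = hc_carrier[OF a] xI a
    have "hc (a \<otimes> x) i \<in> ?I" for i
    proof -
      have "a \<otimes> x = (\<Oplus>k\<in>T. hc a k \<otimes> x)" by (subst T(3), subst finsum_ldistr) (auto simp: T(1))
      then have "hc (a \<otimes> x) i = (\<Oplus>k\<in>T. hc (hc a k \<otimes> x) i)"
        using T(1) hc_finsum[of T "\<lambda>k. hc a k \<otimes> x" i] by simp
      also have "\<dots> \<in> ?I"
        using T(1) hc_mult_left[OF xI(2) hc_G[OF a]] by (intro sums) (auto simp: I.I_l_closed)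
      finally show ?thesis .
    qed
    then show "a \<otimes> x \<in> H" by (auto simp: H_def I.I_l_closed)
    have "hc (x \<otimes> a) i \<in> ?I" for i
    proof -
      have "x \<otimes> a = (\<Oplus>k\<in>T. x \<otimes> hc a k)" by (subst T(3), subst finsum_rdistr) (auto simp: T(1))
      then have "hc (x \<otimes> a) i = (\<Oplus>k\<in>T. hc (x \<otimes> hc a k) i)"
        using T(1) hc_finsum[of T "\<lambda>k. x \<otimes> hc a k" i] by simp
      also have "\<dots> \<in> ?I"
        using T(1) hc_mult_right[OF xI(2) hc_G[OF a]] by (intro sums) (auto simp: I.I_r_closed)
      finally show ?thesis .
    qed
    then show "x \<otimes> a \<in> H" by (auto simp: H_def I.I_r_closed)
  qed
  moreover have "S \<subseteq> H"
  proof
    fix x assume x: "x \<in> S"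
    then obtain i where "x \<in> G i" using assms by blast
    then show "x \<in> H" using x genideal_self[OF S] by (auto simp: H_def hc_homogeneous)
  qed
  ultimately have "?I \<subseteq> H" by (rule genideal_minimal)
  then show ?thesis by (auto simp: homogeneous_ideal_def H_def)
qed

lemma aug_carrier: "x \<in> aug_ideal A G \<Longrightarrow> x \<in> carrier A" by (simp add: aug_ideal_iff)

text \<open>What has to be derived are the two conditions on the augmentation ideal. Let wc = u +
  c'w with \<open>c\<close> in it, and compare components of degree \<open>d\<close>: the left side
  has none, so \<open>hc c' 0\<close> times \<open>w\<close> is minus \<open>hc u d\<close>, which
  lies in the homogeneous ideal \<open>I\<close>. It is absorbed into the error \<open>u\<close>,
  and \<open>c'\<close> is replaced by c' - \<open>hc c' 0\<close>. The other side is
  symmetric.\<close>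

lemma normal_regularI:
  assumes I: "ideal I A" "homogeneous_ideal I" "I \<subseteq> aug_ideal A G" and w: "w \<in> G d" "0 < d"
    and J: "J = {u \<oplus> w \<otimes> c | u c. u \<in> I \<and> c \<in> carrier A}" "ideal J A"
    and nl: "\<And>c. c \<in> carrier A \<Longrightarrow> \<exists>c'\<in>carrier A. \<exists>u\<in>I. w \<otimes> c = u \<oplus> c' \<otimes> w"
    and nr: "\<And>c. c \<in> carrier A \<Longrightarrow> \<exists>c'\<in>carrier A. \<exists>u\<in>I. c \<otimes> w = u \<oplus> w \<otimes> c'"
    and rl: "\<And>c. c \<in> carrier A \<Longrightarrow> w \<otimes> c \<in> I \<Longrightarrow> c \<in> I"
    and rr: "\<And>c. c \<in> carrier A \<Longrightarrow> c \<otimes> w \<in> I \<Longrightarrow> c \<in> I"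
  shows "normal_regular A I J (aug_ideal A G) w"
proof -
  interpret I: ideal I A by (rule I(1))
  interpret m: ideal "aug_ideal A G" A by (rule ideal_aug)
  have wc: "w \<in> carrier A" using w(1) by (rule G_carrier)
  have Ic: "u \<in> I \<Longrightarrow> u \<in> carrier A" for u using I.a_subset by blast
  have wm: "w \<in> aug_ideal A G" using w wc by (simp add: aug_ideal_iff hc_homogeneous)
  have red: "c \<ominus> hc c 0 \<in> aug_ideal A G" if "c \<in> carrier A" for c
  proof -
    have "hc (c \<ominus> hc c 0) 0 = hc c 0 \<oplus> \<ominus> hc (hc c 0) 0"
      using that by (simp add: a_minus_def hc_add hc_neg)
    also have "hc (hc c 0) 0 = hc c 0" by (simp add: hc_homogeneous[OF hc_G[OF that]])
    finally show ?thesis using that by (simp add: aug_ideal_iff r_neg)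
  qed
  have I_of_sum: "b \<in> I" if "\<zero> = a \<oplus> b" "a \<in> I" "b \<in> carrier A" for a b
    using that Ic I.a_inv_closed by (metis a_comm minus_equality)
  show ?thesis
  proof (intro normal_regular.intro normal_regular_axioms.intro, goal_cases)
    case 1 show ?case by (rule ring_axioms)
  next
    case 2 show ?case by (rule I(1))
  next
    case 3 show ?case by (rule J(2))
  next
    case 4 show ?case by (rule ideal_aug)
  next
    case 5 show ?case by (rule wc)
  next
    case 6 show ?case by (rule J(1))
  next
    case 7 show ?case unfolding J(1) using I(3) wm by (auto intro!: m.a_closed m.I_r_closed)
  next
    case (8 c) then show ?case by (rule nl)
  next
    case (9 c) then show ?case by (rule nr)
  next
    case (10 c)
    then have c: "c \<in> carrier A" "hc c 0 = \<zero>" by (auto simp: aug_ideal_iff)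
    obtain c' u where c': "c' \<in> carrier A" "u \<in> I" "w \<otimes> c = u \<oplus> c' \<otimes> w" using nl[OF c(1)] by blast
    note [simp] = c'(1) c wc Ic[OF c'(2)] hc_carrier[OF c'(1)]
    have "hc (w \<otimes> c) d = hc u d \<oplus> hc (c' \<otimes> w) d" by (simp only: c'(3), rule hc_add) auto
    moreover have "hc (w \<otimes> c) d = \<zero>" by (simp add: hc_mult_left[OF c(1) w(1)])
    ultimately have "\<zero> = hc u d \<oplus> hc c' 0 \<otimes> w"
      by (simp add: hc_mult_right[OF c'(1) w(1)])
    then have "hc c' 0 \<otimes> w \<in> I"
      by (rule I_of_sum) (use I(2) c'(2) in \<open>auto simp: homogeneous_ideal_def\<close>)
    then have "u \<oplus> hc c' 0 \<otimes> w \<in> I" using c'(2) by simp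
    moreover have "w \<otimes> c = (u \<oplus> hc c' 0 \<otimes> w) \<oplus> (c' \<ominus> hc c' 0) \<otimes> w"
      unfolding c'(3) by (simp add: a_minus_def l_distr l_minus a_ac r_neg r_neg1 r_neg2)
    ultimately show ?case using red[OF c'(1)] by blast
  next
    case (11 c)
    then have c: "c \<in> carrier A" "hc c 0 = \<zero>" by (auto simp: aug_ideal_iff)
    obtain c' u where c': "c' \<in> carrier A" "u \<in> I" "c \<otimes> w = u \<oplus> w \<otimes> c'" using nr[OF c(1)] by blast
    note [simp] = c'(1) c wc Ic[OF c'(2)] hc_carrier[OF c'(1)]
    have "hc (c \<otimes> w) d = hc u d \<oplus> hc (w \<otimes> c') d" by (simp only: c'(3), rule hc_add) auto
    moreover have "hc (c \<otimes> w) d = \<zero>" by (simp add: hc_mult_right[OF c(1) w(1)])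
    ultimately have "\<zero> = hc u d \<oplus> w \<otimes> hc c' 0"
      by (simp add: hc_mult_left[OF c'(1) w(1)])
    then have "w \<otimes> hc c' 0 \<in> I"
      by (rule I_of_sum) (use I(2) c'(2) in \<open>auto simp: homogeneous_ideal_def\<close>)
    then have "u \<oplus> w \<otimes> hc c' 0 \<in> I" using c'(2) by simp
    moreover have "c \<otimes> w = (u \<oplus> w \<otimes> hc c' 0) \<oplus> w \<otimes> (c' \<ominus> hc c' 0)"
      unfolding c'(3) by (simp add: a_minus_def r_distr r_minus a_ac r_neg r_neg1 r_neg2)
    ultimately show ?case using red[OF c'(1)] by blast
  next
    case (12 c) then show ?case by (rule rl)
  next
    case (13 c) then show ?case by (rule rr)
  qed
qed

end

section \<open>Regular normalizing sequences\<close>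

text \<open>For n = k + 2 the two bounds add up to at most (n + 1)^e times c + (c + 1)(k + 1), and k
  + 1 = n - 1 leaves room. The enlarged constant also pays for the extra 1 in degree 1. The exponent
  grows because every second earlier rank is added.\<close>

lemma quotient_rank_bound:
  assumes "\<And>n. f n \<le> c * (n + 1) ^ e"
  shows "quotient_rank f n \<le> (c + 1) * (n + 1) ^ (e + 1)"
proof (induction n rule: less_induct)
  case (less n)
  consider "n = 0" | "n = 1" | k where "n = Suc (Suc k)" by (metis One_nat_def not0_implies_Suc)
  then show ?case
  proof cases
    case 1
    then show ?thesis using assms[of 0] by simp
  next
    case 2
    have "f 1 + 1 \<le> c * 2 ^ e + 1" using assms[of 1] by (simp add: numeral_2_eq_2)
    also have "\<dots> \<le> c * 2 ^ e + 2 ^ e" by simp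
    also have "\<dots> \<le> (c + 1) * 2 ^ (e + 1)" by (simp add: algebra_simps)
    finally have "f 1 + 1 \<le> (c + 1) * 2 ^ (e + 1)" .
    moreover have "quotient_rank f n = f 1 + 1" "n + 1 = 2" using 2 by simp_all
    ultimately show ?thesis by (simp only:)
  next
    case 3
    have "quotient_rank f k \<le> (c + 1) * (k + 1) ^ (e + 1)" using less 3 by simp
    also have "\<dots> \<le> (c + 1) * ((n + 1) ^ e * (k + 1))"
      unfolding power_add power_one_right using 3 by (intro mult_le_mono2 mult_le_mono1 power_mono) auto
    finally have "quotient_rank f n \<le> c * (n + 1) ^ e + (c + 1) * ((n + 1) ^ e * (k + 1))"
      using assms[of n] 3 by simp
    also have "\<dots> \<le> (c + 1) * ((n + 1) ^ e * (n + 1))"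
      using 3 by (simp add: algebra_simps)
    finally show ?thesis by (simp add: algebra_simps)
  qed
qed

context ring begin

text \<open>Adding the right multiples of \<open>w\<close> to \<open>Idl S\<close> already yields a
  two-sided ideal, since normality moves left factors past \<open>w\<close>.\<close>

lemma ideal_insert_normal:
  assumes S: "S \<subseteq> carrier R" and w: "w \<in> carrier R"
    and nr: "\<And>c. c \<in> carrier R \<Longrightarrow> \<exists>c'\<in>carrier R. \<exists>u\<in>Idl S. c \<otimes> w = u \<oplus> w \<otimes> c'"
  shows "Idl (insert w S) = {u \<oplus> w \<otimes> c | u c. u \<in> Idl S \<and> c \<in> carrier R}" (is "_ = ?J")
proof
  interpret I: ideal "Idl S" R using S by (rule genideal_ideal)
  have Ic: "u \<in> Idl S \<Longrightarrow> u \<in> carrier R" for u using I.a_subset by blast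
  interpret J': ideal "Idl (insert w S)" R using S w by (intro genideal_ideal) auto
  have "Idl S \<subseteq> Idl (insert w S)"
    using genideal_self[of "insert w S"] S w by (intro genideal_minimal J'.ideal_axioms) auto
  moreover have "w \<in> Idl (insert w S)" using genideal_self[of "insert w S"] S w by auto
  ultimately show "?J \<subseteq> Idl (insert w S)" by (auto intro!: J'.a_closed J'.I_r_closed)
  have "ideal ?J R"
  proof (rule idealI)
    show "ring R" by (rule ring_axioms)
    show "subgroup ?J (add_monoid R)"
    proof (rule add.subgroupI)
      show "?J \<subseteq> carrier R" using Ic w by auto
      have "\<zero> \<oplus> w \<otimes> \<zero> \<in> ?J" using I.zero_closed by blast
      then show "?J \<noteq> {}" by blast
    next
      fix x assume "x \<in> ?J"
      then obtain u c where x: "u \<in> Idl S" "c \<in> carrier R" "x = u \<oplus> w \<otimes> c" by blast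
      have "\<ominus> x = \<ominus> u \<oplus> w \<otimes> (\<ominus> c)" using x Ic w by (simp add: minus_add r_minus)
      then show "\<ominus> x \<in> ?J" using x by blast
      fix y assume "y \<in> ?J"
      then obtain u' c' where y: "u' \<in> Idl S" "c' \<in> carrier R" "y = u' \<oplus> w \<otimes> c'" by blast
      have "x \<oplus> y = (u \<oplus> u') \<oplus> w \<otimes> (c \<oplus> c')" using x y Ic w by (simp add: r_distr a_ac)
      then show "x \<oplus> y \<in> ?J" using x y by blast
    qed
    fix x a assume "x \<in> ?J" and a: "a \<in> carrier R"
    then obtain u c where x: "u \<in> Idl S" "c \<in> carrier R" "x = u \<oplus> w \<otimes> c" by blast
    have "x \<otimes> a = u \<otimes> a \<oplus> w \<otimes> (c \<otimes> a)" using x Ic w a by (simp add: l_distr m_assoc)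
    then show "x \<otimes> a \<in> ?J" using x a I.I_r_closed by blast
    obtain a' u' where a': "a' \<in> carrier R" "u' \<in> Idl S" "a \<otimes> w = u' \<oplus> w \<otimes> a'" using nr[OF a] by blast
    have "a \<otimes> x = a \<otimes> u \<oplus> (a \<otimes> w) \<otimes> c" using x Ic w a by (simp add: r_distr m_assoc)
    also have "\<dots> = (a \<otimes> u \<oplus> u' \<otimes> c) \<oplus> w \<otimes> (a' \<otimes> c)"
      unfolding a'(3) using x a' Ic w a by (simp add: l_distr m_assoc a_assoc)
    finally show "a \<otimes> x \<in> ?J" using x a a' I.I_r_closed I.I_l_closed I.a_closed by blast
  qed
  moreover have "insert w S \<subseteq> ?J"
  proof -
    have "w = \<zero> \<oplus> w \<otimes> \<one>" using w by simp
    then have "w \<in> ?J" using I.zero_closed by blast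
    moreover have "s \<in> ?J" if "s \<in> S" for s
    proof -
      have "s = s \<oplus> w \<otimes> \<zero>" using that S w by auto
      then show ?thesis using genideal_self[OF S] that by blast
    qed
    ultimately show ?thesis by blast
  qed
  ultimately show "Idl (insert w S) \<subseteq> ?J" by (rule genideal_minimal)
qed

text \<open>Passes from cosets in \<open>R Quot I\<close>, in which regular normalizing sequences
  are defined, to representatives, in which \<open>normal_regular\<close> is stated.\<close>

lemma quotient_regular_normal:
  assumes I: "ideal I R" and w: "w \<in> carrier R"
    and reg: "\<And>x. x \<in> carrier (R Quot I) \<Longrightarrow> (I +> w) \<otimes>\<^bsub>R Quot I\<^esub> x = \<zero>\<^bsub>R Quot I\<^esub> \<or> x \<otimes>\<^bsub>R Quot I\<^esub> (I +> w) = \<zero>\<^bsub>R Quot I\<^esub> \<Longrightarrow>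
        x = \<zero>\<^bsub>R Quot I\<^esub>"
    and nor: "(I +> w) <#\<^bsub>R Quot I\<^esub> carrier (R Quot I) = carrier (R Quot I) #>\<^bsub>R Quot I\<^esub> (I +> w)"
  shows "c \<in> carrier R \<Longrightarrow> \<exists>c'\<in>carrier R. \<exists>u\<in>I. w \<otimes> c = u \<oplus> c' \<otimes> w"
    and "c \<in> carrier R \<Longrightarrow> \<exists>c'\<in>carrier R. \<exists>u\<in>I. c \<otimes> w = u \<oplus> w \<otimes> c'"
    and "c \<in> carrier R \<Longrightarrow> w \<otimes> c \<in> I \<Longrightarrow> c \<in> I"
    and "c \<in> carrier R \<Longrightarrow> c \<otimes> w \<in> I \<Longrightarrow> c \<in> I"
proof -
  interpret I: ideal I R by (rule I)
  interpret N: left_module R "regular_module R" by (rule left_module_regular)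
  have sub: "submodule I R (regular_module R)" by (rule ring_ideal_submodule[OF ring_axioms I])
  have coset: "I +>\<^bsub>regular_module R\<^esub> x = I +> x" for x by (simp add: a_r_coset_def')
  have z: "I +> x = I \<longleftrightarrow> x \<in> I" if "x \<in> carrier R" for x
    using N.coset_eq_zero_iff[OF sub, of x] that by (simp add: coset)
  have mem: "x \<in> I +> x" if "x \<in> carrier R" for x
    using that I.zero_closed by (force simp: a_r_coset_def')
  have D: "carrier (R Quot I) = (\<lambda>x. I +> x) ` carrier R" "\<zero>\<^bsub>R Quot I\<^esub> = I"
    by (auto simp: FactRing_def A_RCOSETS_def')
  have D2: "(I +> x) \<otimes>\<^bsub>R Quot I\<^esub> (I +> y) = I +> (x \<otimes> y)" if "x \<in> carrier R" "y \<in> carrier R" for x y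
    using I.rcoset_mult_add[OF that] by (simp add: FactRing_def)
  assume c: "c \<in> carrier R"
  have cc: "I +> c \<in> carrier (R Quot I)" using c D by blast
  {
    have "I +> (w \<otimes> c) \<in> (I +> w) <#\<^bsub>R Quot I\<^esub> carrier (R Quot I)"
      using cc D2[OF w c] unfolding l_coset_def by blast
    then obtain x where "x \<in> carrier (R Quot I)" "I +> (w \<otimes> c) = x \<otimes>\<^bsub>R Quot I\<^esub> (I +> w)"
      unfolding nor r_coset_def by blast
    then obtain c' where c': "c' \<in> carrier R" "I +> (w \<otimes> c) = I +> (c' \<otimes> w)"
      using D(1) D2[OF _ w] by auto
    have "w \<otimes> c \<in> I +> (c' \<otimes> w)" using mem[of "w \<otimes> c"] c'(2) w c by simp
    then show "\<exists>c'\<in>carrier R. \<exists>u\<in>I. w \<otimes> c = u \<oplus> c' \<otimes> w"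
      using c'(1) unfolding a_r_coset_def' by blast
  }
  {
    have "I +> (c \<otimes> w) \<in> carrier (R Quot I) #>\<^bsub>R Quot I\<^esub> (I +> w)"
      using cc D2[OF c w] unfolding r_coset_def by blast
    then obtain x where "x \<in> carrier (R Quot I)" "I +> (c \<otimes> w) = (I +> w) \<otimes>\<^bsub>R Quot I\<^esub> x"
      unfolding nor[symmetric] l_coset_def by blast
    then obtain c' where c': "c' \<in> carrier R" "I +> (c \<otimes> w) = I +> (w \<otimes> c')"
      using D(1) D2[OF w] by auto
    have "c \<otimes> w \<in> I +> (w \<otimes> c')" using mem[of "c \<otimes> w"] c'(2) w c by simp
    then show "\<exists>c'\<in>carrier R. \<exists>u\<in>I. c \<otimes> w = u \<oplus> w \<otimes> c'"
      using c'(1) unfolding a_r_coset_def' by blast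
  }
  show "c \<in> I" if "w \<otimes> c \<in> I"
    using reg[OF cc] D2[OF w c] z[of "w \<otimes> c"] z[OF c] that w c D(2) by simp
  show "c \<in> I" if "c \<otimes> w \<in> I"
    using reg[OF cc] D2[OF c w] z[of "c \<otimes> w"] z[OF c] that w c D(2) by simp
qed

end

context graded begin

lemma left_module_trivial: "left_module A (trivial_module A G)"
  unfolding trivial_module_def
  by (rule left_module_quot[OF left_module_regular ring_ideal_submodule[OF ring_axioms ideal_aug]])

text \<open>Links the trivial module, an honest quotient, with the pairs inside
  \<open>seqs A\<close>: the kernel of this cover of rank 1 is the augmentation ideal, so resolving
  the kernel is resolving m.\<close>

lemma trivial_cover:
  defines "\<pi> \<equiv> \<lambda>v :: nat \<Rightarrow> 'a. aug_ideal A G +> v 0"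
  shows "lin_on A (seqs A) (fr A 1) (trivial_module A G) (carrier (trivial_module A G)) \<pi>"
    and "x \<in> carrier (trivial_module A G) \<Longrightarrow> \<exists>c\<in>fr A 1. \<pi> c = x"
    and "{c \<in> fr A 1. \<pi> c = \<zero>\<^bsub>trivial_module A G\<^esub>} = fI A (aug_ideal A G) 1"
proof -
  let ?m = "aug_ideal A G"
  interpret N: left_module A "regular_module A" by (rule left_module_regular)
  have sub: "submodule ?m A (regular_module A)" by (rule ring_ideal_submodule[OF ring_axioms ideal_aug])
  have coset: "?m +> x = ?m +>\<^bsub>regular_module A\<^esub> x" for x by (simp add: a_r_coset_def')
  show "lin_on A (seqs A) (fr A 1) (trivial_module A G) (carrier (trivial_module A G)) \<pi>"
    unfolding \<pi>_def coset trivial_module_def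
    by (rule lin_onI) (simp_all add: fr_def quot_add[OF left_module_regular sub] quot_smult[OF left_module_regular sub])
  show "\<exists>c\<in>fr A 1. \<pi> c = x" if x: "x \<in> carrier (trivial_module A G)"
  proof -
    obtain a where a: "a \<in> carrier A" "x = ?m +> a" using x by (auto simp: trivial_module_def coset)
    then show ?thesis by (intro bexI[of _ "\<lambda>i. if i = 0 then a else \<zero>"]) (auto simp: \<pi>_def fr_def)
  qed
  have "?m +> a = ?m \<longleftrightarrow> a \<in> ?m" if "a \<in> carrier A" for a
    using N.coset_eq_zero_iff[OF sub, of a] that by (simp add: coset)
  moreover have "\<zero> \<in> ?m" by (simp add: aug_ideal_iff)
  ultimately show "{c \<in> fr A 1. \<pi> c = \<zero>\<^bsub>trivial_module A G\<^esub>} = fI A ?m 1"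
    by (auto simp: \<pi>_def trivial_module_def fI_def fr_def) (metis One_nat_def Suc_leI not_gr0)
qed

text \<open>Induction over the elements divided out. For \<open>i = 0\<close> the ranks are bounded,
  so the exponent is 0, and each further element raises it by one through
  \<open>quotient_rank_bound\<close>.\<close>

lemma regular_sequence_resolvable:
  fixes \<Omega>s :: "'a list"
  assumes inf: "infinite (UNIV :: 'a set)" and noeth: "left_noetherian A" and gl: "gl_dim A < \<infinity>"
    and seq: "regular_normalizing_sequence A \<Omega>s" and hom: "\<forall>\<Omega>\<in>set \<Omega>s. \<exists>i>0. \<Omega> \<in> G i"
    and "i \<le> length \<Omega>s"
  shows "\<exists>f c e. (\<forall>n. f n \<le> c * (n + 1) ^ e) \<and>
     (\<forall>n. resolvable A (Idl (set (take i \<Omega>s))) n f (fI A (aug_ideal A G) 1) (fI A (Idl (set (take i \<Omega>s))) 1))"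
  using assms(6)
proof (induction i)
  case 0
  obtain P d \<epsilon> l where "projective_resolution A (trivial_module A G) P d \<epsilon>" "\<And>n. n > l \<Longrightarrow> zero_module (P n)"
    using gl_dim_resolution[OF gl left_module_trivial] by blast
  from noetherian_resolvable[OF noeth inf left_module_trivial this trivial_cover(1,2), unfolded trivial_cover(3)]
  obtain f b where fb: "\<And>i. f i \<le> b" "\<And>n. resolvable A {\<zero>} n f (fI A (aug_ideal A G) 1) {\<lambda>_. \<zero>}"
    by blast
  have "Idl {} = {\<zero>}"
  proof
    show "Idl {} \<subseteq> {\<zero>}" by (rule genideal_minimal[OF zeroideal]) simp
    show "{\<zero>} \<subseteq> Idl {}"
      using additive_subgroup.zero_closed[OF ideal.axioms(1)[OF genideal_ideal[of "{}"]]] by simp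
  qed
  then show ?case using fb by (intro exI[of _ f] exI[of _ b] exI[of _ 0]) (simp add: fI_zero)
next
  case (Suc i)
  then have i: "i < length \<Omega>s" by simp
  let ?S = "set (take i \<Omega>s)" and ?w = "\<Omega>s ! i" and ?m = "aug_ideal A G"
  let ?I = "Idl ?S"
  have sub: "?S \<subseteq> set \<Omega>s" by (rule set_take_subset)
  obtain d where d: "0 < d" "?w \<in> G d" using hom nth_mem[OF i] by blast
  have wc: "?w \<in> carrier A" using d G_carrier by blast
  have homS: "\<exists>j. x \<in> G j" if "x \<in> ?S" for x using that sub hom by blast
  then have Sc: "?S \<subseteq> carrier A" using G_carrier by blast
  have I: "ideal ?I A" using Sc by (rule genideal_ideal)
  have "?S \<subseteq> ?m"
  proof
    fix x assume "x \<in> ?S"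
    then obtain j where "0 < j" "x \<in> G j" using sub hom by blast
    then show "x \<in> ?m" by (simp add: aug_ideal_iff hc_homogeneous G_carrier)
  qed
  then have Im: "?I \<subseteq> ?m" by (rule genideal_minimal[OF ideal_aug])
  have "(\<forall>x\<in>carrier (A Quot ?I). (?I +> ?w) \<otimes>\<^bsub>A Quot ?I\<^esub> x = \<zero>\<^bsub>A Quot ?I\<^esub> \<or>
         x \<otimes>\<^bsub>A Quot ?I\<^esub> (?I +> ?w) = \<zero>\<^bsub>A Quot ?I\<^esub> \<longrightarrow> x = \<zero>\<^bsub>A Quot ?I\<^esub>) \<and>
      (?I +> ?w) <#\<^bsub>A Quot ?I\<^esub> carrier (A Quot ?I) = carrier (A Quot ?I) #>\<^bsub>A Quot ?I\<^esub> (?I +> ?w)"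
    using seq i unfolding regular_normalizing_sequence_def Let_def by blast
  then have reg: "\<And>x. x \<in> carrier (A Quot ?I) \<Longrightarrow> (?I +> ?w) \<otimes>\<^bsub>A Quot ?I\<^esub> x = \<zero>\<^bsub>A Quot ?I\<^esub> \<or>
         x \<otimes>\<^bsub>A Quot ?I\<^esub> (?I +> ?w) = \<zero>\<^bsub>A Quot ?I\<^esub> \<Longrightarrow> x = \<zero>\<^bsub>A Quot ?I\<^esub>"
    and nor: "(?I +> ?w) <#\<^bsub>A Quot ?I\<^esub> carrier (A Quot ?I) = carrier (A Quot ?I) #>\<^bsub>A Quot ?I\<^esub> (?I +> ?w)"
    by blast+
  note nr = quotient_regular_normal[OF I wc reg nor]
  let ?J = "Idl (set (take (Suc i) \<Omega>s))"
  have S': "set (take (Suc i) \<Omega>s) = insert ?w ?S" using i by (simp add: take_Suc_conv_app_nth)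
  have J: "?J = {u \<oplus> ?w \<otimes> c | u c. u \<in> ?I \<and> c \<in> carrier A}"
    unfolding S' by (rule ideal_insert_normal[OF Sc wc nr(2)])
  have Ji: "ideal ?J A" unfolding S' using Sc wc by (intro genideal_ideal) auto
  have "normal_regular A ?I ?J ?m ?w"
    by (rule normal_regularI[OF I homogeneous_genideal[OF homS] Im d(2,1) J Ji nr])
  then interpret nr: normal_regular A ?I ?J ?m ?w .
  obtain f c e where f: "\<And>n. f n \<le> c * (n + 1) ^ e" "\<And>n. resolvable A ?I n f (fI A ?m 1) (fI A ?I 1)"
    using Suc by auto
  have "\<forall>n. quotient_rank f n \<le> (c + 1) * (n + 1) ^ (e + 1)" using quotient_rank_bound[OF f(1)] by blast
  moreover have "\<forall>n. resolvable A ?J n (quotient_rank f) (fI A ?m 1) (fI A ?J 1)"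
    using nr.resolvable_change_of_rings[OF f(2)] by blast
  ultimately show ?case by blast
qed

end

text \<open>In characteristic zero the natural multiples of the unit are pairwise distinct, because
  a nonzero scalar cannot kill the unit of \<open>A\<close>. This provides the infinite type that
  \<open>ex_inj_sequences\<close> asks for.\<close>

lemma infinite_connected_graded:
  fixes A :: "('k, 'a) module"
  assumes "field K" "char_zero K" "connected_graded K A G"
  shows "infinite (UNIV :: 'a set)"
proof -
  interpret K: field K by fact
  interpret graded K A G by standard (use assms(3) in \<open>simp add: connected_graded_def\<close>)
  have ne: "\<one>\<^bsub>A\<^esub> \<noteq> \<zero>\<^bsub>A\<^esub>" using assms(3) by (simp add: connected_graded_def)
  let ?f = "\<lambda>n::nat. [n] \<cdot>\<^bsub>K\<^esub> \<one>\<^bsub>K\<^esub>"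
  have fc: "?f n \<in> carrier K" for n by simp
  have 1: "a \<odot>\<^bsub>A\<^esub> \<one>\<^bsub>A\<^esub> \<noteq> \<zero>\<^bsub>A\<^esub>" if "a \<in> carrier K" "a \<noteq> \<zero>\<^bsub>K\<^esub>" for a
  proof
    have ia: "inv\<^bsub>K\<^esub> a \<in> carrier K" using that K.field_Units by simp
    assume "a \<odot>\<^bsub>A\<^esub> \<one>\<^bsub>A\<^esub> = \<zero>\<^bsub>A\<^esub>"
    then have "(inv\<^bsub>K\<^esub> a \<otimes>\<^bsub>K\<^esub> a) \<odot>\<^bsub>A\<^esub> \<one>\<^bsub>A\<^esub> = \<zero>\<^bsub>A\<^esub>"
      using that(1) ia KL.smult_r_null by (simp add: KA.smult_assoc1)
    then show False using that ne K.field_Units by simp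
  qed
  have 2: "?f n \<odot>\<^bsub>A\<^esub> \<one>\<^bsub>A\<^esub> \<noteq> ?f k \<odot>\<^bsub>A\<^esub> \<one>\<^bsub>A\<^esub>" if "k < n" for k n
  proof
    assume e: "?f n \<odot>\<^bsub>A\<^esub> \<one>\<^bsub>A\<^esub> = ?f k \<odot>\<^bsub>A\<^esub> \<one>\<^bsub>A\<^esub>"
    have "?f n = ?f k \<oplus>\<^bsub>K\<^esub> ?f (n - k)" using that by (simp add: K.add.nat_pow_mult)
    then have "?f k \<odot>\<^bsub>A\<^esub> \<one>\<^bsub>A\<^esub> = ?f k \<odot>\<^bsub>A\<^esub> \<one>\<^bsub>A\<^esub> \<oplus>\<^bsub>A\<^esub> ?f (n - k) \<odot>\<^bsub>A\<^esub> \<one>\<^bsub>A\<^esub>"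
      using e by (simp add: KA.smult_l_distr)
    then have "?f (n - k) \<odot>\<^bsub>A\<^esub> \<one>\<^bsub>A\<^esub> = \<zero>\<^bsub>A\<^esub>" by simp
    moreover have "?f (n - k) \<noteq> \<zero>\<^bsub>K\<^esub>" using assms(2) that by (simp add: char_zero_def)
    ultimately show False using 1 fc by blast
  qed
  have "inj (\<lambda>n. ?f n \<odot>\<^bsub>A\<^esub> \<one>\<^bsub>A\<^esub>)"
  proof (rule injI)
    fix n k assume "?f n \<odot>\<^bsub>A\<^esub> \<one>\<^bsub>A\<^esub> = ?f k \<odot>\<^bsub>A\<^esub> \<one>\<^bsub>A\<^esub>"
    then show "n = k" using 2[of n k] 2[of k n] by (metis linorder_neqE_nat)
  qed
  then show ?thesis using infinite_UNIV_nat by (metis finite_imageD finite_subset subset_UNIV)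
qed

lemma quot_ring_simps:
  "mult (quot_module A I) = rcoset_mult A I" "one (quot_module A I) = I +>\<^bsub>A\<^esub> \<one>\<^bsub>A\<^esub>"
  "add (quot_module A I) = set_add A"
  by (simp_all add: quot_module_def ring.defs module.defs FactRing_def)

text \<open>The composite \<open>\<rho>\<close> of the quotient map with \<open>\<phi>\<close> is a
  graded surjection with kernel \<open>I\<close>. It commutes with homogeneous components and so
  maps one augmentation ideal onto the other, after which \<open>resolvable_transfer\<close>
  applies.\<close>

lemma graded_iso_resolvable:
  fixes C :: "('k, 'c) module" and A :: "('k, 'a) module"
  assumes "graded_algebra K C CG" "graded_algebra K A AG" and I: "ideal I C"
    and iso: "graded_algebra_iso K (quot_module C I) (quot_grading C CG I) A AG \<phi>"
    and Im: "I \<subseteq> aug_ideal C CG"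
    and res: "resolvable C I n f (fI C (aug_ideal C CG) 1) (fI C I 1)"
  shows "resolvable A {\<zero>\<^bsub>A\<^esub>} n f (fI A (aug_ideal A AG) 1) {\<lambda>_. \<zero>\<^bsub>A\<^esub>}"
proof -
  interpret C: graded K C CG by standard (rule assms(1))
  interpret A: graded K A AG by standard (rule assms(2))
  interpret I: ideal I C by (rule I)
  define \<rho> where "\<rho> = (\<lambda>x. \<phi> (I +>\<^bsub>C\<^esub> x))"
  have phi: "\<phi> \<in> ring_hom (quot_module C I) A" "bij_betw \<phi> (carrier (quot_module C I)) (carrier A)"
    using iso by (auto simp: graded_algebra_iso_def ring_iso_def)
  have "(\<lambda>x. I +>\<^bsub>C\<^esub> x) \<in> ring_hom C (quot_module C I)"
    using I.rcoset_mult_add I.a_rcos_sum by (intro ring_hom_memI) (auto simp: quot_ring_simps)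
  then have rho: "\<rho> \<in> ring_hom C A" using phi(1) unfolding \<rho>_def
    by (auto simp: ring_hom_def Pi_def)
  have onto: "\<rho> ` carrier C = carrier A"
  proof -
    have "\<rho> ` carrier C = \<phi> ` carrier (quot_module C I)" by (simp add: \<rho>_def image_image)
    then show ?thesis using phi(2) by (simp add: bij_betw_def)
  qed
  interpret h: ring_hom_ring C A \<rho> by (rule ring_hom_ringI2[OF C.ring_axioms A.ring_axioms rho])
  have ker: "\<rho> x = \<zero>\<^bsub>A\<^esub> \<longleftrightarrow> x \<in> I" if x: "x \<in> carrier C" for x
  proof -
    have Isub: "submodule I C (regular_module C)" by (rule ring_ideal_submodule[OF C.ring_axioms I])
    interpret N: left_module C "regular_module C" by (rule C.left_module_regular)
    have z: "I +>\<^bsub>C\<^esub> y = I \<longleftrightarrow> y \<in> I" if "y \<in> carrier C" for y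
      using N.coset_eq_zero_iff[OF Isub, of y] that by (simp add: a_r_coset_def')
    have "\<rho> \<zero>\<^bsub>C\<^esub> = \<zero>\<^bsub>A\<^esub>" by simp
    then have "\<rho> x = \<zero>\<^bsub>A\<^esub> \<longleftrightarrow> I +>\<^bsub>C\<^esub> x = I +>\<^bsub>C\<^esub> \<zero>\<^bsub>C\<^esub>"
      using phi(2) x unfolding \<rho>_def by (metis (no_types, lifting) C.zero_closed bij_betw_def image_eqI inj_on_eq_iff quot_module_simps(1))
    then show ?thesis using z[OF x] z[of "\<zero>\<^bsub>C\<^esub>"] by simp
  qed
  have deg: "\<rho> x \<in> AG i" if "x \<in> CG i" for x i
  proof -
    have "\<phi> ` (\<lambda>x. I +>\<^bsub>C\<^esub> x) ` CG i = AG i" using iso by (simp add: graded_algebra_iso_def quot_grading_def)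
    moreover have "\<rho> x \<in> \<phi> ` (\<lambda>x. I +>\<^bsub>C\<^esub> x) ` CG i" using that unfolding \<rho>_def by blast
    ultimately show ?thesis by simp
  qed
  have rsum: "\<rho> (\<Oplus>\<^bsub>C\<^esub>i\<in>S. g i) = (\<Oplus>\<^bsub>A\<^esub>i\<in>S. \<rho> (g i))" if "finite S" "\<And>i. g i \<in> carrier C" for S and g :: "nat \<Rightarrow> 'c"
    using that(1)
  proof (induction S)
    case (insert s S)
    have "\<rho> (\<Oplus>\<^bsub>C\<^esub>i\<in>insert s S. g i) = \<rho> (g s \<oplus>\<^bsub>C\<^esub> (\<Oplus>\<^bsub>C\<^esub>i\<in>S. g i))"
      using insert that(2) by (subst C.finsum_insert) auto
    also have "\<dots> = \<rho> (g s) \<oplus>\<^bsub>A\<^esub> (\<Oplus>\<^bsub>A\<^esub>i\<in>S. \<rho> (g i))"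
      using insert.IH that(2) by (simp add: C.finsum_closed)
    also have "\<dots> = (\<Oplus>\<^bsub>A\<^esub>i\<in>insert s S. \<rho> (g i))"
      using insert that(2) by (subst A.finsum_insert) auto
    finally show ?case .
  qed simp
  have hc: "A.hc (\<rho> x) = (\<lambda>i. \<rho> (C.hc x i))" if x: "x \<in> carrier C" for x
  proof -
    obtain S where S: "finite S" "\<And>i. i \<notin> S \<Longrightarrow> C.hc x i = \<zero>\<^bsub>C\<^esub>" "x = (\<Oplus>\<^bsub>C\<^esub>i\<in>S. C.hc x i)" using C.hc_sum[OF x] by blast
    have "\<rho> x = (\<Oplus>\<^bsub>A\<^esub>i\<in>S. \<rho> (C.hc x i))" using S(1,3) rsum[of S "C.hc x"] x by simp
    then show ?thesis using S(1,2) x deg by (intro A.hc_eqI[of _ S]) auto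
  qed
  let ?m = "aug_ideal C CG" and ?M = "aug_ideal A AG"
  have m: "\<rho> ` ?m = ?M"
  proof
    show "\<rho> ` ?m \<subseteq> ?M" by (auto simp: A.aug_ideal_iff C.aug_ideal_iff hc)
    show "?M \<subseteq> \<rho> ` ?m"
    proof
      fix y assume y: "y \<in> ?M"
      then have "y \<in> \<rho> ` carrier C" using onto A.aug_carrier by blast
      then obtain x where x: "x \<in> carrier C" "y = \<rho> x" by blast
      have r0: "\<rho> (C.hc x 0) = \<zero>\<^bsub>A\<^esub>" using y x by (simp add: A.aug_ideal_iff hc)
      \<comment> \<open>The chosen preimage may have a nonzero component of degree 0, but
        \<open>\<rho>\<close> kills that component, so it can be subtracted.\<close>
      let ?x = "x \<ominus>\<^bsub>C\<^esub> C.hc x 0"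
      have "C.hc ?x 0 = C.hc x 0 \<oplus>\<^bsub>C\<^esub> \<ominus>\<^bsub>C\<^esub> C.hc (C.hc x 0) 0"
        using x by (simp add: a_minus_def C.hc_add C.hc_neg)
      also have "C.hc (C.hc x 0) 0 = C.hc x 0" by (simp add: C.hc_homogeneous[OF C.hc_G[OF x(1)]])
      finally have "?x \<in> ?m" using x by (simp add: C.aug_ideal_iff C.r_neg)
      moreover have "\<rho> ?x = y" using x r0 by (simp add: a_minus_def A.minus_zero)
      ultimately show "y \<in> \<rho> ` ?m" by blast
    qed
  qed
  have "(\<lambda>v i. \<rho> (v i)) ` fI C ?m 1 = fI A ?M 1"
  proof
    show "(\<lambda>v i. \<rho> (v i)) ` fI C ?m 1 \<subseteq> fI A ?M 1"
    proof (rule image_subsetI)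
      fix v assume "v \<in> fI C ?m 1"
      then have v: "v i \<in> ?m" "i \<ge> 1 \<Longrightarrow> v i = \<zero>\<^bsub>C\<^esub>" for i by (simp_all add: fI_def fr_def)
      have "\<rho> (v i) \<in> ?M" for i using imageI[OF v(1), of \<rho>] unfolding m .
      then show "(\<lambda>i. \<rho> (v i)) \<in> fI A ?M 1"
        using v(2) A.aug_carrier by (simp add: fI_def fr_def)
    qed
    show "fI A ?M 1 \<subseteq> (\<lambda>v i. \<rho> (v i)) ` fI C ?m 1"
    proof
      fix v assume v: "v \<in> fI A ?M 1"
      then have "v 0 \<in> \<rho> ` ?m" unfolding m by (simp add: fI_def)
      then obtain x where x: "x \<in> ?m" "v 0 = \<rho> x" by blast
      have "v = (\<lambda>i. \<rho> (if i = 0 then x else \<zero>\<^bsub>C\<^esub>))"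
      proof
        fix i
        show "v i = \<rho> (if i = 0 then x else \<zero>\<^bsub>C\<^esub>)"
          using v x(2) by (cases i) (simp_all add: fI_def fr_def)
      qed
      moreover have "(\<lambda>i. if i = 0 then x else \<zero>\<^bsub>C\<^esub>) \<in> fI C ?m 1"
      proof -
        have "\<zero>\<^bsub>C\<^esub> \<in> ?m" by (simp add: C.aug_ideal_iff)
        then show ?thesis using x(1) C.aug_carrier[OF x(1)] by (simp add: fI_def fr_def)
      qed
      ultimately show "v \<in> (\<lambda>v i. \<rho> (v i)) ` fI C ?m 1" by (rule image_eqI)
    qed
  qed
  moreover have "resolvable A {\<zero>\<^bsub>A\<^esub>} n f ((\<lambda>v i. \<rho> (v i)) ` fI C ?m 1) {\<lambda>_. \<zero>\<^bsub>A\<^esub>}"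
    by (rule resolvable_transfer[OF C.ring_axioms A.ring_axioms rho onto I ker C.submod_fI[OF C.ideal_aug] _
      C.fI_mono[OF Im] res]) (auto simp: fI_def)
  ultimately show ?thesis by simp
qed

section \<open>Direct sums and graded free modules\<close>

text \<open>The full product is an ambient module: \<open>direct_sum\<close> is a submodule of it,
  and so are the cochain groups below, where the family is constant.\<close>

definition prod_module :: "'i set \<Rightarrow> ('i \<Rightarrow> ('r, 'm) module) \<Rightarrow> ('r, 'i \<Rightarrow> 'm) module" where
  "prod_module I V =
    \<lparr>carrier = (\<Pi>\<^sub>E i\<in>I. carrier (V i)), mult = undefined, one = undefined,
     zero = (\<lambda>i\<in>I. \<zero>\<^bsub>V i\<^esub>),
     add = (\<lambda>f g. \<lambda>i\<in>I. f i \<oplus>\<^bsub>V i\<^esub> g i),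
     smult = (\<lambda>r f. \<lambda>i\<in>I. r \<odot>\<^bsub>V i\<^esub> f i)\<rparr>"

lemma left_module_prod:
  assumes "ring R" and V: "\<And>i. i \<in> I \<Longrightarrow> left_module R (V i)"
  shows "left_module R (prod_module I V)"
proof -
  have ab: "abelian_group (V i)" if "i \<in> I" for i
    using V[OF that] by (simp add: left_module_def)
  note am = abelian_group.axioms(1)[OF ab]
  note [simp] = abelian_monoid.a_closed[OF am] abelian_monoid.zero_closed[OF am] abelian_monoid.l_zero[OF am]
    left_module.smult_closed[OF V] abelian_group.a_inv_closed[OF ab] abelian_group.l_neg[OF ab] left_module.smult_one[OF V]
  note [simp] = PiE_iff extensional_def fun_eq_iff
  show ?thesis
  proof (rule left_moduleI)
    show "abelian_group (prod_module I V)"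
    proof (rule abelian_groupI)
      fix x assume "x \<in> carrier (prod_module I V)"
      then show "\<exists>y\<in>carrier (prod_module I V). y \<oplus>\<^bsub>prod_module I V\<^esub> x = \<zero>\<^bsub>prod_module I V\<^esub>"
        by (intro bexI[of _ "\<lambda>i\<in>I. \<ominus>\<^bsub>V i\<^esub> x i"]) (auto simp: prod_module_def)
    qed (auto simp: prod_module_def abelian_monoid.a_assoc[OF am] abelian_monoid.a_lcomm[OF am] abelian_monoid.a_comm[OF am]
        abelian_monoid.r_zero[OF am])
  qed (use assms(1) in \<open>auto simp: prod_module_def left_module.smult_l_distr[OF V] left_module.smult_r_distr[OF V]
         left_module.smult_assoc[OF V]\<close>)
qed

lemma left_module_submodule:
  fixes M :: "('r, 'm) module"
  assumes "left_module R M" "submodule H R M"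
  shows "left_module R (M\<lparr>carrier := H\<rparr>)"
proof -
  interpret left_module R M by fact
  note [simp] = submod_carrier[OF assms(2)] submod_zero[OF assms(2)] submod_add[OF assms(2)] submod_smult[OF assms(2)]
  show ?thesis
  proof (rule left_moduleI)
    show "abelian_group (M\<lparr>carrier := H\<rparr>)"
    proof (rule abelian_groupI)
      fix x assume "x \<in> carrier (M\<lparr>carrier := H\<rparr>)"
      then show "\<exists>y\<in>carrier (M\<lparr>carrier := H\<rparr>). y \<oplus>\<^bsub>M\<lparr>carrier := H\<rparr>\<^esub> x = \<zero>\<^bsub>M\<lparr>carrier := H\<rparr>\<^esub>"
        by (intro bexI[of _ "\<ominus>\<^bsub>M\<^esub> x"]) (auto simp: M.l_neg submod_neg[OF assms(2)])
    qed (auto simp: M.a_ac)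
  qed (auto simp: R.ring_axioms smult_l_distr smult_r_distr smult_assoc smult_one)
qed

lemma direct_sum_eq:
  "direct_sum I V = (prod_module I V)\<lparr>carrier := {f \<in> carrier (prod_module I V). finite {i\<in>I. f i \<noteq> \<zero>\<^bsub>V i\<^esub>}}\<rparr>"
  by (simp add: direct_sum_def prod_module_def)

lemma left_module_direct_sum:
  assumes "ring R" and V: "\<And>i. i \<in> I \<Longrightarrow> left_module R (V i)"
  shows "left_module R (direct_sum I V)"
  unfolding direct_sum_eq
proof (rule left_module_submodule[OF left_module_prod[OF assms]])
  interpret left_module R "prod_module I V" by (rule left_module_prod[OF assms])
  show "submodule {f \<in> carrier (prod_module I V). finite {i\<in>I. f i \<noteq> \<zero>\<^bsub>V i\<^esub>}} R (prod_module I V)"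
  proof (rule submodI, goal_cases)
    case 1 show ?case by auto
  next
    case 2
    have "{i\<in>I. \<zero>\<^bsub>prod_module I V\<^esub> i \<noteq> \<zero>\<^bsub>V i\<^esub>} = {}" by (auto simp: prod_module_def)
    then have "finite {i\<in>I. \<zero>\<^bsub>prod_module I V\<^esub> i \<noteq> \<zero>\<^bsub>V i\<^esub>}" by (simp only: finite.emptyI)
    then show ?case using M.zero_closed by blast
  next
    case (3 x y)
    have "x i \<oplus>\<^bsub>V i\<^esub> y i = \<zero>\<^bsub>V i\<^esub>" if "i \<in> I" "x i = \<zero>\<^bsub>V i\<^esub>" "y i = \<zero>\<^bsub>V i\<^esub>" for i
      using V[OF that(1)] that by (simp add: left_module_def abelian_group_def abelian_monoid.l_zero abelian_monoid.zero_closed)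
    then have "{i\<in>I. (x \<oplus>\<^bsub>prod_module I V\<^esub> y) i \<noteq> \<zero>\<^bsub>V i\<^esub>} \<subseteq> {i\<in>I. x i \<noteq> \<zero>\<^bsub>V i\<^esub>} \<union> {i\<in>I. y i \<noteq> \<zero>\<^bsub>V i\<^esub>}"
      by (auto simp: prod_module_def)
    then have "finite {i\<in>I. (x \<oplus>\<^bsub>prod_module I V\<^esub> y) i \<noteq> \<zero>\<^bsub>V i\<^esub>}"
      by (rule finite_subset) (use 3 in simp)
    then show ?case using 3 M.a_closed by blast
  next
    case (4 a x)
    have "{i\<in>I. (a \<odot>\<^bsub>prod_module I V\<^esub> x) i \<noteq> \<zero>\<^bsub>V i\<^esub>} \<subseteq> {i\<in>I. x i \<noteq> \<zero>\<^bsub>V i\<^esub>}"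
      using left_module.smult_r_null[OF V] 4(1) by (auto simp: prod_module_def)
    then have "finite {i\<in>I. (a \<odot>\<^bsub>prod_module I V\<^esub> x) i \<noteq> \<zero>\<^bsub>V i\<^esub>}"
      by (rule finite_subset) (use 4 in simp)
    then show ?case using 4 smult_closed by blast
  qed
qed

lemma direct_sum_simps:
  "f \<in> carrier (direct_sum I V) \<longleftrightarrow> f \<in> (\<Pi>\<^sub>E i\<in>I. carrier (V i)) \<and> finite {i\<in>I. f i \<noteq> \<zero>\<^bsub>V i\<^esub>}"
  "zero (direct_sum I V) = (\<lambda>i\<in>I. \<zero>\<^bsub>V i\<^esub>)"
  "add (direct_sum I V) f g = (\<lambda>i\<in>I. f i \<oplus>\<^bsub>V i\<^esub> g i)"
  "smult (direct_sum I V) r f = (\<lambda>i\<in>I. r \<odot>\<^bsub>V i\<^esub> f i)"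
  by (simp_all add: direct_sum_def)

definition summand_incl :: "'i set \<Rightarrow> ('i \<Rightarrow> ('r, 'm) module) \<Rightarrow> 'i \<Rightarrow> 'm \<Rightarrow> 'i \<Rightarrow> 'm" where
  "summand_incl I V x a = (\<lambda>i\<in>I. if i = x then a else \<zero>\<^bsub>V i\<^esub>)"

lemma summand_incl_closed:
  assumes V: "\<And>i. i \<in> I \<Longrightarrow> left_module R (V i)" and a: "a \<in> carrier (V x)"
  shows "summand_incl I V x a \<in> carrier (direct_sum I V)"
proof -
  have z: "\<zero>\<^bsub>V i\<^esub> \<in> carrier (V i)" if "i \<in> I" for i
    using V[OF that] by (simp add: left_module_def abelian_group_def abelian_monoid.zero_closed)
  have "{i\<in>I. summand_incl I V x a i \<noteq> \<zero>\<^bsub>V i\<^esub>} \<subseteq> {x}" by (auto simp: summand_incl_def)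
  then have "finite {i\<in>I. summand_incl I V x a i \<noteq> \<zero>\<^bsub>V i\<^esub>}" by (rule finite_subset) simp
  then show ?thesis using z a by (auto simp: direct_sum_simps summand_incl_def)
qed

text \<open>Induction on the size of the support, splitting off one nonzero entry at a time.\<close>

lemma direct_sum_induct:
  assumes V: "\<And>i. i \<in> I \<Longrightarrow> left_module R (V i)" and f: "f \<in> carrier (direct_sum I V)"
    and zero: "P \<zero>\<^bsub>direct_sum I V\<^esub>"
    and add: "\<And>f x a. f \<in> carrier (direct_sum I V) \<Longrightarrow> P f \<Longrightarrow> x \<in> I \<Longrightarrow> a \<in> carrier (V x) \<Longrightarrow>
        P (f \<oplus>\<^bsub>direct_sum I V\<^esub> summand_incl I V x a)"
  shows "P f"
  using f
proof (induction "card {i\<in>I. f i \<noteq> \<zero>\<^bsub>V i\<^esub>}" arbitrary: f rule: less_induct)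
  case less
  let ?S = "\<lambda>f. {i\<in>I. f i \<noteq> \<zero>\<^bsub>V i\<^esub>}"
  have am: "abelian_monoid (V i)" if "i \<in> I" for i
    using V[OF that] by (simp add: left_module_def abelian_group_def)
  note [simp] = abelian_monoid.zero_closed[OF am] abelian_monoid.l_zero[OF am] abelian_monoid.r_zero[OF am]
  have f: "f \<in> (\<Pi>\<^sub>E i\<in>I. carrier (V i))" "finite (?S f)" using less(2) by (simp_all add: direct_sum_simps)
  show ?case
  proof (cases "?S f = {}")
    case True
    then have "f = \<zero>\<^bsub>direct_sum I V\<^esub>" using f(1) by (auto simp: direct_sum_simps PiE_iff extensional_def fun_eq_iff)
    then show ?thesis using zero by simp
  next
    case False
    then obtain x where x: "x \<in> I" "f x \<noteq> \<zero>\<^bsub>V x\<^esub>" by blast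
    let ?f = "\<lambda>i\<in>I. if i = x then \<zero>\<^bsub>V i\<^esub> else f i"
    have S: "?S ?f = ?S f - {x}" by auto
    have "finite (?S ?f)" unfolding S using f(2) by (rule finite_Diff)
    then have fc: "?f \<in> carrier (direct_sum I V)"
      using f(1) unfolding direct_sum_simps by auto
    have "card (?S ?f) < card (?S f)" unfolding S using x f(2) by (intro card_Diff1_less) auto
    then have "P ?f" using less(1) fc by blast
    moreover have "f x \<in> carrier (V x)" using f(1) x by auto
    ultimately have "P (?f \<oplus>\<^bsub>direct_sum I V\<^esub> summand_incl I V x (f x))" using add fc x(1) by blast
    moreover have "?f \<oplus>\<^bsub>direct_sum I V\<^esub> summand_incl I V x (f x) = f"
      using f(1) by (auto simp: direct_sum_simps summand_incl_def PiE_iff extensional_def fun_eq_iff)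
    ultimately show ?thesis by simp
  qed
qed

lemma (in left_module) finsum_smult:
  "finite S \<Longrightarrow> a \<in> carrier R \<Longrightarrow> (\<And>s. s \<in> S \<Longrightarrow> g s \<in> carrier M) \<Longrightarrow>
    a \<odot>\<^bsub>M\<^esub> (\<Oplus>\<^bsub>M\<^esub>s\<in>S. g s) = (\<Oplus>\<^bsub>M\<^esub>s\<in>S. a \<odot>\<^bsub>M\<^esub> g s)"
proof (induction S rule: finite_induct)
  case empty
  then show ?case by (simp add: smult_r_null)
next
  case (insert x S)
  have "(\<Oplus>\<^bsub>M\<^esub>s\<in>insert x S. g s) = g x \<oplus>\<^bsub>M\<^esub> (\<Oplus>\<^bsub>M\<^esub>s\<in>S. g s)"
    using insert by (intro M.finsum_insert) auto
  moreover have "(\<Oplus>\<^bsub>M\<^esub>s\<in>insert x S. a \<odot>\<^bsub>M\<^esub> g s) = a \<odot>\<^bsub>M\<^esub> g x \<oplus>\<^bsub>M\<^esub> (\<Oplus>\<^bsub>M\<^esub>s\<in>S. a \<odot>\<^bsub>M\<^esub> g s)"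
    using insert by (intro M.finsum_insert) (auto simp: smult_closed)
  moreover have "(\<Oplus>\<^bsub>M\<^esub>s\<in>S. g s) \<in> carrier M" using insert by (intro M.finsum_closed) auto
  ultimately show ?case using insert by (simp add: smult_r_distr)
qed

section \<open>Free modules on an arbitrary set of generators\<close>

context ring begin

lemma left_module_free: "left_module R (free_module R B)"
  unfolding free_module_def by (rule left_module_direct_sum[OF ring_axioms left_module_regular])

definition free_single :: "'x set \<Rightarrow> 'x \<Rightarrow> 'a \<Rightarrow> 'x \<Rightarrow> 'a" where
  "free_single B x a = (\<lambda>y\<in>B. if y = x then a else \<zero>)"

lemma free_simps:
  "f \<in> carrier (free_module R B) \<longleftrightarrow> f \<in> B \<rightarrow>\<^sub>E carrier R \<and> finite {x\<in>B. f x \<noteq> \<zero>}"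
  "zero (free_module R B) = (\<lambda>x\<in>B. \<zero>)"
  "add (free_module R B) f g = (\<lambda>x\<in>B. f x \<oplus> g x)"
  "smult (free_module R B) r f = (\<lambda>x\<in>B. r \<otimes> f x)"
  by (simp_all add: free_module_def direct_sum_simps)

lemma summand_incl_regular: "summand_incl B (\<lambda>_. regular_module R) = free_single B"
  by (simp add: fun_eq_iff summand_incl_def free_single_def)

lemma free_single_closed: "a \<in> carrier R \<Longrightarrow> free_single B x a \<in> carrier (free_module R B)"
  using summand_incl_closed[OF left_module_regular, of a B x] by (simp add: summand_incl_regular free_module_def)

lemma free_induct:
  assumes "f \<in> carrier (free_module R B)" "P \<zero>\<^bsub>free_module R B\<^esub>"
    and "\<And>f x a. f \<in> carrier (free_module R B) \<Longrightarrow> P f \<Longrightarrow> x \<in> B \<Longrightarrow> a \<in> carrier R \<Longrightarrow>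
        P (f \<oplus>\<^bsub>free_module R B\<^esub> free_single B x a)"
  shows "P f"
  using assms direct_sum_induct[of B R "\<lambda>_. regular_module R" f P, OF left_module_regular]
  by (simp add: summand_incl_regular free_module_def)

lemma free_lift_superset:
  assumes "left_module R M" and v: "\<And>x. x \<in> B \<Longrightarrow> v x \<in> carrier M" and f: "f \<in> carrier (free_module R B)"
    and S: "finite S" "S \<subseteq> B" "\<And>x. x \<in> B \<Longrightarrow> x \<notin> S \<Longrightarrow> f x = \<zero>"
  shows "free_lift R B M v f = (\<Oplus>\<^bsub>M\<^esub>x\<in>S. f x \<odot>\<^bsub>M\<^esub> v x)"
proof -
  interpret M: left_module R M by fact
  have fx: "f x \<in> carrier R" if "x \<in> B" for x using f that by (auto simp: free_simps)
  have "{x\<in>B. f x \<noteq> \<zero>} \<subseteq> S" using S(3) by blast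
  then have "(\<Oplus>\<^bsub>M\<^esub>x\<in>{x\<in>B. f x \<noteq> \<zero>}. f x \<odot>\<^bsub>M\<^esub> v x) = (\<Oplus>\<^bsub>M\<^esub>x\<in>S. f x \<odot>\<^bsub>M\<^esub> v x)"
    using S(1,2) v fx
    by (intro M.add.finprod_mono_neutral_cong_left) (auto simp: M.smult_l_null M.smult_closed subset_iff)
  then show ?thesis using f by (simp add: free_lift_def)
qed

lemma free_lift_linear:
  assumes M: "left_module R M" and v: "\<And>x. x \<in> B \<Longrightarrow> v x \<in> carrier M"
  shows "lin_on R (free_module R B) (carrier (free_module R B)) M (carrier M) (free_lift R B M v)"
proof (rule lin_onI)
  interpret M: left_module R M by fact
  interpret F: left_module R "free_module R B" by (rule left_module_free)
  fix f assume f: "f \<in> carrier (free_module R B)"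
  let ?S = "\<lambda>f. {x\<in>B. f x \<noteq> \<zero>}"
  have fx: "f x \<in> carrier R" if "x \<in> B" for x using f that by (auto simp: free_simps)
  have Sf: "finite (?S f)" using f by (simp add: free_simps)
  show "free_lift R B M v f \<in> carrier M"
    using free_lift_superset[OF M v f Sf] fx v by (auto intro!: M.finsum_closed simp: M.smult_closed)
  {
    fix g assume g: "g \<in> carrier (free_module R B)"
    have gx: "g x \<in> carrier R" if "x \<in> B" for x using g that by (auto simp: free_simps)
    let ?T = "?S f \<union> ?S g"
    have T: "finite ?T" "?T \<subseteq> B" using Sf g by (auto simp: free_simps)
    have "free_lift R B M v (f \<oplus>\<^bsub>free_module R B\<^esub> g) = (\<Oplus>\<^bsub>M\<^esub>x\<in>?T. (f \<oplus>\<^bsub>free_module R B\<^esub> g) x \<odot>\<^bsub>M\<^esub> v x)"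
      by (rule free_lift_superset[OF M v F.M.a_closed[OF f g] T]) (auto simp: free_simps)
    also have "\<dots> = (\<Oplus>\<^bsub>M\<^esub>x\<in>?T. f x \<odot>\<^bsub>M\<^esub> v x \<oplus>\<^bsub>M\<^esub> g x \<odot>\<^bsub>M\<^esub> v x)"
      using fx gx v by (intro M.finsum_cong') (auto simp: free_simps M.smult_l_distr M.smult_closed)
    also have "\<dots> = (\<Oplus>\<^bsub>M\<^esub>x\<in>?T. f x \<odot>\<^bsub>M\<^esub> v x) \<oplus>\<^bsub>M\<^esub> (\<Oplus>\<^bsub>M\<^esub>x\<in>?T. g x \<odot>\<^bsub>M\<^esub> v x)"
      using fx gx v by (intro M.finsum_addf) (auto simp: M.smult_closed)
    also have "\<dots> = free_lift R B M v f \<oplus>\<^bsub>M\<^esub> free_lift R B M v g"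
      using free_lift_superset[OF M v f T] free_lift_superset[OF M v g T] by auto
    finally show "free_lift R B M v (f \<oplus>\<^bsub>free_module R B\<^esub> g) = free_lift R B M v f \<oplus>\<^bsub>M\<^esub> free_lift R B M v g" .
  }
  fix a assume a: "a \<in> carrier R"
  have "free_lift R B M v (a \<odot>\<^bsub>free_module R B\<^esub> f) = (\<Oplus>\<^bsub>M\<^esub>x\<in>?S f. (a \<odot>\<^bsub>free_module R B\<^esub> f) x \<odot>\<^bsub>M\<^esub> v x)"
    using a by (intro free_lift_superset[OF M v F.smult_closed[OF a f] Sf]) (auto simp: free_simps)
  also have "\<dots> = (\<Oplus>\<^bsub>M\<^esub>x\<in>?S f. a \<odot>\<^bsub>M\<^esub> (f x \<odot>\<^bsub>M\<^esub> v x))"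
    using a fx v by (intro M.finsum_cong') (auto simp: free_simps M.smult_assoc M.smult_closed)
  also have "\<dots> = a \<odot>\<^bsub>M\<^esub> (\<Oplus>\<^bsub>M\<^esub>x\<in>?S f. f x \<odot>\<^bsub>M\<^esub> v x)"
    using Sf a fx v by (subst M.finsum_smult) (auto simp: M.smult_closed)
  also have "(\<Oplus>\<^bsub>M\<^esub>x\<in>?S f. f x \<odot>\<^bsub>M\<^esub> v x) = free_lift R B M v f"
    using free_lift_superset[OF M v f Sf] by auto
  finally show "free_lift R B M v (a \<odot>\<^bsub>free_module R B\<^esub> f) = a \<odot>\<^bsub>M\<^esub> free_lift R B M v f" .
qed

lemma free_lift_single:
  assumes M: "left_module R M" and v: "\<And>x. x \<in> B \<Longrightarrow> v x \<in> carrier M" and x: "x \<in> B" and a: "a \<in> carrier R"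
  shows "free_lift R B M v (free_single B x a) = a \<odot>\<^bsub>M\<^esub> v x"
proof -
  interpret M: left_module R M by fact
  have "free_lift R B M v (free_single B x a) = (\<Oplus>\<^bsub>M\<^esub>y\<in>{x}. free_single B x a y \<odot>\<^bsub>M\<^esub> v y)"
    using x by (intro free_lift_superset[OF M v free_single_closed[OF a]]) (auto simp: free_single_def)
  also have "\<dots> = a \<odot>\<^bsub>M\<^esub> v x"
    using x a v by (subst M.finsum_insert) (auto simp: free_single_def M.smult_closed)
  finally show ?thesis .
qed

lemma free_single_smult:
  "x \<in> B \<Longrightarrow> a \<in> carrier R \<Longrightarrow> free_single B x a = a \<odot>\<^bsub>free_module R B\<^esub> free_single B x \<one>"
  by (auto simp: free_single_def free_simps)

text \<open>The terms of the standard resolution are free on infinite sets, beyond the reach of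
  \<open>lifts_fr\<close>. Preimages of all basis elements are chosen at once, and induction along
  supports takes the place of induction over the rank.\<close>

lemma lifts_free:
  fixes N :: "('a, 'n) module"
  assumes N: "left_module R N" and Q: "left_module R Q" and Y: "submodule Y R N" and W: "submodule W R Q"
    and d: "lin_on R N Y Q W d" and onto: "\<And>w. w \<in> W \<Longrightarrow> \<exists>y\<in>Y. d y = w"
  shows "lifts R (free_module R B) (carrier (free_module R B)) N Y Q W d"
  unfolding lifts_def
proof (intro allI impI)
  let ?F = "free_module R B"
  interpret N: left_module R N by fact
  interpret Q: left_module R Q by fact
  interpret F: left_module R ?F by (rule left_module_free)
  fix q assume q: "lin_on R ?F (carrier ?F) Q W q"
  have "\<forall>x. \<exists>y. y \<in> Y \<and> d y = q (free_single B x \<one>)"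
    using onto lin_on_mem[OF q free_single_closed[OF one_closed]] by blast
  then obtain v where v: "\<And>x. v x \<in> Y" "\<And>x. d (v x) = q (free_single B x \<one>)" by metis
  have vc: "v x \<in> carrier N" for x using N.submod_carrier[OF Y v(1)] .
  let ?p = "free_lift R B N v"
  have p: "lin_on R ?F (carrier ?F) N (carrier N) ?p" by (rule free_lift_linear[OF N vc])
  have single: "?p (free_single B x a) \<in> Y" "d (?p (free_single B x a)) = q (free_single B x a)"
    if x: "x \<in> B" and a: "a \<in> carrier R" for x a
  proof -
    have e: "?p (free_single B x a) = a \<odot>\<^bsub>N\<^esub> v x" by (rule free_lift_single[OF N vc x a])
    then show "?p (free_single B x a) \<in> Y" using N.submod_smult[OF Y a v(1)] by simp
    have "d (?p (free_single B x a)) = a \<odot>\<^bsub>Q\<^esub> q (free_single B x \<one>)"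
      unfolding e lin_on_smult[OF d a v(1)] v(2) ..
    also have "\<dots> = q (a \<odot>\<^bsub>free_module R B\<^esub> free_single B x \<one>)"
      by (rule lin_on_smult[OF q a free_single_closed[OF one_closed], symmetric])
    finally show "d (?p (free_single B x a)) = q (free_single B x a)"
      unfolding free_single_smult[OF x a, symmetric] .
  qed
  have pq: "?p f \<in> Y \<and> d (?p f) = q f" if "f \<in> carrier ?F" for f
    using that
  proof (rule free_induct)
    have "?p \<zero>\<^bsub>?F\<^esub> = \<zero>\<^bsub>N\<^esub>"
      by (rule lin_on_zero[OF left_module_free N F.submod_carrier_self N.submod_carrier_self p])
    moreover have "q \<zero>\<^bsub>?F\<^esub> = \<zero>\<^bsub>Q\<^esub>" by (rule lin_on_zero[OF left_module_free Q F.submod_carrier_self W q])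
    ultimately show "?p \<zero>\<^bsub>?F\<^esub> \<in> Y \<and> d (?p \<zero>\<^bsub>?F\<^esub>) = q \<zero>\<^bsub>?F\<^esub>"
      using N.submod_zero[OF Y] lin_on_zero[OF N Q Y W d] by simp
    fix f x a assume f: "f \<in> carrier ?F" "?p f \<in> Y \<and> d (?p f) = q f" and x: "x \<in> B" and a: "a \<in> carrier R"
    note s = single[OF x a] free_single_closed[OF a, of B x]
    show "?p (f \<oplus>\<^bsub>?F\<^esub> free_single B x a) \<in> Y \<and> d (?p (f \<oplus>\<^bsub>?F\<^esub> free_single B x a)) = q (f \<oplus>\<^bsub>?F\<^esub> free_single B x a)"
      using f s lin_on_add[OF p f(1) s(3)] lin_on_add[OF q f(1) s(3)] lin_on_add[OF d _ s(1)] N.submod_add[OF Y _ s(1)]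
      by simp
  qed
  have "lin_on R ?F (carrier ?F) N Y ?p" by (rule lin_on_subset[OF p subset_refl]) (use pq in blast)
  then show "\<exists>p. lin_on R ?F (carrier ?F) N Y p \<and> (\<forall>x\<in>carrier ?F. d (p x) = q x)" using pq by blast
qed

lemma ex_comb_value:
  assumes f: "f \<in> carrier (free_module R B)"
  shows "\<exists>S. fset S \<subseteq> B \<times> carrier R \<and> comb_value R B S = f"
proof -
  \<comment> \<open>The graph of \<open>f\<close> on its support: a generator occurs in at most one
    pair, so each sum in \<open>comb_value\<close> has at most one term.\<close>
  let ?X = "(\<lambda>x. (x, f x)) ` {x\<in>B. f x \<noteq> \<zero>}"
  have "finite ?X" using f by (simp add: free_simps)
  then have "fset (Abs_fset ?X) = ?X" by (intro Abs_fset_inverse) simp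
  then obtain S where S: "fset S = ?X" by blast
  have "fset S \<subseteq> B \<times> carrier R" unfolding S using f by (auto simp: free_simps)
  moreover have "comb_value R B S = f"
  proof
    fix x
    show "comb_value R B S x = f x"
    proof (cases "x \<in> B")
      case True
      then have fx: "f x \<in> carrier R" using f by (auto simp: free_simps)
      have "{a. (x, a) \<in> fset S} = (if f x = \<zero> then {} else {f x})" using True by (auto simp: S)
      then show ?thesis using True fx by (auto simp: comb_value_def)
    next
      case False
      then show ?thesis using f by (auto simp: comb_value_def free_simps)
    qed
  qed
  ultimately show ?thesis by blast
qed

end

section \<open>Homogeneous parts in graded free modules\<close>

context graded begin

text \<open>Components indexed by integers, since generators have integer degrees and
  \<open>j - gen_degree x\<close> can be negative.\<close>

definition hz :: "'a \<Rightarrow> int \<Rightarrow> 'a" where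
  "hz a i = (if i < 0 then \<zero> else hc a (nat i))"

lemma hz_int_grading: "a \<in> carrier A \<Longrightarrow> hz a i \<in> int_grading A G i"
  by (simp add: hz_def int_grading_def)

lemma int_grading_carrier: "a \<in> int_grading A G i \<Longrightarrow> a \<in> carrier A"
  using G_carrier by (auto simp: int_grading_def split: if_splits)

lemma hz_carrier [simp]: "a \<in> carrier A \<Longrightarrow> hz a i \<in> carrier A"
  using hz_int_grading int_grading_carrier by blast

lemma hz_zero [simp]: "hz \<zero> i = \<zero>"
  by (simp add: hz_def)

lemma hz_add: "a \<in> carrier A \<Longrightarrow> b \<in> carrier A \<Longrightarrow> hz (a \<oplus> b) i = hz a i \<oplus> hz b i"
  by (simp add: hz_def hc_add)

lemma hz_mult_right:
  assumes "x \<in> carrier A" "b \<in> int_grading A G j"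
  shows "hz (x \<otimes> b) i = hz x (i - j) \<otimes> b"
proof (cases "j < 0")
  case True
  then show ?thesis using assms by (simp add: int_grading_def)
next
  case False
  then have b: "b \<in> G (nat j)" using assms(2) by (simp add: int_grading_def)
  have "nat (i - j) = nat i - nat j" using False by simp
  then show ?thesis
    using False hc_mult_right[OF assms(1) b, of "nat i"] G_carrier[OF b] by (auto simp: hz_def nat_le_iff le_nat_iff)
qed

text \<open>The projection to degree \<open>j\<close> for the grading of the free module that gives
  the basis element \<open>x\<close> the degree \<open>gen_degree x\<close>.\<close>

definition part :: "('a, 'm) gen set \<Rightarrow> int \<Rightarrow> (('a, 'm) gen \<Rightarrow> 'a) \<Rightarrow> ('a, 'm) gen \<Rightarrow> 'a" where
  "part B j f = (\<lambda>x\<in>B. hz (f x) (j - gen_degree x))"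

lemma free_val: "f \<in> carrier (free_module A B) \<Longrightarrow> x \<in> B \<Longrightarrow> f x \<in> carrier A"
  by (auto simp: free_simps)

lemma part_closed:
  assumes "f \<in> carrier (free_module A B)"
  shows "part B j f \<in> free_degree_part A G B j" "part B j f \<in> carrier (free_module A B)"
proof -
  have "{x \<in> B. part B j f x \<noteq> \<zero>} \<subseteq> {x \<in> B. f x \<noteq> \<zero>}" by (auto simp: part_def)
  then have "finite {x \<in> B. part B j f x \<noteq> \<zero>}" by (rule finite_subset) (use assms in \<open>simp add: free_simps\<close>)
  then show 1: "part B j f \<in> carrier (free_module A B)"
    using free_val[OF assms] by (auto simp: free_simps part_def)
  then show "part B j f \<in> free_degree_part A G B j"
    using free_val[OF assms] hz_int_grading by (auto simp: free_degree_part_def part_def)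
qed

lemma part_add:
  assumes "f \<in> carrier (free_module A B)" "g \<in> carrier (free_module A B)"
  shows "part B j (f \<oplus>\<^bsub>free_module A B\<^esub> g) = part B j f \<oplus>\<^bsub>free_module A B\<^esub> part B j g"
  using free_val[OF assms(1)] free_val[OF assms(2)] by (auto simp: part_def free_simps hz_add)

lemma part_zero: "part B j \<zero>\<^bsub>free_module A B\<^esub> = \<zero>\<^bsub>free_module A B\<^esub>"
  by (auto simp: part_def free_simps)

lemma part_single: "x \<in> B \<Longrightarrow> part B j (free_single B x a) = free_single B x (hz a (j - gen_degree x))"
  by (auto simp: part_def free_single_def)

lemma part_smult:
  assumes "a \<in> carrier A" "v \<in> free_degree_part A G B t"
  shows "part B j (a \<odot>\<^bsub>free_module A B\<^esub> v) = hz a (j - t) \<odot>\<^bsub>free_module A B\<^esub> v"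
proof -
  have "hz (a \<otimes> v x) (j - gen_degree x) = hz a (j - t) \<otimes> v x" if "x \<in> B" for x
    using hz_mult_right[OF assms(1), of "v x" "t - gen_degree x" "j - gen_degree x"] assms(2) that
    by (simp add: free_degree_part_def algebra_simps)
  then show ?thesis by (auto simp: part_def free_simps)
qed

text \<open>\<open>v\<close> preserves the degrees of generators, so its linear extension is
  homogeneous of degree 0 and commutes with the projections to parts.\<close>

lemma part_free_lift:
  assumes v: "\<And>x. x \<in> B' \<Longrightarrow> v x \<in> free_degree_part A G B (gen_degree x)"
    and f: "f \<in> carrier (free_module A B')"
  shows "free_lift A B' (free_module A B) v (part B' j f) = part B j (free_lift A B' (free_module A B) v f)"
proof -
  let ?F = "free_module A B" and ?F' = "free_module A B'"
  let ?d = "free_lift A B' ?F v"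
  interpret F: left_module A ?F by (rule left_module_free)
  interpret F': left_module A ?F' by (rule left_module_free)
  have vc: "v x \<in> carrier ?F" if "x \<in> B'" for x using v[OF that] by (simp add: free_degree_part_def)
  have d: "lin_on A ?F' (carrier ?F') ?F (carrier ?F) ?d" by (rule free_lift_linear[OF left_module_free vc])
  have d0: "?d \<zero>\<^bsub>?F'\<^esub> = \<zero>\<^bsub>?F\<^esub>"
    by (rule lin_on_zero[OF left_module_free left_module_free F'.submod_carrier_self F.submod_carrier_self d])
  show ?thesis using f
  proof (rule free_induct)
    show "?d (part B' j \<zero>\<^bsub>?F'\<^esub>) = part B j (?d \<zero>\<^bsub>?F'\<^esub>)" by (simp add: part_zero d0)
    fix f x a assume f: "f \<in> carrier ?F'" "?d (part B' j f) = part B j (?d f)" and x: "x \<in> B'" and a: "a \<in> carrier A"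
    have s: "free_single B' x a \<in> carrier ?F'" using a by (rule free_single_closed)
    have "?d (part B' j (f \<oplus>\<^bsub>?F'\<^esub> free_single B' x a)) = ?d (part B' j f) \<oplus>\<^bsub>?F\<^esub> ?d (part B' j (free_single B' x a))"
      unfolding part_add[OF f(1) s] by (rule lin_on_add[OF d part_closed(2)[OF f(1)] part_closed(2)[OF s]])
    also have "?d (part B' j (free_single B' x a)) = hz a (j - gen_degree x) \<odot>\<^bsub>?F\<^esub> v x"
      unfolding part_single[OF x] by (rule free_lift_single[OF left_module_free vc x hz_carrier[OF a]])
    also have "\<dots> = part B j (a \<odot>\<^bsub>?F\<^esub> v x)" by (rule part_smult[OF a v[OF x], symmetric])
    also have "a \<odot>\<^bsub>?F\<^esub> v x = ?d (free_single B' x a)" by (rule free_lift_single[OF left_module_free vc x a, symmetric])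
    also have "?d (part B' j f) = part B j (?d f)" by (rule f(2))
    also have "part B j (?d f) \<oplus>\<^bsub>?F\<^esub> part B j (?d (free_single B' x a)) = part B j (?d (f \<oplus>\<^bsub>?F'\<^esub> free_single B' x a))"
      unfolding lin_on_add[OF d f(1) s] by (rule part_add[OF lin_on_mem[OF d f(1)] lin_on_mem[OF d s], symmetric])
    finally show "?d (part B' j (f \<oplus>\<^bsub>?F'\<^esub> free_single B' x a)) = part B j (?d (f \<oplus>\<^bsub>?F'\<^esub> free_single B' x a))" .
  qed
qed

lemma hz_hz: "a \<in> carrier A \<Longrightarrow> hz (hz a i) k = (if k = i then hz a i else \<zero>)"
  by (auto simp: hz_def hc_homogeneous[OF hc_G] eq_nat_nat_iff)

lemma part_part:
  assumes "f \<in> carrier (free_module A B)"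
  shows "part B i (part B j f) = (if i = j then part B j f else \<zero>\<^bsub>free_module A B\<^esub>)"
  using free_val[OF assms] by (auto simp: part_def free_simps hz_hz)

lemma finite_parts:
  assumes "f \<in> carrier (free_module A B)"
  shows "finite {j. part B j f \<noteq> \<zero>\<^bsub>free_module A B\<^esub>}"
proof -
  let ?S = "{x\<in>B. f x \<noteq> \<zero>}"
  let ?T = "\<Union>x\<in>?S. (\<lambda>i. int i + gen_degree x) ` {i. hc (f x) i \<noteq> \<zero>}"
  have "{j. part B j f \<noteq> \<zero>\<^bsub>free_module A B\<^esub>} \<subseteq> ?T"
  proof
    fix j assume "j \<in> {j. part B j f \<noteq> \<zero>\<^bsub>free_module A B\<^esub>}"
    then obtain x where x: "x \<in> B" "hz (f x) (j - gen_degree x) \<noteq> \<zero>"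
      by (auto simp: part_def free_simps fun_eq_iff restrict_def split: if_splits)
    then have "f x \<noteq> \<zero>" by auto
    moreover have "hc (f x) (nat (j - gen_degree x)) \<noteq> \<zero>" "j - gen_degree x \<ge> 0"
      using x(2) by (auto simp: hz_def split: if_splits)
    ultimately show "j \<in> ?T" using x(1)
      by (intro UN_I[of x]) (auto intro!: image_eqI[of _ _ "nat (j - gen_degree x)"])
  qed
  moreover have "finite ?T"
    using assms free_val[OF assms] hc_components
    by (intro finite_UN_I finite_imageI) (auto simp: free_simps homogeneous_components_def)
  ultimately show ?thesis by (rule finite_subset)
qed

text \<open>\<open>f\<close> is the sum of its finitely many nonzero parts, which are split off one
  by one. This reduces exactness of the standard resolution to homogeneous cycles, the only ones
  that are boundaries of generators by construction.\<close>

lemma mem_of_parts: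
  assumes H: "submodule H A (free_module A B)" and "f \<in> carrier (free_module A B)" "\<And>j. part B j f \<in> H"
  shows "f \<in> H"
  using assms(2,3)
proof (induction "card {j. part B j f \<noteq> \<zero>\<^bsub>free_module A B\<^esub>}" arbitrary: f rule: less_induct)
  case less
  let ?F = "free_module A B"
  interpret F: left_module A ?F by (rule left_module_free)
  show ?case
  proof (cases "\<exists>j. part B j f \<noteq> \<zero>\<^bsub>?F\<^esub>")
    case True
    then obtain j where j: "part B j f \<noteq> \<zero>\<^bsub>?F\<^esub>" by blast
    let ?g = "f \<ominus>\<^bsub>?F\<^esub> part B j f"
    have pc: "part B i f \<in> carrier ?F" for i using part_closed(2)[OF less(2)] .
    have g: "?g \<in> carrier ?F" using less(2) pc by simp
    have fg: "part B j f \<oplus>\<^bsub>?F\<^esub> ?g = f" using F.add_minus_cancel[OF less(2) pc] .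
    have gi: "part B i ?g = (if i = j then \<zero>\<^bsub>?F\<^esub> else part B i f)" for i
    proof -
      have e: "part B i f = part B i (part B j f) \<oplus>\<^bsub>?F\<^esub> part B i ?g"
        using part_add[OF pc[of j] g, of i] fg by simp
      have gc: "part B i ?g \<in> carrier ?F" using part_closed(2)[OF g] .
      show ?thesis
      proof (cases "i = j")
        case True
        then show ?thesis using e gc pc part_part[OF less(2), of j j] by (simp add: F.M.add.r_cancel_one')
      next
        case False
        then show ?thesis using e gc part_part[OF less(2), of i j] by simp
      qed
    qed
    have "{i. part B i ?g \<noteq> \<zero>\<^bsub>?F\<^esub>} = {i. part B i f \<noteq> \<zero>\<^bsub>?F\<^esub>} - {j}" by (auto simp: gi)
    then have "card {i. part B i ?g \<noteq> \<zero>\<^bsub>?F\<^esub>} < card {i. part B i f \<noteq> \<zero>\<^bsub>?F\<^esub>}"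
      using j finite_parts[OF less(2)] by (simp only:) (intro card_Diff1_less, auto)
    moreover have "part B i ?g \<in> H" for i using less(3) F.submod_zero[OF H] by (simp add: gi)
    ultimately have "?g \<in> H" using less(1) g by blast
    then show ?thesis using F.submod_add[OF H less(3)[of j]] fg by metis
  next
    case False
    have "f x = \<zero>" if x: "x \<in> B" for x
    proof -
      have fx: "f x \<in> carrier A" using free_val[OF less(2) x] .
      have "hc (f x) i = \<zero>" for i
      proof -
        have "part B (int i + gen_degree x) f x = \<zero>\<^bsub>?F\<^esub> x" using False by simp
        then show ?thesis using x by (simp add: part_def free_simps hz_def)
      qed
      then show ?thesis using hc_components[OF fx] by (simp add: homogeneous_components_def)
    qed
    then have "f = \<zero>\<^bsub>?F\<^esub>" using less(2) by (auto simp: free_simps PiE_iff extensional_def fun_eq_iff)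
    then show ?thesis using F.submod_zero[OF H] by simp
  qed
qed

end

section \<open>The standard resolution\<close>

lemma (in ring) lin_fr_zero:
  assumes "left_module R N" "submodule Y R N"
  shows "lin_on R (seqs R) (fr R k) N Y q \<Longrightarrow>
    (\<And>i. i < k \<Longrightarrow> q (\<lambda>j. if j = i then \<one> else \<zero>) = \<zero>\<^bsub>N\<^esub>) \<Longrightarrow> c \<in> fr R k \<Longrightarrow> q c = \<zero>\<^bsub>N\<^esub>"
proof (induction k arbitrary: c)
  case 0
  then show ?case using lin_on_zero[OF left_module_seqs assms(1) submod_fr assms(2) 0(1)] by (simp add: fr_0)
next
  case (Suc k)
  interpret N: left_module R N by fact
  let ?e = "\<lambda>j. if j = k then \<one> else \<zero>"
  note d = fr_decomp[OF Suc(4)]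
  have "lin_on R (seqs R) (fr R k) N Y q"
    using Suc(2) by (rule lin_on_subset) (use fr_mono[of k "Suc k"] lin_on_mem[OF Suc(2)] in auto)
  then have "q (c(k := \<zero>)) = \<zero>\<^bsub>N\<^esub>" by (intro Suc(1)[OF _ _ d(1)]) (use Suc(3) in auto)
  moreover have "q c = q (c(k := \<zero>)) \<oplus>\<^bsub>N\<^esub> c k \<odot>\<^bsub>N\<^esub> q ?e"
    by (subst d(4), subst lin_on_add[OF Suc(2)])
      (use d fr_mono[of k "Suc k"] in \<open>auto simp: lin_on_smult[OF Suc(2)] V.submod_smult[OF submod_fr]\<close>)
  ultimately show ?case using Suc(3)[of k] d(2) by (simp add: N.smult_r_null)
qed

context graded begin

abbreviation "T \<equiv> trivial_module A G"
abbreviation "TG \<equiv> trivial_grading A G"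

text \<open>Short names for the standard resolution of k. \<open>cyc n\<close> is the kernel of the
  map leaving \<open>Fr n\<close>; for \<open>n = 0\<close> that map goes to
  \<open>T\<close>.\<close>

definition "gens n = std_gens A G T TG n"
definition "cyc n = snd (std_resolution A G T TG n)"
definition "Fr n = free_module A (gens n)"
definition "dif n = free_lift A (gens (Suc n)) (Fr n) (gen_boundary A (gens n))"

lemma std_term_eq: "std_term A G T TG n = Fr n"
  by (simp add: std_term_def Fr_def gens_def)

lemma std_diff_eq: "std_diff A G T TG n = dif n"
  by (simp add: std_diff_def dif_def std_term_eq gens_def)

lemma gens_0: "gens 0 = {Elt j t | j t. t \<in> TG j}"
  by (simp add: gens_def std_gens_def Let_def)

lemma cyc_0: "cyc 0 = {f \<in> carrier (Fr 0). free_lift A (gens 0) T gen_elt f = \<zero>\<^bsub>T\<^esub>}"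
  unfolding Fr_def gens_0 by (simp add: cyc_def Let_def)

lemma gens_Suc: "gens (Suc n) = {Comb j S | j S. fset S \<subseteq> gens n \<times> carrier A \<and>
    comb_value A (gens n) S \<in> cyc n \<inter> free_degree_part A G (gens n) j}"
  by (simp add: gens_def std_gens_def cyc_def Let_def split_beta)

lemma cyc_Suc: "cyc (Suc n) = {f \<in> carrier (Fr (Suc n)). dif n f = \<zero>\<^bsub>Fr n\<^esub>}"
  unfolding Fr_def dif_def gens_Suc by (simp add: gens_def std_gens_def cyc_def Let_def split_beta)

lemma left_module_Fr: "left_module A (Fr n)"
  unfolding Fr_def by (rule left_module_free)

sublocale Fr: left_module A "Fr n" for n by (rule left_module_Fr)
sublocale T: left_module A T by (rule left_module_trivial)

lemma T_elem:
  assumes "t \<in> carrier T"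
  obtains x where "x \<in> carrier A" "t = aug_ideal A G +>\<^bsub>regular_module A\<^esub> x"
  using assms by (auto simp: trivial_module_def)

text \<open>The difference of \<open>a\<close> and \<open>hc a 0\<close> lies in the augmentation
  ideal, which kills \<open>T\<close>.\<close>

lemma T_smult:
  assumes a: "a \<in> carrier A" and t: "t \<in> carrier T"
  shows "a \<odot>\<^bsub>T\<^esub> t = hc a 0 \<odot>\<^bsub>T\<^esub> t"
proof -
  let ?M = "aug_ideal A G"
  interpret N: left_module A "regular_module A" by (rule left_module_regular)
  have sub: "submodule ?M A (regular_module A)" by (rule ring_ideal_submodule[OF ring_axioms ideal_aug])
  obtain x where x: "x \<in> carrier A" "t = ?M +>\<^bsub>regular_module A\<^esub> x" using T_elem[OF t] by blast
  have s: "b \<odot>\<^bsub>T\<^esub> t = ?M +>\<^bsub>regular_module A\<^esub> (b \<otimes> x)" if "b \<in> carrier A" for b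
    using quot_smult[OF left_module_regular sub, of x b] that x by (simp add: trivial_module_def)
  have "hc (a \<otimes> x \<oplus> \<ominus> (hc a 0 \<otimes> x)) 0 = hc a 0 \<otimes> hc x 0 \<oplus> \<ominus> (hc (hc a 0) 0 \<otimes> hc x 0)"
    using a x by (simp add: hc_add hc_neg hc_0_mult)
  also have "hc (hc a 0) 0 = hc a 0" using a by (simp add: hc_homogeneous[OF hc_G[OF a]])
  finally have m: "a \<otimes> x \<oplus> \<ominus> (hc a 0 \<otimes> x) \<in> ?M"
    using a x by (simp add: aug_ideal_iff r_neg)
  have "\<ominus>\<^bsub>regular_module A\<^esub> y = \<ominus> y" if "y \<in> carrier A" for y
    using that by (intro N.minus_equality) (simp_all add: l_neg)
  then show ?thesis
    unfolding s[OF a] s[OF hc_carrier[OF a]]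
    using N.coset_eq_iff[OF sub, of "a \<otimes> x" "hc a 0 \<otimes> x"] a x m by (simp add: a_minus_def)
qed

lemma TG_carrier: "t \<in> TG j \<Longrightarrow> t \<in> carrier T"
  using T.M.zero_closed by (auto simp: trivial_grading_def split: if_splits)

lemma aug_lift: "lin_on A (Fr 0) (carrier (Fr 0)) T (carrier T) (free_lift A (gens 0) T gen_elt)"
  unfolding Fr_def by (rule free_lift_linear[OF left_module_trivial]) (auto simp: gens_0 TG_carrier)

text \<open>\<open>T\<close> sits in degree 0 and \<open>A\<close> acts on it through
  \<open>hc a 0\<close>. A generator of nonzero degree is a formal copy of the zero of
  \<open>T\<close>, so both sides vanish on it.\<close>

lemma aug_lift_part:
  assumes "f \<in> carrier (Fr 0)"
  shows "free_lift A (gens 0) T gen_elt (part (gens 0) j f) =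
    (if j = 0 then free_lift A (gens 0) T gen_elt f else \<zero>\<^bsub>T\<^esub>)"
  using assms unfolding Fr_def
proof (rule free_induct)
  let ?F = "free_module A (gens 0)" and ?\<epsilon> = "free_lift A (gens 0) T gen_elt"
  have vc: "gen_elt x \<in> carrier T" if "x \<in> gens 0" for x using that by (auto simp: gens_0 TG_carrier)
  note lin = aug_lift[unfolded Fr_def]
  have "?\<epsilon> \<zero>\<^bsub>?F\<^esub> = \<zero>\<^bsub>T\<^esub>"
    using lin_on_zero[OF left_module_Fr left_module_trivial Fr.submod_carrier_self T.submod_carrier_self aug_lift]
    by (simp add: Fr_def)
  then show "?\<epsilon> (part (gens 0) j \<zero>\<^bsub>?F\<^esub>) = (if j = 0 then ?\<epsilon> \<zero>\<^bsub>?F\<^esub> else \<zero>\<^bsub>T\<^esub>)" by (simp add: part_zero)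
  fix f x a assume f: "f \<in> carrier ?F" "?\<epsilon> (part (gens 0) j f) = (if j = 0 then ?\<epsilon> f else \<zero>\<^bsub>T\<^esub>)"
    and x: "x \<in> gens 0" and a: "a \<in> carrier A"
  have s: "free_single (gens 0) x a \<in> carrier ?F" using a by (rule free_single_closed)
  have t: "gen_elt x \<in> TG (gen_degree x)" using x by (auto simp: gens_0)
  have tc: "gen_elt x \<in> carrier T" using vc[OF x] .
  have "hz a (j - gen_degree x) \<odot>\<^bsub>T\<^esub> gen_elt x = (if j = 0 then a \<odot>\<^bsub>T\<^esub> gen_elt x else \<zero>\<^bsub>T\<^esub>)"
  proof (cases "gen_degree x = 0")
    case True
    have "hc (hc a i) 0 = (if i = 0 then hc a 0 else \<zero>)" for i by (simp add: hc_homogeneous[OF hc_G[OF a]])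
    then show ?thesis
      using True T_smult[OF hz_carrier[OF a] tc, of j] T_smult[OF a tc] T.smult_l_null[OF tc]
      by (auto simp: hz_def)
  next
    case False
    then have "gen_elt x = \<zero>\<^bsub>T\<^esub>" using t by (simp add: trivial_grading_def)
    then show ?thesis using a by (simp add: T.smult_r_null)
  qed
  then have "?\<epsilon> (part (gens 0) j (free_single (gens 0) x a)) = (if j = 0 then ?\<epsilon> (free_single (gens 0) x a) else \<zero>\<^bsub>T\<^esub>)"
    unfolding part_single[OF x] using free_lift_single[OF left_module_trivial vc x] a by simp
  then show "?\<epsilon> (part (gens 0) j (f \<oplus>\<^bsub>?F\<^esub> free_single (gens 0) x a)) =
      (if j = 0 then ?\<epsilon> (f \<oplus>\<^bsub>?F\<^esub> free_single (gens 0) x a) else \<zero>\<^bsub>T\<^esub>)"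
    unfolding part_add[OF f(1) s] lin_on_add[OF lin part_closed(2)[OF f(1)] part_closed(2)[OF s]]
      lin_on_add[OF lin f(1) s] using f(2) by simp
qed

lemma gen_boundary_closed:
  "x \<in> gens (Suc n) \<Longrightarrow> gen_boundary A (gens n) x \<in> cyc n \<inter> free_degree_part A G (gens n) (gen_degree x)"
  by (auto simp: gens_Suc)

lemma gen_boundary_carrier: "x \<in> gens (Suc n) \<Longrightarrow> gen_boundary A (gens n) x \<in> carrier (Fr n)"
  using gen_boundary_closed[of x n] by (auto simp: Fr_def free_degree_part_def)

lemma dif_linear: "lin_on A (Fr (Suc n)) (carrier (Fr (Suc n))) (Fr n) (carrier (Fr n)) (dif n)"
  unfolding dif_def using gen_boundary_carrier
  by (subst (1 2) Fr_def) (rule free_lift_linear[OF left_module_Fr])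

lemma dif_single: "x \<in> gens (Suc n) \<Longrightarrow> a \<in> carrier A \<Longrightarrow>
    dif n (free_single (gens (Suc n)) x a) = a \<odot>\<^bsub>Fr n\<^esub> gen_boundary A (gens n) x"
  unfolding dif_def by (rule free_lift_single[OF left_module_Fr gen_boundary_carrier])

lemma cyc_submodule: "submodule (cyc n) A (Fr n)"
proof (cases n)
  case 0
  show ?thesis unfolding 0 cyc_0
    using submod_vimage[OF left_module_Fr left_module_trivial Fr.submod_carrier_self T.submod_carrier_self T.submod_null aug_lift]
    by simp
next
  case (Suc n)
  show ?thesis unfolding Suc cyc_Suc
    using submod_vimage[OF left_module_Fr left_module_Fr Fr.submod_carrier_self Fr.submod_carrier_self Fr.submod_null dif_linear]
    by simp
qed

lemma cyc_subset: "cyc n \<subseteq> carrier (Fr n)"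
  by (rule Fr.submod_subset[OF cyc_submodule])

lemma dif_cyc:
  assumes "f \<in> carrier (Fr (Suc n))"
  shows "dif n f \<in> cyc n"
  using assms unfolding Fr_def
proof (rule free_induct)
  have "dif n \<zero>\<^bsub>Fr (Suc n)\<^esub> = \<zero>\<^bsub>Fr n\<^esub>"
    by (rule lin_on_zero[OF left_module_Fr left_module_Fr Fr.submod_carrier_self Fr.submod_carrier_self dif_linear])
  then show "dif n \<zero>\<^bsub>free_module A (gens (Suc n))\<^esub> \<in> cyc n"
    using Fr.submod_zero[OF cyc_submodule] by (simp add: Fr_def)
  fix f x a assume f: "f \<in> carrier (free_module A (gens (Suc n)))" "dif n f \<in> cyc n"
    and x: "x \<in> gens (Suc n)" and a: "a \<in> carrier A"
  have "dif n (free_single (gens (Suc n)) x a) \<in> cyc n"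
    unfolding dif_single[OF x a] using gen_boundary_closed[OF x] Fr.submod_smult[OF cyc_submodule a] by blast
  then show "dif n (f \<oplus>\<^bsub>free_module A (gens (Suc n))\<^esub> free_single (gens (Suc n)) x a) \<in> cyc n"
    using lin_on_add[OF dif_linear, of f n "free_single (gens (Suc n)) x a"] f free_single_closed[OF a, of "gens (Suc n)" x]
      Fr.submod_add[OF cyc_submodule] by (simp add: Fr_def)
qed

lemma part_cyc: "f \<in> cyc n \<Longrightarrow> part (gens n) j f \<in> cyc n"
proof (cases n)
  case 0
  assume "f \<in> cyc n"
  then show ?thesis
    using aug_lift_part[of f j] part_closed(2)[of f "gens 0" j] unfolding 0 cyc_0 by (auto simp: Fr_def)
next
  case (Suc m)
  assume f: "f \<in> cyc n"
  then have fc: "f \<in> carrier (free_module A (gens (Suc m)))" "dif m f = \<zero>\<^bsub>Fr m\<^esub>"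
    unfolding Suc cyc_Suc by (auto simp: Fr_def)
  have "dif m (part (gens (Suc m)) j f) = part (gens m) j (dif m f)"
    unfolding dif_def Fr_def using gen_boundary_closed by (intro part_free_lift[OF _ fc(1)]) blast
  also have "\<dots> = \<zero>\<^bsub>Fr m\<^esub>" unfolding fc(2) Fr_def by (rule part_zero)
  finally show ?thesis unfolding Suc cyc_Suc using part_closed(2)[OF fc(1)] by (simp add: Fr_def)
qed

text \<open>Exactness of the standard resolution: each homogeneous part of a cycle is a cycle by
  \<open>part_cyc\<close> and is the value of a formal combination \<open>S\<close>, so
  \<open>Comb j S\<close> is a generator with this part as its boundary.\<close>

lemma dif_onto:
  assumes z: "z \<in> cyc n"
  shows "\<exists>f\<in>carrier (Fr (Suc n)). dif n f = z"
proof -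
  let ?H = "dif n ` carrier (Fr (Suc n))"
  have H: "submodule ?H A (Fr n)"
    by (rule submod_image[OF left_module_Fr left_module_Fr Fr.submod_carrier_self Fr.submod_carrier_self dif_linear])
  have zc: "z \<in> carrier (free_module A (gens n))" using z cyc_subset by (auto simp: Fr_def)
  have "part (gens n) j z \<in> ?H" for j
  proof -
    let ?p = "part (gens n) j z"
    obtain S where S: "fset S \<subseteq> gens n \<times> carrier A" "comb_value A (gens n) S = ?p"
      using ex_comb_value[OF part_closed(2)[OF zc]] by blast
    have x: "Comb j S \<in> gens (Suc n)"
      unfolding gens_Suc using S part_cyc[OF z] part_closed(1)[OF zc] by auto
    have "dif n (free_single (gens (Suc n)) (Comb j S) \<one>) = ?p"
      unfolding dif_single[OF x one_closed] gen_boundary.simps S(2)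
      by (rule Fr.smult_one) (simp add: Fr_def part_closed(2)[OF zc])
    moreover have "free_single (gens (Suc n)) (Comb j S) \<one> \<in> carrier (Fr (Suc n))"
      unfolding Fr_def by (rule free_single_closed[OF one_closed])
    ultimately show ?thesis by (metis imageI)
  qed
  then have "z \<in> ?H" using mem_of_parts[OF H[unfolded Fr_def[of n]] zc] by blast
  then show ?thesis by (elim imageE) blast
qed

lemma dif_lin_cyc: "lin_on A (Fr (Suc n)) (carrier (Fr (Suc n))) (Fr n) (cyc n) (dif n)"
  by (rule lin_on_subset[OF dif_linear subset_refl dif_cyc])

lemma aug_onto: "t \<in> carrier T \<Longrightarrow> \<exists>f\<in>carrier (Fr 0). free_lift A (gens 0) T gen_elt f = t"
proof -
  assume t: "t \<in> carrier T"
  have x: "Elt 0 t \<in> gens 0" using t by (simp add: gens_0 trivial_grading_def)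
  have vc: "gen_elt x \<in> carrier T" if "x \<in> gens 0" for x using that by (auto simp: gens_0 TG_carrier)
  have "free_lift A (gens 0) T gen_elt (free_single (gens 0) (Elt 0 t) \<one>) = t"
    using free_lift_single[OF left_module_trivial vc x one_closed] t by (simp add: T.smult_one)
  moreover have "free_single (gens 0) (Elt 0 t) \<one> \<in> carrier (Fr 0)"
    unfolding Fr_def by (rule free_single_closed[OF one_closed])
  ultimately show ?thesis by blast
qed

lemma lifts_Fr:
  fixes N :: "('a, 'n) module"
  assumes "left_module A N" "left_module A Q" "submodule Y A N" "submodule W A Q"
    "lin_on A N Y Q W d" "\<And>w. w \<in> W \<Longrightarrow> \<exists>y\<in>Y. d y = w"
  shows "lifts A (Fr n) (carrier (Fr n)) N Y Q W d"
  unfolding Fr_def using assms by (rule lifts_free)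

text \<open>Takes \<open>n\<close> syzygies on both sides at once, so that the first cover on the
  finite side has rank \<open>f n\<close> at the end. The roles are opposite to those in
  \<open>noetherian_resolvable\<close>: now the cycles of the standard resolution are the retracts
  of finitely generated syzygies.\<close>

lemma stable_retract_shift:
  "subm X \<Longrightarrow> X \<subseteq> fr A k \<Longrightarrow> stable_retract A (Fr j) (carrier (Fr j)) (cyc j) (seqs A) (fr A k) X \<Longrightarrow>
    resolvable A {\<zero>} (Suc n) f X {\<lambda>_. \<zero>} \<Longrightarrow>
    \<exists>K' k' p. subm K' \<and> K' \<subseteq> fr A k' \<and> covers A (f n) p K' {\<lambda>_. \<zero>} \<and>
      stable_retract A (Fr (j + n)) (carrier (Fr (j + n))) (cyc (j + n)) (seqs A) (fr A k') K'"
proof (induction n arbitrary: X k j f)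
  case 0
  then show ?case by auto
next
  case (Suc n)
  obtain p where p: "covers A (f 0) p X {\<lambda>_. \<zero>}"
    "resolvable A {\<zero>} (Suc n) (\<lambda>i. f (Suc i)) {c \<in> fr A (f 0). p c \<in> {\<lambda>_. \<zero>}} (fI A {\<zero>} (f 0))"
    using Suc(5) unfolding resolvable.simps(2)[of _ _ "Suc n"] by blast
  have lp: "lin (fr A (f 0)) X p" using p(1) by (simp add: covers_def)
  have onto: "\<exists>y\<in>fr A (f 0). p y = w" if w: "w \<in> X" for w
  proof -
    obtain c l where c: "c \<in> fr A (f 0)" "l \<in> {\<lambda>_. \<zero>}" "w = vadd (p c) l"
      using p(1) w unfolding covers_def by blast
    then have "w = vadd (p c) \<zero>\<^bsub>seqs A\<^esub>" by simp
    with c(1) show ?thesis using V.M.r_zero[OF V.submod_carrier[OF Suc(2) lin_on_mem[OF lp c(1)]]] by auto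
  qed
  let ?X = "{c \<in> fr A (f 0). p c = \<zero>\<^bsub>seqs A\<^esub>}"
  have "stable_retract A (Fr (Suc j)) (carrier (Fr (Suc j))) {x \<in> carrier (Fr (Suc j)). dif j x = \<zero>\<^bsub>Fr j\<^esub>}
      (seqs A) (fr A (f 0)) ?X"
  proof (rule stable_retract_syzygy[OF left_module_Fr left_module_seqs left_module_Fr left_module_seqs
        Fr.submod_carrier_self cyc_submodule submod_fr Suc(2) Fr.submod_carrier_self submod_fr cyc_subset Suc(3)
        dif_lin_cyc lp _ _ _ Suc(4)])
    show "lifts A (Fr (Suc j)) (carrier (Fr (Suc j))) (seqs A) (fr A (f 0)) (seqs A) X p"
      by (rule lifts_Fr[OF left_module_seqs left_module_seqs submod_fr Suc(2) lp onto])
    show "lifts A (seqs A) (fr A (f 0)) (Fr (Suc j)) (carrier (Fr (Suc j))) (Fr j) (cyc j) (dif j)"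
      by (rule lifts_fr[OF left_module_Fr left_module_Fr Fr.submod_carrier_self cyc_submodule dif_lin_cyc dif_onto])
    show "lifts A (Fr j) (carrier (Fr j)) (Fr (Suc j)) (carrier (Fr (Suc j))) (Fr j) (cyc j) (dif j)"
      by (rule lifts_Fr[OF left_module_Fr left_module_Fr Fr.submod_carrier_self cyc_submodule dif_lin_cyc dif_onto])
  qed
  then have sr: "stable_retract A (Fr (Suc j)) (carrier (Fr (Suc j))) (cyc (Suc j)) (seqs A) (fr A (f 0)) ?X"
    by (simp add: cyc_Suc)
  have X: "subm ?X" using subm_vimage[OF submod_fr Suc(2) V.submod_null lp] by simp
  have res: "resolvable A {\<zero>} (Suc n) (\<lambda>i. f (Suc i)) ?X {\<lambda>_. \<zero>}"
    using p(2) by (simp only: fI_zero singleton_iff seqs_simps(2))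
  have "?X \<subseteq> fr A (f 0)" by blast
  from Suc(1)[OF X this sr res] show ?case by simp
qed

lemma std_stable_retract:
  assumes "\<And>n. resolvable A {\<zero>} n f (fI A (aug_ideal A G) 1) {\<lambda>_. \<zero>}"
  shows "\<exists>K k p. subm K \<and> K \<subseteq> fr A k \<and> covers A (f n) p K {\<lambda>_. \<zero>} \<and>
      stable_retract A (Fr n) (carrier (Fr n)) (cyc n) (seqs A) (fr A k) K"
proof -
  let ?\<pi> = "\<lambda>v :: nat \<Rightarrow> 'a. aug_ideal A G +> v 0"
  have "stable_retract A (Fr 0) (carrier (Fr 0)) {x \<in> carrier (Fr 0). free_lift A (gens 0) T gen_elt x = \<zero>\<^bsub>T\<^esub>}
     (seqs A) (fr A 1) {c \<in> fr A 1. ?\<pi> c = \<zero>\<^bsub>T\<^esub>}"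
  proof (rule stable_retract_kernels[OF left_module_Fr left_module_seqs left_module_trivial Fr.submod_carrier_self submod_fr
        T.submod_carrier_self aug_lift trivial_cover(1)])
    show "lifts A (Fr 0) (carrier (Fr 0)) (seqs A) (fr A 1) T (carrier T) ?\<pi>"
      by (rule lifts_Fr[OF left_module_seqs left_module_trivial submod_fr T.submod_carrier_self trivial_cover(1,2)])
    show "lifts A (seqs A) (fr A 1) (Fr 0) (carrier (Fr 0)) T (carrier T) (free_lift A (gens 0) T gen_elt)"
      by (rule lifts_fr[OF left_module_Fr left_module_trivial Fr.submod_carrier_self T.submod_carrier_self aug_lift aug_onto])
  qed
  then have "stable_retract A (Fr 0) (carrier (Fr 0)) (cyc 0) (seqs A) (fr A 1) (fI A (aug_ideal A G) 1)"
    unfolding trivial_cover(3) cyc_0 .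
  moreover have "fI A (aug_ideal A G) 1 \<subseteq> fr A 1" by (auto simp: fI_def)
  ultimately show ?thesis
    using stable_retract_shift[OF submod_fI[OF ideal_aug] _ _ assms, of 1 0 n] by auto
qed

text \<open>The witnesses \<open>e i\<close> lift the images under \<open>\<beta>\<close> of generators of \<open>X\<close>.\<close>

lemma cocycle_coboundary:
  assumes X: "subm X" "X \<subseteq> fr A k" and cov: "covers A r p X {\<lambda>_. \<zero>}"
    and sr: "stable_retract A (Fr n) (carrier (Fr n)) (cyc n) (seqs A) (fr A k) X"
  shows "\<exists>e. (\<forall>i<r. e i \<in> carrier (Fr (Suc n))) \<and>
    (\<forall>f. lin_on A (Fr (Suc n)) (carrier (Fr (Suc n))) T (carrier T) f \<longrightarrow> (\<forall>z\<in>cyc (Suc n). f z = \<zero>\<^bsub>T\<^esub>) \<longrightarrow>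
      (\<forall>i<r. f (e i) = \<zero>\<^bsub>T\<^esub>) \<longrightarrow>
      (\<exists>g. lin_on A (Fr n) (carrier (Fr n)) T (carrier T) g \<and> (\<forall>x\<in>carrier (Fr (Suc n)). f x = g (dif n x))))"
proof -
  obtain \<alpha> \<beta> \<theta> where a: "\<And>z. z \<in> cyc n \<Longrightarrow> \<alpha> z \<in> X"
    and b0: "lin_on A (seqs A) (fr A k) (Fr n) (carrier (Fr n)) \<beta>" "\<And>z. z \<in> X \<Longrightarrow> \<beta> z \<in> cyc n"
    and t: "lin_on A (Fr n) (carrier (Fr n)) (Fr n) (cyc n) \<theta>" "\<And>z. z \<in> cyc n \<Longrightarrow> z = \<beta> (\<alpha> z) \<oplus>\<^bsub>Fr n\<^esub> \<theta> z"
    using sr unfolding stable_retract_def by blast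
  have b: "lin_on A (seqs A) X (Fr n) (cyc n) \<beta>" by (rule lin_on_subset[OF b0(1) X(2) b0(2)])
  have lp: "lin (fr A r) X p" using cov by (simp add: covers_def)
  let ?u = "\<lambda>i j. if j = i then \<one> else \<zero>"
  have u: "?u i \<in> fr A r" if "i < r" for i using that by (auto simp: fr_def)
  define s where "s z = (SOME x. x \<in> carrier (Fr (Suc n)) \<and> dif n x = z)" for z
  have s: "s z \<in> carrier (Fr (Suc n))" "dif n (s z) = z" if z: "z \<in> cyc n" for z
  proof -
    have "\<exists>x. x \<in> carrier (Fr (Suc n)) \<and> dif n x = z" using dif_onto[OF z] by blast
    from someI_ex[OF this] show "s z \<in> carrier (Fr (Suc n))" "dif n (s z) = z" unfolding s_def by blast+
  qed
  define e where "e i = s (\<beta> (p (?u i)))" for i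
  have bp: "\<beta> (p c) \<in> cyc n" if "c \<in> fr A r" for c using lin_on_mem[OF b lin_on_mem[OF lp that]] .
  show ?thesis
  proof (intro exI[of _ e] conjI allI impI)
    show "e i \<in> carrier (Fr (Suc n))" if "i < r" for i unfolding e_def by (rule s(1)[OF bp[OF u[OF that]]])
    fix f assume f: "lin_on A (Fr (Suc n)) (carrier (Fr (Suc n))) T (carrier T) f" "\<forall>z\<in>cyc (Suc n). f z = \<zero>\<^bsub>T\<^esub>"
      and fe: "\<forall>i<r. f (e i) = \<zero>\<^bsub>T\<^esub>"
    \<comment> \<open>A cocycle vanishes on the kernel of \<open>dif n\<close>, hence factors
      through the cycles as \<open>fb\<close>.\<close>
    have fd: "f x = f y" if x: "x \<in> carrier (Fr (Suc n))" and y: "y \<in> carrier (Fr (Suc n))" and d: "dif n x = dif n y" for x y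
    proof -
      have xy: "x \<ominus>\<^bsub>Fr (Suc n)\<^esub> y \<in> carrier (Fr (Suc n))" using x y by simp
      have dc: "dif n y \<in> carrier (Fr n)" using lin_on_mem[OF dif_linear y] .
      have "dif n (x \<ominus>\<^bsub>Fr (Suc n)\<^esub> y) = dif n x \<ominus>\<^bsub>Fr n\<^esub> dif n y"
        by (rule lin_on_minus[OF left_module_Fr left_module_Fr Fr.submod_carrier_self Fr.submod_carrier_self dif_linear x y])
      also have "\<dots> = \<zero>\<^bsub>Fr n\<^esub>" unfolding d a_minus_def by (rule Fr.M.r_neg[OF dc])
      finally have "f (x \<ominus>\<^bsub>Fr (Suc n)\<^esub> y) = \<zero>\<^bsub>T\<^esub>" using f(2) xy by (simp add: cyc_Suc)
      moreover have "x = y \<oplus>\<^bsub>Fr (Suc n)\<^esub> (x \<ominus>\<^bsub>Fr (Suc n)\<^esub> y)" using Fr.add_minus_cancel[OF x y] by simp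
      ultimately show ?thesis using lin_on_add[OF f(1) y xy] lin_on_mem[OF f(1) y] by simp
    qed
    define fb where "fb z = f (s z)" for z
    have fb: "fb (dif n x) = f x" if "x \<in> carrier (Fr (Suc n))" for x
      unfolding fb_def using fd[OF s(1)[OF dif_cyc[OF that]] that s(2)[OF dif_cyc[OF that]]] .
    have lfb: "lin_on A (Fr n) (cyc n) T (carrier T) fb"
    proof (rule lin_onI)
      fix x assume x: "x \<in> cyc n"
      show "fb x \<in> carrier T" unfolding fb_def by (rule lin_on_mem[OF f(1) s(1)[OF x]])
      {
        fix y assume y: "y \<in> cyc n"
        have sx: "s x \<oplus>\<^bsub>Fr (Suc n)\<^esub> s y \<in> carrier (Fr (Suc n))" using s(1)[OF x] s(1)[OF y] by simp
        have "fb (x \<oplus>\<^bsub>Fr n\<^esub> y) = f (s x \<oplus>\<^bsub>Fr (Suc n)\<^esub> s y)"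
          using fb[OF sx] lin_on_add[OF dif_linear s(1)[OF x] s(1)[OF y]] s(2)[OF x] s(2)[OF y] by simp
        also have "\<dots> = fb x \<oplus>\<^bsub>T\<^esub> fb y" unfolding fb_def by (rule lin_on_add[OF f(1) s(1)[OF x] s(1)[OF y]])
        finally show "fb (x \<oplus>\<^bsub>Fr n\<^esub> y) = fb x \<oplus>\<^bsub>T\<^esub> fb y" .
      }
      fix c assume c: "c \<in> carrier A"
      have sx: "c \<odot>\<^bsub>Fr (Suc n)\<^esub> s x \<in> carrier (Fr (Suc n))" using s(1)[OF x] c by (simp add: Fr.smult_closed)
      have "fb (c \<odot>\<^bsub>Fr n\<^esub> x) = f (c \<odot>\<^bsub>Fr (Suc n)\<^esub> s x)"
        using fb[OF sx] lin_on_smult[OF dif_linear c s(1)[OF x]] s(2)[OF x] by simp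
      also have "\<dots> = c \<odot>\<^bsub>T\<^esub> fb x" unfolding fb_def by (rule lin_on_smult[OF f(1) c s(1)[OF x]])
      finally show "fb (c \<odot>\<^bsub>Fr n\<^esub> x) = c \<odot>\<^bsub>T\<^esub> fb x" .
    qed
    \<comment> \<open>Vanishing on the \<open>r\<close> basis vectors means vanishing on A^r, and
      therefore \<open>fb\<close> vanishes on the image of \<open>X\<close> under
      \<open>\<beta>\<close>.\<close>
    have q0: "fb (\<beta> (p c)) = \<zero>\<^bsub>T\<^esub>" if c: "c \<in> fr A r" for c
    proof (rule lin_fr_zero[OF left_module_trivial T.submod_carrier_self _ _ c])
      show "lin_on A (seqs A) (fr A r) T (carrier T) (\<lambda>c. fb (\<beta> (p c)))"
        by (rule lin_on_comp[OF lin_on_comp[OF lp b] lfb])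
      show "fb (\<beta> (p (?u i))) = \<zero>\<^bsub>T\<^esub>" if "i < r" for i using fe that by (simp add: e_def fb_def)
    qed
    have fK: "fb (\<beta> y) = \<zero>\<^bsub>T\<^esub>" if y: "y \<in> X" for y
    proof -
      obtain c l where c: "c \<in> fr A r" "l \<in> {\<lambda>_. \<zero>}" "y = vadd (p c) l"
        using cov y unfolding covers_def by blast
      then have "y = vadd (p c) \<zero>\<^bsub>seqs A\<^esub>" by simp
      then have "y = p c" using V.M.r_zero[OF V.submod_carrier[OF X(1) lin_on_mem[OF lp c(1)]]] by simp
      then show ?thesis using q0[OF c(1)] by simp
    qed
    \<comment> \<open>Only \<open>fb\<close> after \<open>\<theta>\<close> remains of
      \<open>fb\<close>. Since \<open>\<theta>\<close> is defined on all of \<open>Fr n\<close> and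
      not just on the cycles, this is a cochain with coboundary \<open>f\<close>.\<close>
    have fz: "fb z = fb (\<theta> z)" if z: "z \<in> cyc n" for z
    proof -
      have tz: "\<theta> z \<in> cyc n" using lin_on_mem[OF t(1) subsetD[OF cyc_subset z]] .
      have "fb z = fb (\<beta> (\<alpha> z) \<oplus>\<^bsub>Fr n\<^esub> \<theta> z)" using t(2)[OF z] by simp
      also have "\<dots> = fb (\<beta> (\<alpha> z)) \<oplus>\<^bsub>T\<^esub> fb (\<theta> z)" by (rule lin_on_add[OF lfb lin_on_mem[OF b a[OF z]] tz])
      also have "\<dots> = fb (\<theta> z)" unfolding fK[OF a[OF z]] by (rule T.M.l_zero[OF lin_on_mem[OF lfb tz]])
      finally show ?thesis .
    qed
    show "\<exists>g. lin_on A (Fr n) (carrier (Fr n)) T (carrier T) g \<and> (\<forall>x\<in>carrier (Fr (Suc n)). f x = g (dif n x))"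
    proof (intro exI[of _ "\<lambda>x. fb (\<theta> x)"] conjI ballI)
      show "lin_on A (Fr n) (carrier (Fr n)) T (carrier T) (\<lambda>x. fb (\<theta> x))" by (rule lin_on_comp[OF t(1) lfb])
      show "f x = fb (\<theta> (dif n x))" if "x \<in> carrier (Fr (Suc n))" for x
        using fb[OF that] fz[OF dif_cyc[OF that]] by simp
    qed
  qed
qed

end

section \<open>The dimension of Ext\<close>

text \<open>Spanning is expressed through submodules, so that it passes to quotients and direct sums
  by taking preimages, without linear combinations.\<close>

definition generates :: "'k ring \<Rightarrow> ('k, 'v) module \<Rightarrow> 'v set \<Rightarrow> bool" where
  "generates K V B \<longleftrightarrow> finite B \<and> B \<subseteq> carrier V \<and> (\<forall>W. submodule W K V \<longrightarrow> B \<subseteq> W \<longrightarrow> carrier V \<subseteq> W)"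

text \<open>A vector \<open>b\<close> that the last map does not kill, if there is one, spans
  \<open>V'\<close> together with the kernel of that map, because the target is a line. So each
  evaluation costs at most one generator.\<close>

lemma span_evaluations:
  assumes V: "left_module K V" and Q: "left_module K Q"
    and line: "\<And>x y. x \<in> carrier Q \<Longrightarrow> y \<in> carrier Q \<Longrightarrow> y \<noteq> \<zero>\<^bsub>Q\<^esub> \<Longrightarrow> \<exists>c\<in>carrier K. x = c \<odot>\<^bsub>Q\<^esub> y"
    and ev: "\<And>i. i < r \<Longrightarrow> lin_on K V (carrier V) Q (carrier Q) (ev i)"
  shows "submodule V' K V \<Longrightarrow> (\<And>v. v \<in> V' \<Longrightarrow> (\<And>i. i < r \<Longrightarrow> ev i v = \<zero>\<^bsub>Q\<^esub>) \<Longrightarrow> v \<in> U) \<Longrightarrow>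
    \<exists>B. finite B \<and> card B \<le> r \<and> B \<subseteq> V' \<and> (\<forall>W. submodule W K V \<longrightarrow> U \<subseteq> W \<longrightarrow> B \<subseteq> W \<longrightarrow> V' \<subseteq> W)"
  using ev
proof (induction r arbitrary: V')
  case 0
  then show ?case by (intro exI[of _ "{}"]) auto
next
  case (Suc r)
  interpret V: left_module K V by fact
  interpret Q: left_module K Q by fact
  note er = Suc(4)[of r, simplified]
  let ?V = "{v \<in> V'. ev r v = \<zero>\<^bsub>Q\<^esub>}"
  have lr: "lin_on K V V' Q (carrier Q) (ev r)"
    by (rule lin_on_subset[OF er V.submod_subset[OF Suc(2)]]) (use lin_on_mem[OF er] V.submod_carrier[OF Suc(2)] in blast)
  have sub: "submodule ?V K V"
    using submod_vimage[OF V Q Suc(2) Q.submod_carrier_self Q.submod_null lr] by simp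
  have "v \<in> U" if v: "v \<in> ?V" and e: "\<And>i. i < r \<Longrightarrow> ev i v = \<zero>\<^bsub>Q\<^esub>" for v
    using Suc(3)[of v] v e by (metis (mono_tags, lifting) less_Suc_eq mem_Collect_eq)
  then obtain B where B: "finite B" "card B \<le> r" "B \<subseteq> ?V"
    "\<And>W. submodule W K V \<Longrightarrow> U \<subseteq> W \<Longrightarrow> B \<subseteq> W \<Longrightarrow> ?V \<subseteq> W"
    using Suc(1)[OF sub _ Suc(4)] by (metis (no_types, lifting) less_Suc_eq)
  show ?case
  proof (cases "?V = V'")
    case True
    have "B \<subseteq> V'" using B(3) by blast
    moreover have "\<forall>W. submodule W K V \<longrightarrow> U \<subseteq> W \<longrightarrow> B \<subseteq> W \<longrightarrow> V' \<subseteq> W" using B(4) True by simp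
    ultimately show ?thesis using B(1,2) le_SucI by blast
  next
    case False
    then obtain b where b: "b \<in> V'" "ev r b \<noteq> \<zero>\<^bsub>Q\<^esub>" by blast
    have "V' \<subseteq> W" if W: "submodule W K V" "U \<subseteq> W" "insert b B \<subseteq> W" for W
    proof
      fix v assume v: "v \<in> V'"
      obtain c where c: "c \<in> carrier K" "ev r v = c \<odot>\<^bsub>Q\<^esub> ev r b"
        using line[OF lin_on_mem[OF lr v] lin_on_mem[OF lr b(1)] b(2)] by blast
      have cb: "c \<odot>\<^bsub>V\<^esub> b \<in> V'" using V.submod_smult[OF Suc(2) c(1) b(1)] .
      have "ev r (v \<ominus>\<^bsub>V\<^esub> c \<odot>\<^bsub>V\<^esub> b) = ev r v \<ominus>\<^bsub>Q\<^esub> ev r (c \<odot>\<^bsub>V\<^esub> b)"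
        by (rule lin_on_minus[OF V Q Suc(2) Q.submod_carrier_self lr v cb])
      also have "ev r (c \<odot>\<^bsub>V\<^esub> b) = ev r v" unfolding lin_on_smult[OF lr c(1) b(1)] c(2) ..
      also have "ev r v \<ominus>\<^bsub>Q\<^esub> ev r v = \<zero>\<^bsub>Q\<^esub>" unfolding a_minus_def by (rule Q.M.r_neg[OF lin_on_mem[OF lr v]])
      finally have "v \<ominus>\<^bsub>V\<^esub> c \<odot>\<^bsub>V\<^esub> b \<in> ?V" using V.submod_minus[OF Suc(2) v cb] by simp
      then have 1: "v \<ominus>\<^bsub>V\<^esub> c \<odot>\<^bsub>V\<^esub> b \<in> W" using B(4)[OF W(1,2)] W(3) by blast
      have 2: "c \<odot>\<^bsub>V\<^esub> b \<in> W" using V.submod_smult[OF W(1) c(1)] W(3) by blast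
      have "c \<odot>\<^bsub>V\<^esub> b \<oplus>\<^bsub>V\<^esub> (v \<ominus>\<^bsub>V\<^esub> c \<odot>\<^bsub>V\<^esub> b) = v"
        by (rule V.add_minus_cancel[OF V.submod_carrier[OF Suc(2) v] V.submod_carrier[OF Suc(2) cb]])
      then show "v \<in> W" using V.submod_add[OF W(1) 2 1] by simp
    qed
    moreover have "card (insert b B) \<le> Suc r" using B(2) by (simp add: card_insert_if[OF B(1)])
    moreover have "insert b B \<subseteq> V'" using b B(3) by blast
    ultimately show ?thesis using B(1) by (intro exI[of _ "insert b B"]) auto
  qed
qed

lemma generates_quot:
  assumes V: "left_module K V" and U: "submodule U K V" and B: "finite B" "B \<subseteq> carrier V"
    and gen: "\<And>W. submodule W K V \<Longrightarrow> U \<subseteq> W \<Longrightarrow> B \<subseteq> W \<Longrightarrow> carrier V \<subseteq> W"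
  shows "generates K (quot_module V U) ((\<lambda>x. U +>\<^bsub>V\<^esub> x) ` B)"
  unfolding generates_def
proof (intro conjI allI impI)
  let ?Q = "quot_module V U"
  interpret V: left_module K V by fact
  interpret Q: left_module K ?Q by (rule left_module_quot[OF V U])
  show "finite ((\<lambda>x. U +>\<^bsub>V\<^esub> x) ` B)" using B(1) by simp
  show "(\<lambda>x. U +>\<^bsub>V\<^esub> x) ` B \<subseteq> carrier ?Q" using B(2) by auto
  fix W assume W: "submodule W K ?Q" "(\<lambda>x. U +>\<^bsub>V\<^esub> x) ` B \<subseteq> W"
  have lin: "lin_on K V (carrier V) ?Q (carrier ?Q) (\<lambda>x. U +>\<^bsub>V\<^esub> x)"
    by (rule lin_onI) (simp_all add: quot_add[OF V U] quot_smult[OF V U])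
  let ?W = "{v \<in> carrier V. U +>\<^bsub>V\<^esub> v \<in> W}"
  have "submodule ?W K V"
    by (rule submod_vimage[OF V left_module_quot[OF V U] V.submod_carrier_self Q.submod_carrier_self W(1) lin])
  moreover have "U \<subseteq> ?W"
  proof
    fix u assume u: "u \<in> U"
    have uc: "u \<in> carrier V" using V.submod_carrier[OF U u] .
    then have "U +>\<^bsub>V\<^esub> u = U" using V.coset_eq_zero_iff[OF U] u by blast
    then show "u \<in> ?W" using uc Q.submod_zero[OF W(1)] by simp
  qed
  moreover have "B \<subseteq> ?W" using B(2) W(2) by blast
  ultimately have "carrier V \<subseteq> ?W" by (rule gen)
  then show "carrier ?Q \<subseteq> W" by auto
qed

lemma generates_direct_sum:
  assumes "ring K" "finite I" and V: "\<And>i. i \<in> I \<Longrightarrow> left_module K (V i)"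
    and gen: "\<And>i. i \<in> I \<Longrightarrow> generates K (V i) (B i)"
  shows "generates K (direct_sum I V) (\<Union>i\<in>I. summand_incl I V i ` B i)"
  unfolding generates_def
proof (intro conjI allI impI)
  let ?S = "direct_sum I V"
  have S: "left_module K ?S" by (rule left_module_direct_sum[OF assms(1) V])
  interpret S: left_module K ?S by (rule S)
  show "finite (\<Union>i\<in>I. summand_incl I V i ` B i)" using assms(2) gen by (auto simp: generates_def)
  have Bc: "b \<in> carrier (V i)" if "i \<in> I" "b \<in> B i" for i b using gen[OF that(1)] that(2) by (auto simp: generates_def)
  show "(\<Union>i\<in>I. summand_incl I V i ` B i) \<subseteq> carrier ?S"
    by (intro UN_least image_subsetI summand_incl_closed[OF V Bc])
  fix W assume W: "submodule W K ?S" "(\<Union>i\<in>I. summand_incl I V i ` B i) \<subseteq> W"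
  have incl: "summand_incl I V i a \<in> W" if i: "i \<in> I" and a: "a \<in> carrier (V i)" for i a
  proof -
    interpret Vi: left_module K "V i" by (rule V[OF i])
    have z: "\<zero>\<^bsub>V k\<^esub> \<oplus>\<^bsub>V k\<^esub> \<zero>\<^bsub>V k\<^esub> = \<zero>\<^bsub>V k\<^esub>" "c \<odot>\<^bsub>V k\<^esub> \<zero>\<^bsub>V k\<^esub> = \<zero>\<^bsub>V k\<^esub>" if "k \<in> I" "c \<in> carrier K" for k c
    proof -
      interpret Vk: left_module K "V k" by (rule V[OF that(1)])
      show "\<zero>\<^bsub>V k\<^esub> \<oplus>\<^bsub>V k\<^esub> \<zero>\<^bsub>V k\<^esub> = \<zero>\<^bsub>V k\<^esub>" "c \<odot>\<^bsub>V k\<^esub> \<zero>\<^bsub>V k\<^esub> = \<zero>\<^bsub>V k\<^esub>"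
        using that by (simp_all add: Vk.smult_r_null)
    qed
    have lin: "lin_on K (V i) (carrier (V i)) ?S (carrier ?S) (summand_incl I V i)"
      using z z(1)[OF _ S.R.zero_closed]
      by (intro lin_onI summand_incl_closed[OF V]) (auto simp: direct_sum_simps summand_incl_def fun_eq_iff)
    have "submodule {v \<in> carrier (V i). summand_incl I V i v \<in> W} K (V i)"
      by (rule submod_vimage[OF V[OF i] S Vi.submod_carrier_self S.submod_carrier_self W(1) lin])
    moreover have "B i \<subseteq> {v \<in> carrier (V i). summand_incl I V i v \<in> W}" using Bc[OF i] W(2) i by blast
    ultimately have "carrier (V i) \<subseteq> {v \<in> carrier (V i). summand_incl I V i v \<in> W}"
      using gen[OF i] unfolding generates_def by blast
    then show ?thesis using a by blast
  qed
  show "carrier ?S \<subseteq> W"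
  proof
    fix f assume f: "f \<in> carrier ?S"
    show "f \<in> W"
      by (rule direct_sum_induct[of I K V f "\<lambda>f. f \<in> W", OF V f])
        (auto intro: S.submod_zero[OF W(1)] S.submod_add[OF W(1)] incl)
  qed
qed

lemma (in left_module) submod_finsum:
  assumes "submodule W R M" "finite S" "\<And>s. s \<in> S \<Longrightarrow> g s \<in> W"
  shows "(\<Oplus>\<^bsub>M\<^esub>s\<in>S. g s) \<in> W"
  using assms(2,3)
proof (induction S rule: finite_induct)
  case empty
  then show ?case using submod_zero[OF assms(1)] by simp
next
  case (insert x S)
  have "(\<Oplus>\<^bsub>M\<^esub>s\<in>insert x S. g s) = g x \<oplus>\<^bsub>M\<^esub> (\<Oplus>\<^bsub>M\<^esub>s\<in>S. g s)"
    using insert submod_carrier[OF assms(1)] by (intro M.finsum_insert) auto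
  then show ?case using insert submod_add[OF assms(1)] by simp
qed

text \<open>\<open>vs_dim\<close> is an infimum over bases, so a basis has to be exhibited. A
  generating set of least size is one: a vector with nonzero coefficient in a linear relation lies
  in the span of the others and could be dropped.\<close>

lemma vs_dim_generates:
  fixes V :: "('k, 'v) module"
  assumes K: "field K" and V: "left_module K V" and gen: "generates K V B0"
  shows "vs_dim K V \<le> enat (card B0)"
proof -
  interpret K: field K by fact
  interpret V: left_module K V by fact
  obtain B where B: "generates K V B" "\<And>B'. generates K V B' \<Longrightarrow> card B \<le> card B'"
    using ex_has_least_nat[of "generates K V" B0 card] gen by blast
  have Bf: "finite B" "B \<subseteq> carrier V" using B(1) by (auto simp: generates_def)
  let ?F = "free_module K B"
  interpret F: left_module K ?F by (rule K.left_module_free)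
  let ?L = "free_lift K B V (\<lambda>b. b)"
  have vc: "b \<in> carrier V" if "b \<in> B" for b using that Bf by blast
  have Fc: "carrier ?F = B \<rightarrow>\<^sub>E carrier K" using Bf(1) by (auto simp: K.free_simps)
  have L: "?L c = (\<Oplus>\<^bsub>V\<^esub>b\<in>B. c b \<odot>\<^bsub>V\<^esub> b)" if "c \<in> carrier ?F" for c
    by (rule K.free_lift_superset[OF V vc that Bf(1)]) auto
  have lin: "lin_on K ?F (carrier ?F) V (carrier V) ?L" by (rule K.free_lift_linear[OF V vc])
  have im: "carrier V \<subseteq> ?L ` carrier ?F"
  proof -
    have "submodule (?L ` carrier ?F) K V"
      by (rule submod_image[OF K.left_module_free V F.submod_carrier_self V.submod_carrier_self lin])
    moreover have "B \<subseteq> ?L ` carrier ?F"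
    proof
      fix b assume b: "b \<in> B"
      have "b = ?L (K.free_single B b \<one>\<^bsub>K\<^esub>)"
        using K.free_lift_single[OF V vc b K.one_closed] vc[OF b] by (simp add: V.smult_one)
      then show "b \<in> ?L ` carrier ?F" using K.free_single_closed[OF K.one_closed] by (rule image_eqI)
    qed
    ultimately show ?thesis using B(1) by (simp add: generates_def)
  qed
  have inj: "e = \<zero>\<^bsub>?F\<^esub>" if e: "e \<in> carrier ?F" "?L e = \<zero>\<^bsub>V\<^esub>" for e
  proof (rule ccontr)
    assume "e \<noteq> \<zero>\<^bsub>?F\<^esub>"
    moreover have "e = \<zero>\<^bsub>?F\<^esub>" if "\<And>b. b \<in> B \<Longrightarrow> e b = \<zero>\<^bsub>K\<^esub>"
      using e(1) that by (auto simp: K.free_simps PiE_iff extensional_def fun_eq_iff)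
    ultimately obtain b where b: "b \<in> B" "e b \<noteq> \<zero>\<^bsub>K\<^esub>" by blast
    have ec: "e x \<in> carrier K" if "x \<in> B" for x using e(1) that by (auto simp: K.free_simps)
    let ?B = "B - {b}"
    let ?s = "\<Oplus>\<^bsub>V\<^esub>x\<in>?B. e x \<odot>\<^bsub>V\<^esub> x"
    have sc: "?s \<in> carrier V" using ec vc by (intro V.M.finsum_closed) (auto simp: V.smult_closed)
    have "insert b ?B = B" using b(1) by blast
    then have "?L e = e b \<odot>\<^bsub>V\<^esub> b \<oplus>\<^bsub>V\<^esub> ?s"
      using L[OF e(1)] V.M.finsum_insert[of ?B b "\<lambda>x. e x \<odot>\<^bsub>V\<^esub> x"] Bf(1) ec vc b(1)
      by (auto simp: V.smult_closed)
    then have s: "?s \<oplus>\<^bsub>V\<^esub> e b \<odot>\<^bsub>V\<^esub> b = \<zero>\<^bsub>V\<^esub>"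
      using e(2) sc ec[OF b(1)] vc[OF b(1)] by (simp add: V.M.a_comm V.smult_closed)
    have ib: "inv\<^bsub>K\<^esub> e b \<in> carrier K" "inv\<^bsub>K\<^esub> e b \<otimes>\<^bsub>K\<^esub> e b = \<one>\<^bsub>K\<^esub>"
      using b(2) ec[OF b(1)] K.field_Units by auto
    have eb: "e b \<odot>\<^bsub>V\<^esub> b = \<ominus>\<^bsub>V\<^esub> ?s"
      using V.M.minus_equality[of "e b \<odot>\<^bsub>V\<^esub> b" ?s] s sc ec[OF b(1)] vc[OF b(1)] by (simp add: V.M.a_comm V.smult_closed)
    have b_eq: "b = inv\<^bsub>K\<^esub> e b \<odot>\<^bsub>V\<^esub> (\<ominus>\<^bsub>V\<^esub> ?s)"
      unfolding eb[symmetric] using V.smult_assoc[OF ib(1) ec[OF b(1)] vc[OF b(1)]] ib(2) vc[OF b(1)] by (simp add: V.smult_one)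
    have "generates K V ?B"
      unfolding generates_def
    proof (intro conjI allI impI)
      fix W assume W: "submodule W K V" "?B \<subseteq> W"
      have "?s \<in> W" using Bf(1) W ec by (intro V.submod_finsum[OF W(1)]) (auto intro: V.submod_smult[OF W(1)])
      then have "inv\<^bsub>K\<^esub> e b \<odot>\<^bsub>V\<^esub> (\<ominus>\<^bsub>V\<^esub> ?s) \<in> W" by (intro V.submod_smult[OF W(1) ib(1)] V.submod_neg[OF W(1)])
      then have "b \<in> W" using b_eq by simp
      then have "B \<subseteq> W" using W(2) by blast
      then show "carrier V \<subseteq> W" using B(1) W(1) by (simp add: generates_def)
    qed (use Bf in auto)
    then show False using B(2)[of ?B] card_Diff1_less[OF Bf(1) b(1)] by simp
  qed
  have "finite_basis K V B"
    unfolding finite_basis_def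
  proof (intro conjI ballI Bf)
    fix v assume v: "v \<in> carrier V"
    show "\<exists>!c. c \<in> B \<rightarrow>\<^sub>E carrier K \<and> v = (\<Oplus>\<^bsub>V\<^esub>b\<in>B. c b \<odot>\<^bsub>V\<^esub> b)"
    proof (rule ex_ex1I)
      obtain c where "c \<in> carrier ?F" "v = ?L c" using im v by blast
      then show "\<exists>c. c \<in> B \<rightarrow>\<^sub>E carrier K \<and> v = (\<Oplus>\<^bsub>V\<^esub>b\<in>B. c b \<odot>\<^bsub>V\<^esub> b)" using L Fc by metis
    next
      fix c c' assume "c \<in> B \<rightarrow>\<^sub>E carrier K \<and> v = (\<Oplus>\<^bsub>V\<^esub>b\<in>B. c b \<odot>\<^bsub>V\<^esub> b)"
        "c' \<in> B \<rightarrow>\<^sub>E carrier K \<and> v = (\<Oplus>\<^bsub>V\<^esub>b\<in>B. c' b \<odot>\<^bsub>V\<^esub> b)"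
      then have c: "c \<in> carrier ?F" "v = ?L c" "c' \<in> carrier ?F" "v = ?L c'" using L Fc by auto
      have "?L (c \<ominus>\<^bsub>?F\<^esub> c') = ?L c \<ominus>\<^bsub>V\<^esub> ?L c'"
        by (rule lin_on_minus[OF K.left_module_free V F.submod_carrier_self V.submod_carrier_self lin c(1,3)])
      also have "\<dots> = \<zero>\<^bsub>V\<^esub>" using c(2,4) v by (simp add: a_minus_def V.M.r_neg)
      finally have "c \<ominus>\<^bsub>?F\<^esub> c' = \<zero>\<^bsub>?F\<^esub>" using c by (intro inj) simp_all
      then show "c = c'" using F.add_minus_cancel[OF c(1,3)] c(3) by simp
    qed
  qed
  then have "vs_dim K V \<le> enat (card B)" unfolding vs_dim_def by (intro Inf_lower) blast
  also have "\<dots> \<le> enat (card B0)" using B(2)[OF gen] by simp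
  finally show ?thesis .
qed

section \<open>Cochains, cocycles and coboundaries as vector spaces over \<open>K\<close>\<close>

lemma lin_maps_iff:
  "f \<in> lin_maps R M N \<longleftrightarrow> f \<in> extensional (carrier M) \<and> lin_on R M (carrier M) N (carrier N) f"
  by (auto simp: lin_maps_def lin_on_def PiE_iff)

lemma submodule_restrict:
  fixes M :: "('r, 'm) module"
  assumes M: "left_module R M" and Z: "submodule Z R M" and H: "submodule H R M" "H \<subseteq> Z"
  shows "submodule H R (M\<lparr>carrier := Z\<rparr>)"
proof -
  interpret M: left_module R M by fact
  interpret Z: left_module R "M\<lparr>carrier := Z\<rparr>" by (rule left_module_submodule[OF M Z])
  show ?thesis
    using H(2) M.submod_zero[OF H(1)] M.submod_add[OF H(1)] M.submod_smult[OF H(1)]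
    by (intro Z.submodI) auto
qed

context graded begin

text \<open>\<open>kQ\<close> is \<open>T\<close> with the action of \<open>K\<close> in place of that of \<open>A\<close>.\<close>

abbreviation "kQ \<equiv> quot_module A (aug_ideal A G)"

lemma aug_submodule: "submodule (aug_ideal A G) K A"
proof (rule KL.submodI)
  fix c x assume c: "c \<in> carrier K" and x: "x \<in> aug_ideal A G"
  have xc: "x \<in> carrier A" using x by (rule aug_carrier)
  have "c \<odot> x = (c \<odot> \<one>) \<otimes> x"
    using graded c xc by (simp add: graded_algebra_def assoc_algebra_def)
  then show "c \<odot> x \<in> aug_ideal A G"
    using ideal.I_l_closed[OF ideal_aug x, of "c \<odot> \<one>"] c by simp
qed (use ideal_aug in \<open>auto simp: aug_ideal_iff hc_add\<close>)

lemma left_module_kQ: "left_module K kQ"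
  by (rule left_module_quot[OF KA_left_module aug_submodule])

sublocale kQ: left_module K kQ by (rule left_module_kQ)

lemma T_kQ: "carrier T = carrier kQ" "zero T = zero kQ" "add T = add kQ"
proof -
  show "carrier T = carrier kQ" "zero T = zero kQ" by (simp_all add: trivial_module_def a_r_coset_def')
  show "add T = add kQ"
    by (intro ext) (simp add: trivial_module_def quot_module_def ring.defs module.defs FactRing_def set_add_def')
qed

text \<open>This makes scalar multiples of \<open>A\<close>-linear maps to the trivial module
  \<open>A\<close>-linear again.\<close>

lemma kQ_smult:
  assumes c: "c \<in> carrier K" and a: "a \<in> carrier A" and t: "t \<in> carrier T"
  shows "c \<odot>\<^bsub>kQ\<^esub> (a \<odot>\<^bsub>T\<^esub> t) = a \<odot>\<^bsub>T\<^esub> (c \<odot>\<^bsub>kQ\<^esub> t)"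
proof -
  let ?M = "aug_ideal A G"
  have sub: "submodule ?M A (regular_module A)" by (rule ring_ideal_submodule[OF ring_axioms ideal_aug])
  have coset: "?M +>\<^bsub>regular_module A\<^esub> x = ?M +> x" for x by (simp add: a_r_coset_def')
  obtain x where x: "x \<in> carrier A" "t = ?M +>\<^bsub>regular_module A\<^esub> x" using T_elem[OF t] by blast
  have s: "b \<odot>\<^bsub>T\<^esub> (?M +> y) = ?M +> (b \<otimes> y)" if "b \<in> carrier A" "y \<in> carrier A" for b y
    using quot_smult[OF left_module_regular sub, of y b] that by (simp add: trivial_module_def coset)
  have "c \<odot> (a \<otimes> x) = a \<otimes> (c \<odot> x)"
    using graded c a x by (simp add: graded_algebra_def assoc_algebra_def)
  then show ?thesis
    using x c a by (simp add: coset s quot_smult[OF KA_left_module aug_submodule])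
qed

text \<open>By connectedness every element is, modulo the augmentation ideal, a scalar multiple of
  the unit; so the trivial module is a line over \<open>K\<close>.\<close>

lemma kQ_line:
  assumes "field K" and conn: "G 0 = (\<lambda>c. c \<odot> \<one>) ` carrier K"
    and x: "x \<in> carrier kQ" and y: "y \<in> carrier kQ" "y \<noteq> \<zero>\<^bsub>kQ\<^esub>"
  shows "\<exists>c\<in>carrier K. x = c \<odot>\<^bsub>kQ\<^esub> y"
proof -
  interpret K: field K by fact
  let ?M = "aug_ideal A G"
  let ?o = "?M +> \<one>"
  have oc: "?o \<in> carrier kQ" by auto
  have rep: "\<exists>c\<in>carrier K. z = c \<odot>\<^bsub>kQ\<^esub> ?o" if z: "z \<in> carrier kQ" for z
  proof -
    obtain a where a: "a \<in> carrier A" "z = ?M +> a" using z by auto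
    obtain c where c: "c \<in> carrier K" "hc a 0 = c \<odot> \<one>" using hc_G[OF a(1), of 0] unfolding conn by blast
    have "hc (a \<ominus> hc a 0) 0 = hc a 0 \<oplus> \<ominus> hc (hc a 0) 0"
      using a(1) by (simp add: a_minus_def hc_add hc_neg)
    also have "hc (hc a 0) 0 = hc a 0" by (simp add: hc_homogeneous[OF hc_G[OF a(1)]])
    finally have "a \<ominus> hc a 0 \<in> ?M" using a(1) by (simp add: aug_ideal_iff r_neg)
    then have "z = ?M +> hc a 0" using KL.coset_eq_iff[OF aug_submodule a(1) hc_carrier[OF a(1)]] a(2) by simp
    also have "\<dots> = c \<odot>\<^bsub>kQ\<^esub> ?o" unfolding c(2) using c(1) by (simp add: quot_smult[OF KA_left_module aug_submodule])
    finally show ?thesis using c(1) by blast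
  qed
  obtain c where c: "c \<in> carrier K" "x = c \<odot>\<^bsub>kQ\<^esub> ?o" using rep[OF x] by blast
  obtain e where e: "e \<in> carrier K" "y = e \<odot>\<^bsub>kQ\<^esub> ?o" using rep[OF y(1)] by blast
  have "e \<noteq> \<zero>\<^bsub>K\<^esub>" using y(2) e kQ.smult_l_null[OF oc] by auto
  then have ie: "inv\<^bsub>K\<^esub> e \<in> carrier K" "inv\<^bsub>K\<^esub> e \<otimes>\<^bsub>K\<^esub> e = \<one>\<^bsub>K\<^esub>" using e(1) K.field_Units by auto
  have "(c \<otimes>\<^bsub>K\<^esub> inv\<^bsub>K\<^esub> e) \<odot>\<^bsub>kQ\<^esub> y = (c \<otimes>\<^bsub>K\<^esub> inv\<^bsub>K\<^esub> e \<otimes>\<^bsub>K\<^esub> e) \<odot>\<^bsub>kQ\<^esub> ?o"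
    unfolding e(2) using c ie e by (intro kQ.smult_assoc[symmetric] oc) auto
  also have "c \<otimes>\<^bsub>K\<^esub> inv\<^bsub>K\<^esub> e \<otimes>\<^bsub>K\<^esub> e = c" using c ie e by (simp add: KA.R.m_assoc)
  finally show ?thesis using c ie by (intro bexI[of _ "c \<otimes>\<^bsub>K\<^esub> inv\<^bsub>K\<^esub> e"]) auto
qed

text \<open>All functions from \<open>Fr n\<close> to the trivial module, with the operations of
  \<open>Hom_module\<close>. Linear maps, cocycles and coboundaries are submodules of it over
  \<open>K\<close>.\<close>

definition "Ho n = prod_module (carrier (Fr n)) (\<lambda>_. kQ)"

lemma left_module_Ho: "left_module K (Ho n)"
  unfolding Ho_def by (rule left_module_prod[OF KA.R.ring_axioms left_module_kQ])

sublocale Ho: left_module K "Ho n" for n by (rule left_module_Ho)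

lemma Ho_simps:
  "carrier (Ho n) = carrier (Fr n) \<rightarrow>\<^sub>E carrier T"
  "zero (Ho n) = (\<lambda>x\<in>carrier (Fr n). \<zero>\<^bsub>T\<^esub>)"
  "add (Ho n) f g = (\<lambda>x\<in>carrier (Fr n). f x \<oplus>\<^bsub>T\<^esub> g x)"
  "smult (Ho n) c f = (\<lambda>x\<in>carrier (Fr n). c \<odot>\<^bsub>kQ\<^esub> f x)"
  by (simp_all add: Ho_def prod_module_def T_kQ)

lemma kQ_closed: "c \<in> carrier K \<Longrightarrow> t \<in> carrier T \<Longrightarrow> c \<odot>\<^bsub>kQ\<^esub> t \<in> carrier T"
  unfolding T_kQ by (rule kQ.smult_closed)

lemma kQ_distr: "c \<in> carrier K \<Longrightarrow> t \<in> carrier T \<Longrightarrow> u \<in> carrier T \<Longrightarrow>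
    c \<odot>\<^bsub>kQ\<^esub> (t \<oplus>\<^bsub>T\<^esub> u) = c \<odot>\<^bsub>kQ\<^esub> t \<oplus>\<^bsub>T\<^esub> c \<odot>\<^bsub>kQ\<^esub> u"
  unfolding T_kQ by (rule kQ.smult_r_distr)

lemma kQ_null: "c \<in> carrier K \<Longrightarrow> c \<odot>\<^bsub>kQ\<^esub> \<zero>\<^bsub>T\<^esub> = \<zero>\<^bsub>T\<^esub>"
  unfolding T_kQ by (rule kQ.smult_r_null)

lemma lin_maps_submodule: "submodule (lin_maps A (Fr n) T) K (Ho n)"
proof (rule Ho.submodI)
  show "lin_maps A (Fr n) T \<subseteq> carrier (Ho n)" by (auto simp: lin_maps_def Ho_simps)
  show "\<zero>\<^bsub>Ho n\<^esub> \<in> lin_maps A (Fr n) T"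
    by (auto simp: lin_maps_iff Ho_simps intro!: lin_onI simp: Fr.smult_closed T.smult_r_null)
  fix f g assume f: "f \<in> lin_maps A (Fr n) T" and g: "g \<in> lin_maps A (Fr n) T"
  have lf: "lin_on A (Fr n) (carrier (Fr n)) T (carrier T) f" and lg: "lin_on A (Fr n) (carrier (Fr n)) T (carrier T) g"
    using f g by (simp_all add: lin_maps_iff)
  show "f \<oplus>\<^bsub>Ho n\<^esub> g \<in> lin_maps A (Fr n) T"
    unfolding lin_maps_iff
    by (auto simp: Ho_simps intro!: lin_onI simp: Fr.smult_closed lin_on_mem[OF lf] lin_on_mem[OF lg]
      lin_on_add[OF lf] lin_on_add[OF lg] lin_on_smult[OF lf] lin_on_smult[OF lg] T.M.a_ac T.smult_r_distr)
next
  fix c f assume c: "c \<in> carrier K" and f: "f \<in> lin_maps A (Fr n) T"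
  have lf: "lin_on A (Fr n) (carrier (Fr n)) T (carrier T) f" using f by (simp add: lin_maps_iff)
  show "c \<odot>\<^bsub>Ho n\<^esub> f \<in> lin_maps A (Fr n) T"
    unfolding lin_maps_iff using c
    by (auto simp: Ho_simps intro!: lin_onI simp: Fr.smult_closed lin_on_mem[OF lf] kQ_closed kQ_distr kQ_smult
      lin_on_add[OF lf] lin_on_smult[OF lf])
qed

definition "Zc n = Ext_cocycles A G T TG T n"
definition "Bd n = Ext_coboundaries A G T TG T n"

lemma Zc_iff: "f \<in> Zc n \<longleftrightarrow> f \<in> lin_maps A (Fr n) T \<and> (\<forall>z\<in>cyc n. f z = \<zero>\<^bsub>T\<^esub>)"
proof -
  have "f \<in> Zc n \<longleftrightarrow> f \<in> lin_maps A (Fr n) T \<and> (\<forall>p\<in>carrier (Fr (Suc n)). f (dif n p) = \<zero>\<^bsub>T\<^esub>)"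
    by (simp add: Zc_def Ext_cocycles_def std_term_eq std_diff_eq)
  also have "(\<forall>p\<in>carrier (Fr (Suc n)). f (dif n p) = \<zero>\<^bsub>T\<^esub>) \<longleftrightarrow> (\<forall>z\<in>cyc n. f z = \<zero>\<^bsub>T\<^esub>)"
    using dif_onto dif_cyc by metis
  finally show ?thesis .
qed

lemma Zc_submodule: "submodule (Zc n) K (Ho n)"
proof (rule Ho.submodI)
  note L = lin_maps_submodule[of n]
  have c: "z \<in> carrier (Fr n)" if "z \<in> cyc n" for z using that cyc_subset by blast
  show "Zc n \<subseteq> carrier (Ho n)" using Ho.submod_subset[OF L] by (auto simp: Zc_iff)
  show "\<zero>\<^bsub>Ho n\<^esub> \<in> Zc n" using Ho.submod_zero[OF L] c by (simp add: Zc_iff) (simp add: Ho_simps)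
  show "f \<oplus>\<^bsub>Ho n\<^esub> g \<in> Zc n" if "f \<in> Zc n" "g \<in> Zc n" for f g
    using that Ho.submod_add[OF L] c by (simp add: Zc_iff) (simp add: Ho_simps)
  show "a \<odot>\<^bsub>Ho n\<^esub> f \<in> Zc n" if "a \<in> carrier K" "f \<in> Zc n" for a f
    using that Ho.submod_smult[OF L] c by (simp add: Zc_iff) (simp add: Ho_simps kQ_null)
qed

lemma Bd_0: "Bd 0 = {\<zero>\<^bsub>Ho 0\<^esub>}"
  by (simp add: Bd_def std_term_eq Ho_simps)

lemma Bd_Suc: "Bd (Suc n) = (\<lambda>g. compose (carrier (Fr (Suc n))) g (dif n)) ` lin_maps A (Fr n) T"
  by (simp add: Bd_def std_term_eq std_diff_eq)

lemma Bd_submodule: "submodule (Bd n) K (Ho n)"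
proof (cases n)
  case 0
  then show ?thesis using Ho.submod_null by (simp add: Bd_0)
next
  case (Suc m)
  have dm: "dif m x \<in> carrier (Fr m)" if "x \<in> carrier (Fr (Suc m))" for x using lin_on_mem[OF dif_linear that] .
  have "lin_on K (Ho m) (lin_maps A (Fr m) T) (Ho (Suc m)) (carrier (Ho (Suc m))) (\<lambda>g. compose (carrier (Fr (Suc m))) g (dif m))"
    using dm by (intro lin_onI) (auto simp: Ho_simps compose_def fun_eq_iff lin_maps_def PiE_iff)
  from submod_image[OF left_module_Ho left_module_Ho lin_maps_submodule Ho.submod_carrier_self this]
  show ?thesis by (simp add: Suc Bd_Suc)
qed

lemma Bd_Zc: "Bd n \<subseteq> Zc n"
proof (cases n)
  case 0
  then show ?thesis using Ho.submod_zero[OF Zc_submodule] by (simp add: Bd_0)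
next
  case (Suc m)
  show ?thesis
  proof
    fix f assume "f \<in> Bd n"
    then obtain g where g: "g \<in> lin_maps A (Fr m) T" "f = compose (carrier (Fr (Suc m))) g (dif m)"
      by (auto simp: Suc Bd_Suc)
    have lg: "lin_on A (Fr m) (carrier (Fr m)) T (carrier T) g" using g(1) by (simp add: lin_maps_iff)
    have "lin_on A (Fr (Suc m)) (carrier (Fr (Suc m))) T (carrier T) f"
      using lin_on_comp[OF dif_linear lg]
      by (auto simp: g(2) compose_def lin_on_def Fr.smult_closed)
    moreover have "f z = \<zero>\<^bsub>T\<^esub>" if "z \<in> cyc (Suc m)" for z
      using that lin_on_zero[OF left_module_Fr left_module_trivial Fr.submod_carrier_self T.submod_carrier_self lg]
      by (simp add: g(2) cyc_Suc compose_def)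
    ultimately show "f \<in> Zc n" unfolding Suc Zc_iff lin_maps_iff by (simp add: g(2))
  qed
qed

lemma Ext_component_eq: "Ext_algebra_component A G n = quot_module ((Ho n)\<lparr>carrier := Zc n\<rparr>) (Bd n)"
proof -
  have "(Hom_module A (std_term A G T TG n) T (smult kQ))\<lparr>carrier := Zc n\<rparr> = (Ho n)\<lparr>carrier := Zc n\<rparr>"
    by (simp add: Hom_module_def Ho_def prod_module_def T_kQ std_term_eq)
  then show ?thesis by (simp add: Ext_algebra_component_def Ext_def Zc_def Bd_def)
qed

lemma left_module_Zc: "left_module K ((Ho n)\<lparr>carrier := Zc n\<rparr>)"
  by (rule left_module_submodule[OF left_module_Ho Zc_submodule])

lemma Bd_restrict: "submodule (Bd n) K ((Ho n)\<lparr>carrier := Zc n\<rparr>)"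
  by (rule submodule_restrict[OF left_module_Ho Zc_submodule Bd_submodule Bd_Zc])

lemma left_module_Ext: "left_module K (Ext_algebra_component A G n)"
  unfolding Ext_component_eq by (rule left_module_quot[OF left_module_Zc Bd_restrict])

text \<open>Up to coboundaries a cocycle is determined by its values at the points
  \<open>e i\<close>, each of them in a line over \<open>K\<close>, so
  \<open>span_evaluations\<close> applies.\<close>

lemma Ext_generates_evaluations:
  assumes fld: "field K" and conn: "G 0 = (\<lambda>c. c \<odot> \<one>) ` carrier K"
    and e: "\<And>i. i < r \<Longrightarrow> e i \<in> carrier (Fr n)"
    and ker: "\<And>f. f \<in> Zc n \<Longrightarrow> (\<And>i. i < r \<Longrightarrow> f (e i) = \<zero>\<^bsub>T\<^esub>) \<Longrightarrow> f \<in> Bd n"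
  shows "\<exists>B. generates K (Ext_algebra_component A G n) B \<and> card B \<le> r"
proof -
  let ?V = "(Ho n)\<lparr>carrier := Zc n\<rparr>"
  interpret V: left_module K ?V by (rule left_module_Zc)
  have val: "f x \<in> carrier kQ" if "f \<in> Zc n" "x \<in> carrier (Fr n)" for f x
    using that unfolding T_kQ[symmetric] by (auto simp: Zc_iff lin_maps_def)
  have ev: "lin_on K ?V (carrier ?V) kQ (carrier kQ) (\<lambda>f. f (e i))" if "i < r" for i
    using e[OF that] val by (intro lin_onI) (simp_all add: Ho_simps T_kQ)
  have ker': "f \<in> Bd n" if "f \<in> carrier ?V" "\<And>i. i < r \<Longrightarrow> f (e i) = \<zero>\<^bsub>kQ\<^esub>" for f
    using ker[of f] that by (simp add: T_kQ)
  obtain B where B: "finite B" "card B \<le> r" "B \<subseteq> carrier ?V"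
      "\<And>W. submodule W K ?V \<Longrightarrow> Bd n \<subseteq> W \<Longrightarrow> B \<subseteq> W \<Longrightarrow> carrier ?V \<subseteq> W"
    using span_evaluations[where ev = "\<lambda>i f. f (e i)" and r = r and U = "Bd n", OF left_module_Zc left_module_kQ kQ_line[OF fld conn] ev
        V.submod_carrier_self ker'] by blast
  have "generates K (Ext_algebra_component A G n) ((\<lambda>x. Bd n +>\<^bsub>?V\<^esub> x) ` B)"
    unfolding Ext_component_eq by (rule generates_quot[OF left_module_Zc Bd_restrict B(1,3,4)])
  moreover have "card ((\<lambda>x. Bd n +>\<^bsub>?V\<^esub> x) ` B) \<le> r" using card_image_le[OF B(1)] B(2) by (rule order_trans)
  ultimately show ?thesis by blast
qed

text \<open>\<open>case_nat 1 f\<close> lists the ranks for the trivial module: 1 in degree 0, then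
  those of its syzygy, the augmentation ideal. In positive degree the evaluation points come from
  \<open>cocycle_coboundary\<close>.\<close>

lemma Ext_generates:
  assumes fld: "field K" and conn: "G 0 = (\<lambda>c. c \<odot> \<one>) ` carrier K"
    and res: "\<And>n. resolvable A {\<zero>} n f (fI A (aug_ideal A G) 1) {\<lambda>_. \<zero>}"
  shows "\<exists>B. generates K (Ext_algebra_component A G n) B \<and> card B \<le> case_nat 1 f n"
proof (cases n)
  case 0
  let ?\<epsilon> = "free_lift A (gens 0) T gen_elt"
  have o: "aug_ideal A G +>\<^bsub>regular_module A\<^esub> \<one> \<in> carrier T" (is "?o \<in> _") by (auto simp: trivial_module_def)
  \<comment> \<open>In degree 0 one evaluation point is enough: a cocycle vanishes on the kernel of
    the augmentation, so it is determined by its value at a preimage of the coset of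
    \<open>\<one>\<close>, which generates \<open>T\<close>.\<close>
  obtain p where p: "p \<in> carrier (Fr 0)" "?\<epsilon> p = ?o" using aug_onto[OF o] by blast
  have "h \<in> Bd 0" if h: "h \<in> Zc 0" and hp: "h p = \<zero>\<^bsub>T\<^esub>" for h
  proof -
    have lh: "lin_on A (Fr 0) (carrier (Fr 0)) T (carrier T) h" "h \<in> extensional (carrier (Fr 0))"
      and hz: "\<And>z. z \<in> cyc 0 \<Longrightarrow> h z = \<zero>\<^bsub>T\<^esub>" using h by (auto simp: Zc_iff lin_maps_iff)
    have "h x = \<zero>\<^bsub>T\<^esub>" if x: "x \<in> carrier (Fr 0)" for x
    proof -
      have ex: "?\<epsilon> x \<in> carrier T" using lin_on_mem[OF aug_lift x] .
      obtain a where a: "a \<in> carrier A" "?\<epsilon> x = aug_ideal A G +>\<^bsub>regular_module A\<^esub> a" using T_elem[OF ex] by blast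
      have "a \<odot>\<^bsub>T\<^esub> ?o = ?\<epsilon> x"
        using quot_smult[OF left_module_regular ring_ideal_submodule[OF ring_axioms ideal_aug], of "\<one>" a] a
        by (simp add: trivial_module_def)
      then have ea: "?\<epsilon> (a \<odot>\<^bsub>Fr 0\<^esub> p) = ?\<epsilon> x" using lin_on_smult[OF aug_lift a(1) p(1)] p(2) by simp
      have ap: "a \<odot>\<^bsub>Fr 0\<^esub> p \<in> carrier (Fr 0)" using Fr.smult_closed[OF a(1) p(1)] .
      have d: "x \<ominus>\<^bsub>Fr 0\<^esub> a \<odot>\<^bsub>Fr 0\<^esub> p \<in> carrier (Fr 0)" using x ap by simp
      have "?\<epsilon> (x \<ominus>\<^bsub>Fr 0\<^esub> a \<odot>\<^bsub>Fr 0\<^esub> p) = ?\<epsilon> x \<ominus>\<^bsub>T\<^esub> ?\<epsilon> (a \<odot>\<^bsub>Fr 0\<^esub> p)"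
        by (rule lin_on_minus[OF left_module_Fr left_module_trivial Fr.submod_carrier_self T.submod_carrier_self aug_lift x ap])
      also have "\<dots> = \<zero>\<^bsub>T\<^esub>" unfolding ea a_minus_def by (rule T.M.r_neg[OF ex])
      finally have "x \<ominus>\<^bsub>Fr 0\<^esub> a \<odot>\<^bsub>Fr 0\<^esub> p \<in> cyc 0" using d by (simp add: cyc_0)
      then have 1: "h (x \<ominus>\<^bsub>Fr 0\<^esub> a \<odot>\<^bsub>Fr 0\<^esub> p) = \<zero>\<^bsub>T\<^esub>" by (rule hz)
      have 2: "h (a \<odot>\<^bsub>Fr 0\<^esub> p) = \<zero>\<^bsub>T\<^esub>" using lin_on_smult[OF lh(1) a(1) p(1)] hp a(1) by (simp add: T.smult_r_null)
      have "h x = h (a \<odot>\<^bsub>Fr 0\<^esub> p \<oplus>\<^bsub>Fr 0\<^esub> (x \<ominus>\<^bsub>Fr 0\<^esub> a \<odot>\<^bsub>Fr 0\<^esub> p))" using Fr.add_minus_cancel[OF x ap] by simp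
      also have "\<dots> = \<zero>\<^bsub>T\<^esub>" unfolding lin_on_add[OF lh(1) ap d] 1 2 by simp
      finally show ?thesis .
    qed
    then have "h = (\<lambda>x\<in>carrier (Fr 0). \<zero>\<^bsub>T\<^esub>)" using lh(2) by (auto simp: extensional_def fun_eq_iff)
    then show ?thesis by (simp add: Bd_0 Ho_simps)
  qed
  then show ?thesis
    using Ext_generates_evaluations[OF fld conn, of 1 "\<lambda>_. p" 0] p(1) 0 by auto
next
  case (Suc m)
  obtain X k p where X: "subm X" "X \<subseteq> fr A k" "covers A (f m) p X {\<lambda>_. \<zero>}"
     "stable_retract A (Fr m) (carrier (Fr m)) (cyc m) (seqs A) (fr A k) X"
    using std_stable_retract[OF res, of m] by blast
  obtain e where e: "\<And>i. i < f m \<Longrightarrow> e i \<in> carrier (Fr (Suc m))"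
    and cb: "\<And>h. lin_on A (Fr (Suc m)) (carrier (Fr (Suc m))) T (carrier T) h \<Longrightarrow> (\<forall>z\<in>cyc (Suc m). h z = \<zero>\<^bsub>T\<^esub>) \<Longrightarrow>
      (\<forall>i<f m. h (e i) = \<zero>\<^bsub>T\<^esub>) \<Longrightarrow>
      \<exists>g. lin_on A (Fr m) (carrier (Fr m)) T (carrier T) g \<and> (\<forall>x\<in>carrier (Fr (Suc m)). h x = g (dif m x))"
    using cocycle_coboundary[OF X] by blast
  have "h \<in> Bd (Suc m)" if h: "h \<in> Zc (Suc m)" and he: "\<And>i. i < f m \<Longrightarrow> h (e i) = \<zero>\<^bsub>T\<^esub>" for h
  proof -
    have lh: "lin_on A (Fr (Suc m)) (carrier (Fr (Suc m))) T (carrier T) h" "h \<in> extensional (carrier (Fr (Suc m)))"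
      "\<forall>z\<in>cyc (Suc m). h z = \<zero>\<^bsub>T\<^esub>" using h by (auto simp: Zc_iff lin_maps_iff)
    obtain g where g: "lin_on A (Fr m) (carrier (Fr m)) T (carrier T) g"
      "\<And>x. x \<in> carrier (Fr (Suc m)) \<Longrightarrow> h x = g (dif m x)" using cb[OF lh(1,3)] he by blast
    have "restrict g (carrier (Fr m)) \<in> lin_maps A (Fr m) T" by (rule restrict_lin_maps[OF left_module_Fr g(1)])
    moreover have "h = compose (carrier (Fr (Suc m))) (restrict g (carrier (Fr m))) (dif m)"
      using g(2) lh(2) lin_on_mem[OF dif_linear] by (auto simp: compose_def extensional_def fun_eq_iff)
    ultimately show ?thesis unfolding Bd_Suc by blast
  qed
  then show ?thesis
    using Ext_generates_evaluations[OF fld conn e] Suc by auto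
qed

end

text \<open>The exponent comes from two crude bounds for n at least 2: n + 1 is at most n^2, and c
  is at most n^c. For m = 0 the logarithm is minus infinity by definition.\<close>

lemma log_enat_le:
  assumes n: "2 \<le> n" and m: "m \<le> enat (c * (n + 1) ^ e)"
  shows "log_enat n m \<le> ereal (c + 2 * e)"
proof (cases m)
  case (enat r)
  show ?thesis
  proof (cases "r = 0")
    case False
    have "n + 1 \<le> 2 * n" using n by simp
    also have "\<dots> \<le> n ^ 2" unfolding power2_eq_square using n by (rule mult_le_mono1)
    finally have "(n + 1) ^ e \<le> n ^ (2 * e)" by (simp add: power_mono power_mult)
    moreover have "c \<le> n ^ c"
      using less_exp[of c] power_mono[OF n, of c] by linarith
    ultimately have "c * (n + 1) ^ e \<le> n ^ c * n ^ (2 * e)" by (rule mult_le_mono[rotated])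
    then have "r \<le> n ^ (c + 2 * e)" using m enat by (simp add: power_add)
    then have "real r \<le> real n ^ (c + 2 * e)" by (metis of_nat_le_iff of_nat_power)
    then have "log (real n) (real r) \<le> log (real n) (real n ^ (c + 2 * e))"
      using n False by (intro log_mono) auto
    also have "\<dots> = real (c + 2 * e)" using n by (simp add: log_nat_power)
    finally show ?thesis using False by (simp add: log_enat_def enat)
  qed (simp add: log_enat_def enat)
qed (use m in simp)

theorem theorem0p1:
  fixes K :: "'k ring"
    and A :: "('k, 'a) module" and AG :: "nat \<Rightarrow> 'a set"
    and C :: "('k, 'c) module" and CG :: "nat \<Rightarrow> 'c set"
    and \<Omega>s :: "'c list" and \<phi> :: "'c set \<Rightarrow> 'a"
  assumes "field K" and "char_zero K"
    and "connected_graded K A AG"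
    and "connected_graded K C CG" and "noetherian C" and "AS_regular K C CG"
    and "regular_normalizing_sequence C \<Omega>s"
    and "\<forall>\<Omega>\<in>set \<Omega>s. \<exists>i>0. \<Omega> \<in> CG i"
    and "graded_algebra_iso K (quot_module C (Idl\<^bsub>C\<^esub> (set \<Omega>s)))
           (quot_grading C CG (Idl\<^bsub>C\<^esub> (set \<Omega>s))) A AG \<phi>"
  shows "GK_dim K (Ext_algebra_component A AG) < \<infinity>"
proof -
  have gC: "graded_algebra K C CG" and gA: "graded_algebra K A AG"
    and conn: "AG 0 = (\<lambda>c. c \<odot>\<^bsub>A\<^esub> \<one>\<^bsub>A\<^esub>) ` carrier K"
    using assms(3,4) by (auto simp: connected_graded_def)
  have K: "ring K" using assms(1) by (simp add: field_def domain_def cring_def)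
  interpret C: graded K C CG by standard (rule gC)
  interpret A: graded K A AG by standard (rule gA)
  let ?I = "Idl\<^bsub>C\<^esub> (set \<Omega>s)"
  have noeth: "left_noetherian C" using assms(5) by (simp add: noetherian_def)
  have gl: "gl_dim C < \<infinity>" using assms(6) by (simp add: AS_regular_def)
  have inf: "infinite (UNIV :: 'c set)" by (rule infinite_connected_graded[OF assms(1,2,4)])
  obtain f c e where f: "\<And>n. f n \<le> c * (n + 1) ^ e"
    "\<And>n. resolvable C ?I n f (fI C (aug_ideal C CG) 1) (fI C ?I 1)"
    using C.regular_sequence_resolvable[OF inf noeth gl assms(7,8) order_refl] by auto
  have "set \<Omega>s \<subseteq> aug_ideal C CG"
    using assms(8) by (auto simp: C.aug_ideal_iff C.hc_homogeneous C.G_carrier)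
  then have Im: "?I \<subseteq> aug_ideal C CG" by (rule C.genideal_minimal[OF C.ideal_aug])
  have "set \<Omega>s \<subseteq> carrier C" using assms(8) C.G_carrier by blast
  then have I: "ideal ?I C" by (rule C.genideal_ideal)
  have res: "resolvable A {\<zero>\<^bsub>A\<^esub>} n f (fI A (aug_ideal A AG) 1) {\<lambda>_. \<zero>\<^bsub>A\<^esub>}" for n
    by (rule graded_iso_resolvable[OF gC gA I assms(9) Im f(2)])
  let ?E = "Ext_algebra_component A AG"
  obtain B where B: "\<And>i. generates K (?E i) (B i)" "\<And>i. card (B i) \<le> case_nat 1 f i"
    using A.Ext_generates[OF assms(1) conn res] by metis
  have Bf: "finite (B i)" for i using B(1)[of i] by (simp add: generates_def)
  \<comment> \<open>Each of the \<open>n + 1\<close> components is bounded by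
    \<open>(c + 1) * (n + 1) ^ e\<close>, so the sum raises the exponent by one. The constant is
    \<open>c + 1\<close> so that it also covers the rank 1 in degree 0, about which \<open>f\<close>
    says nothing.\<close>
  have dim: "vs_dim K (direct_sum {0..n} ?E) \<le> enat ((c + 1) * (n + 1) ^ (e + 1))" for n
  proof -
    let ?B = "\<Union>i\<in>{0..n}. summand_incl {0..n} ?E i ` B i"
    have "generates K (direct_sum {0..n} ?E) ?B"
      by (rule generates_direct_sum[OF K finite_atLeastAtMost A.left_module_Ext B(1)])
    then have "vs_dim K (direct_sum {0..n} ?E) \<le> enat (card ?B)"
      by (rule vs_dim_generates[OF assms(1) left_module_direct_sum[OF K A.left_module_Ext]])
    moreover have "card ?B \<le> (c + 1) * (n + 1) ^ (e + 1)"
    proof -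
      have "card ?B \<le> (\<Sum>i\<in>{0..n}. card (summand_incl {0..n} ?E i ` B i))" by (rule card_UN_le) simp
      also have "\<dots> \<le> (\<Sum>i\<in>{0..n}. (c + 1) * (n + 1) ^ e)"
      proof (rule sum_mono)
        fix i assume i: "i \<in> {0..n}"
        have "card (summand_incl {0..n} ?E i ` B i) \<le> case_nat 1 f i" using card_image_le[OF Bf] B(2) by (rule order_trans)
        also have "\<dots> \<le> (c + 1) * (n + 1) ^ e"
        proof (cases i)
          case (Suc j)
          have "f j \<le> c * (j + 1) ^ e" by (rule f(1))
          also have "\<dots> \<le> (c + 1) * (n + 1) ^ e" using i Suc by (intro mult_le_mono power_mono) auto
          finally show ?thesis using Suc by simp
        next
          case 0
          have "0 < (c + 1) * (n + 1) ^ e" by simp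
          then show ?thesis using 0 by (simp add: Suc_le_eq)
        qed
        finally show "card (summand_incl {0..n} ?E i ` B i) \<le> (c + 1) * (n + 1) ^ e" .
      qed
      also have "\<dots> = (c + 1) * (n + 1) ^ (e + 1)" by (simp add: algebra_simps)
      finally show ?thesis .
    qed
    ultimately show ?thesis by (meson enat_ord_simps(1) order_trans)
  qed
  have "GK_dim K ?E \<le> ereal (c + 1 + 2 * (e + 1))"
    unfolding GK_dim_def
  proof (rule Limsup_bounded)
    show "\<forall>\<^sub>F n in sequentially. log_enat n (vs_dim K (direct_sum {0..n} ?E)) \<le> ereal (c + 1 + 2 * (e + 1))"
      \<comment> \<open>\<open>log_enat_le\<close> applies from \<open>n = 2\<close> on, which is
        enough for the limit superior.\<close>
      using eventually_ge_at_top[of 2] by eventually_elim (use log_enat_le[OF _ dim] in simp)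
  qed
  then show ?thesis by (rule le_less_trans) simp
qed

end
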